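(* Let $a\in\mathbb{R}$, $\mu_1,\mu_2\in\mathbb{R}$, $\sigma_1,\sigma_2>0$ and $q>0$. Let $X$ be the unique strong solution of $$\mathrm{d} X_t=(\mu_1 \mathbf{1}_{\{X_t \le a\}}+\mu_2 \mathbf{1}_{\{X_t> a\}})\,\mathrm{d} t+(\sigma_1\mathbf{1}_{\{X_t\le a\}}+\sigma_2\mathbf{1}_{\{X_t> a\}})\,\mathrm{d} B_t ,$$ and let $e_q$ be an exponential random variable with rate $q$ independent of $X$. Then for any starting point $x\ge a$, $$\mathbb{P}_{x}\left(X_{e_q} \in \mathrm{d}z \right)=\frac{q}{\sqrt{2q\sigma_1^2+\mu_1^2}}\,\frac{\delta_1^++\delta_1^-}{\delta_2^++\delta_1^-}\, e^{-\delta_2^+(x-a)}e^{\delta_1^+(z-a)}\,\mathrm{d}z , \qquad z<a.$$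
   Context: $B$ is a standard one-dimensional Brownian motion on a complete filtered probability space satisfying the usual conditions; $\mathbb{P}_x$ denotes the law under which $X_0=x$. It is known that the stochastic differential equation has a unique strong solution. For $i=1,2$, $$\delta_i^{+}:=\frac{\sqrt{2q\sigma_i^2+\mu_i^2}+\mu_i}{\sigma_i^2},\qquad \delta_i^{-}:=\frac{\sqrt{2q\sigma_i^2+\mu_i^2}-\mu_i}{\sigma_i^2}.$$ An identity $\mathbb{P}_x(X_{e_q}\in\mathrm{d}z)=f(z)\,\mathrm{d}z$ on a set of $z$ means that the law of $X_{e_q}$ restricted to that set is absolutely continuous with density $f$. Since $e_q$ is independent of $X$, $\mathbb{P}_{x}(X_{e_q}\in \mathrm{d}z)=\int_0^\infty qe^{-qt}\,\mathbb{P}_x(X_t\in \mathrm{d}z)\,\mathrm{d} t$. *)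

theory Defs
  imports "HOL-Probability.Probability"
begin

text \<open>
  Time is \<^term>\<open>{0..}\<close> inside \<^typ>\<open>real\<close>.  The library locale \<^locale>\<open>filtration\<close> indexes
  a filtration by the whole type; its members at negative times play no role
  (any filtration on \<^term>\<open>{0..}\<close> extends by its value at time 0).
\<close>

locale usual_filtered_prob_space =
  prob_space M + complete_measure M + filtration "space M" F
  for M :: "'w measure" and F :: "real \<Rightarrow> 'w measure" +
  assumes sets_F_subset: "\<And>t. sets (F t) \<subseteq> sets M"
    and null_sets_subset: "null_sets M \<subseteq> sets (F 0)"
    and right_continuous: "\<And>t. 0 \<le> t \<Longrightarrow> sets (F t) = (\<Inter>s\<in>{t<..}. sets (F s))"

text \<open>The \<open>\<sigma>\<close>-algebra on \<open>\<Omega>\<close> generated by the random variables \<open>X s\<close>, \<open>s \<in> I\<close>.\<close>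

definition path_algebra :: "'w set \<Rightarrow> real set \<Rightarrow> (real \<Rightarrow> 'w \<Rightarrow> real) \<Rightarrow> 'w measure" where
  "path_algebra \<Omega> I X =
     vimage_algebra \<Omega> (\<lambda>\<omega>. \<lambda>s\<in>I. X s \<omega>) (Pi\<^sub>M I (\<lambda>_. borel))"

definition augmented_filtration :: "'w measure \<Rightarrow> (real \<Rightarrow> 'w \<Rightarrow> real) \<Rightarrow> real \<Rightarrow> 'w measure" where
  "augmented_filtration M X t =
     sigma (space M) (sets (path_algebra (space M) {0..t} X) \<union> null_sets M)"

definition brownian_motion ::
  "'w measure \<Rightarrow> (real \<Rightarrow> 'w measure) \<Rightarrow> (real \<Rightarrow> 'w \<Rightarrow> real) \<Rightarrow> bool" where
  "brownian_motion M F B \<longleftrightarrow>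
     (\<forall>t\<ge>0. B t \<in> borel_measurable (F t)) \<and>
     (\<forall>\<omega>\<in>space M. continuous_on {0..} (\<lambda>t. B t \<omega>)) \<and>
     (AE \<omega> in M. B 0 \<omega> = 0) \<and>
     (\<forall>s t. 0 \<le> s \<and> s < t \<longrightarrow>
        distributed M lborel (\<lambda>\<omega>. B t \<omega> - B s \<omega>) (normal_density 0 (sqrt (t - s))) \<and>
        prob_space.indep_set M (sets (F s))
          (sets (vimage_algebra (space M) (\<lambda>\<omega>. B t \<omega> - B s \<omega>) borel)))"

text \<open>
  A simple integrand on \<open>[0, T]\<close> is given by a partition \<open>\<tau> 0 \<le> \<dots> \<le> \<tau> n\<close> and bounded
  \<open>F (\<tau> i)\<close>-measurable weights \<open>\<xi> i\<close> on the intervals \<open>(\<tau> i, \<tau> (i + 1)]\<close>.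
\<close>

definition simple_integrand ::
  "(real \<Rightarrow> 'w measure) \<Rightarrow> real \<Rightarrow> nat \<Rightarrow> (nat \<Rightarrow> real) \<Rightarrow> (nat \<Rightarrow> 'w \<Rightarrow> real) \<Rightarrow> bool" where
  "simple_integrand F T n \<tau> \<xi> \<longleftrightarrow>
     0 \<le> \<tau> 0 \<and> (\<forall>i<n. \<tau> i \<le> \<tau> (Suc i)) \<and> \<tau> n \<le> T \<and>
     (\<forall>i<n. \<xi> i \<in> borel_measurable (F (\<tau> i)) \<and> bounded (\<xi> i ` space (F (\<tau> i))))"

definition simple_process ::
  "nat \<Rightarrow> (nat \<Rightarrow> real) \<Rightarrow> (nat \<Rightarrow> 'w \<Rightarrow> real) \<Rightarrow> real \<Rightarrow> 'w \<Rightarrow> real" where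
  "simple_process n \<tau> \<xi> t \<omega> = (\<Sum>i<n. \<xi> i \<omega> * indicator {\<tau> i<..\<tau> (Suc i)} t)"

definition simple_integral ::
  "(real \<Rightarrow> 'w \<Rightarrow> real) \<Rightarrow> nat \<Rightarrow> (nat \<Rightarrow> real) \<Rightarrow> (nat \<Rightarrow> 'w \<Rightarrow> real) \<Rightarrow> 'w \<Rightarrow> real" where
  "simple_integral B n \<tau> \<xi> \<omega> = (\<Sum>i<n. \<xi> i \<omega> * (B (\<tau> (Suc i)) \<omega> - B (\<tau> i) \<omega>))"

definition progressive_on ::
  "(real \<Rightarrow> 'w measure) \<Rightarrow> real \<Rightarrow> (real \<Rightarrow> 'w \<Rightarrow> real) \<Rightarrow> bool" where
  "progressive_on F T H \<longleftrightarrow>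
     (\<forall>t\<in>{0..T}. (\<lambda>(s, \<omega>). H s \<omega>) \<in> borel_measurable (restrict_space borel {0..t} \<Otimes>\<^sub>M F t))"

text \<open>
  \<open>has_ito_integral M F B T H J\<close>: the random variable \<open>J\<close> is (a version of) the Ito integral
  of \<open>H\<close> against \<open>B\<close> over \<open>[0, T]\<close>, for progressively measurable \<open>H\<close> that is square integrable on
  \<open>[0, T] \<times> \<Omega>\<close>, i.e. \<open>J\<close> is the \<open>L\<^sup>2\<close>-limit of the integrals of simple integrands converging
  to \<open>H\<close> in \<open>L\<^sup>2([0, T] \<times> \<Omega>)\<close>.  By the Ito isometry, \<open>J\<close> exists for every such \<open>H\<close> and does not
  depend, up to null sets, on the approximating sequence.
\<close>

definition has_ito_integral ::
  "'w measure \<Rightarrow> (real \<Rightarrow> 'w measure) \<Rightarrow> (real \<Rightarrow> 'w \<Rightarrow> real) \<Rightarrow> real \<Rightarrow>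
   (real \<Rightarrow> 'w \<Rightarrow> real) \<Rightarrow> ('w \<Rightarrow> real) \<Rightarrow> bool" where
  "has_ito_integral M F B T H J \<longleftrightarrow>
     progressive_on F T H \<and>
     (\<integral>\<^sup>+\<omega>. (\<integral>\<^sup>+s\<in>{0..T}. ennreal ((H s \<omega>)\<^sup>2) \<partial>lborel) \<partial>M) < \<infinity> \<and>
     J \<in> borel_measurable M \<and>
     (\<exists>n \<tau> \<xi>.
        (\<forall>k. simple_integrand F T (n k) (\<tau> k) (\<xi> k)) \<and>
        (\<lambda>k. \<integral>\<^sup>+\<omega>. (\<integral>\<^sup>+s\<in>{0..T}.
            ennreal ((simple_process (n k) (\<tau> k) (\<xi> k) s \<omega> - H s \<omega>)\<^sup>2) \<partial>lborel) \<partial>M)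
          \<longlonglongrightarrow> 0 \<and>
        (\<lambda>k. \<integral>\<^sup>+\<omega>. ennreal ((simple_integral B (n k) (\<tau> k) (\<xi> k) \<omega> - J \<omega>)\<^sup>2) \<partial>M)
          \<longlonglongrightarrow> 0)"

text \<open>
  Strong solution of \<open>dX\<^sub>t = b(X\<^sub>t) dt + v(X\<^sub>t) dB\<^sub>t\<close>, \<open>X\<^sub>0 = x\<close>: a continuous process, adapted to the
  augmentation of the filtration generated by \<open>B\<close>, satisfying the integral equation.  The Ito
  integral is the one for square-integrable integrands, which is the general one
  whenever \<open>v\<close> is bounded.  Equality at each time suffices, since for an \<open>X\<close> with continuous
  paths it gives equality for all times simultaneously with the continuous version of the
  right-hand side.
\<close>

definition strong_solution ::
  "'w measure \<Rightarrow> (real \<Rightarrow> 'w measure) \<Rightarrow> (real \<Rightarrow> 'w \<Rightarrow> real) \<Rightarrow>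
   (real \<Rightarrow> real) \<Rightarrow> (real \<Rightarrow> real) \<Rightarrow> real \<Rightarrow> (real \<Rightarrow> 'w \<Rightarrow> real) \<Rightarrow> bool" where
  "strong_solution M F B b v x X \<longleftrightarrow>
     (\<forall>t\<ge>0. X t \<in> borel_measurable (augmented_filtration M B t)) \<and>
     (\<forall>\<omega>\<in>space M. continuous_on {0..} (\<lambda>t. X t \<omega>)) \<and>
     (AE \<omega> in M. X 0 \<omega> = x) \<and>
     (\<forall>t\<ge>0. AE \<omega> in M. set_integrable lborel {0..t} (\<lambda>s. b (X s \<omega>))) \<and>
     (\<forall>t\<ge>0. \<exists>J. has_ito_integral M F B t (\<lambda>s \<omega>. v (X s \<omega>)) J \<and>
        (AE \<omega> in M. X t \<omega> = x + (LINT s:{0..t}|lborel. b (X s \<omega>)) + J \<omega>))"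

definition delta_plus :: "real \<Rightarrow> real \<Rightarrow> real \<Rightarrow> real" where
  "delta_plus q \<mu> \<sigma> = (sqrt (2 * q * \<sigma>\<^sup>2 + \<mu>\<^sup>2) + \<mu>) / \<sigma>\<^sup>2"

definition delta_minus :: "real \<Rightarrow> real \<Rightarrow> real \<Rightarrow> real" where
  "delta_minus q \<mu> \<sigma> = (sqrt (2 * q * \<sigma>\<^sup>2 + \<mu>\<^sup>2) - \<mu>) / \<sigma>\<^sup>2"

end

theory Submission
  imports Defs
begin

text \<open>
  Let \<open>L\<close> be the generator \<open>b \<partial> + v\<^sup>2/2 \<partial>\<^sup>2\<close>.  For smooth \<open>\<phi>\<close>, a second order Taylor expansion over one
  short time step gives \<open>E \<phi>(X\<^sub>t) - E \<phi>(X\<^sub>s) = \<integral>\<^sub>s\<^sup>t E (L\<phi>)(X\<^sub>r) dr + O((t - s)\<^sup>3\<^sup>/\<^sup>2)\<close>.  The increments of the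
  difference of the two sides being superlinear, it is constant in \<open>t\<close>: this is Dynkin's formula,
  without any Ito calculus beyond the isometry and a fourth moment bound.  Its Laplace transform reads
  \<open>E (\<phi> - L\<phi>/q)(X\<^sub>e) = \<phi>(x)\<close>.  By averaging over short intervals this extends to every
  bounded \<open>C\<^sup>1\<close> function \<open>u\<close> with bounded Lipschitz derivative, where \<open>u''\<close> is read as a left derivative; since
  \<open>b\<close> and \<open>v\<close> take at \<open>a\<close> their values from the left, this is the right reading.  The explicit bounded solution \<open>u\<close> of \<open>u - Lu/q = 1\<^bsub>(-\<infinity>, z]\<^esub>\<close> then gives \<open>P\<^sub>x(X\<^sub>e \<le> z) = u(x)\<close>.
\<close>

section \<open>Brownian increments and simple integrals\<close>

text \<open>The coefficients jump at \<open>a\<close>, so \<open>b\<close> and \<open>v\<close> must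
  never be compared at two different positions. The Taylor step therefore freezes only the
  derivatives of the test function at time s; \<open>b\<close> and the square of \<open>v\<close>
  stay at the running time r inside the time integral. Freezing costs the Lipschitz constants of
  these derivatives times E|X_r - X_s|, which is of order sqrt(r - s). The second order term carries
  a weight known at time s, and the isometry with such a weight turns it into a time integral. A
  second obstacle is that \<open>has_ito_integral\<close> speaks of one horizon at a time: the
  integrals over [0, s] and [0, t] come with unrelated approximations, and additivity in time has to
  be recovered from the isometry. The third absolute moment of a simple integral is controlled by
  its second and fourth moments. The latter is of the right order (t - s)^2 only for uniformly
  bounded weights, hence the truncation of weights at \<open>K\<close>.\<close>

lemma (in prob_space) indep_var_of_indep_set:
  assumes ind: "indep_set \<A> (sets (vimage_algebra (space M) Y T))"
    and X: "X \<in> measurable N S" "space N = space M" "sets N = \<A>" and "S_ok": "X \<in> measurable M S"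
    and Y: "Y \<in> measurable M T"
  shows "indep_var S X T Y"
  unfolding indep_var_eq
proof (intro conjI)
  show "X \<in> measurable M S" "Y \<in> measurable M T" by fact+
  have 1: "sigma_sets (space M) {X -` A \<inter> space M |A. A \<in> sets S} \<subseteq> \<A>"
  proof -
    have "{X -` A \<inter> space M |A. A \<in> sets S} \<subseteq> sets N"
      using measurable_sets[OF X(1)] X(2) by auto
    then show ?thesis
      using sets.sigma_sets_subset[of _ N] X(2,3) by auto
  qed
  have 2: "sigma_sets (space M) {Y -` A \<inter> space M |A. A \<in> sets T} = sets (vimage_algebra (space M) Y T)"
    by (rule sets_vimage_algebra[symmetric])
  show "indep_set (sigma_sets (space M) {X -` A \<inter> space M |A. A \<in> sets S})
     (sigma_sets (space M) {Y -` A \<inter> space M |A. A \<in> sets T})"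
    unfolding 2 indep_set_def
    using ind[unfolded indep_set_def]
    by (rule indep_sets_mono_sets) (use 1 in \<open>auto split: bool.split\<close>)
qed

locale brownian_space = usual_filtered_prob_space M F
  for M :: "'w measure" and F :: "real \<Rightarrow> 'w measure" +
  fixes B :: "real \<Rightarrow> 'w \<Rightarrow> real"
  assumes brownian: "brownian_motion M F B"
begin

lemma F_mono: "s \<le> t \<Longrightarrow> f \<in> borel_measurable (F s) \<Longrightarrow> f \<in> borel_measurable (F t)"
  using measurable_mono[OF order_refl refl sets_F_mono, of s t borel] by (auto simp: space_F)

lemma F_meas: "f \<in> borel_measurable (F s) \<Longrightarrow> f \<in> borel_measurable M"
  using measurable_mono[OF order_refl refl sets_F_subset, of s borel] by (auto simp: space_F)

lemma B_adapted: "0 \<le> s \<Longrightarrow> s \<le> t \<Longrightarrow> B s \<in> borel_measurable (F t)"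
  using brownian F_mono[of s t "B s"] by (auto simp: brownian_motion_def)

lemma B_meas: "0 \<le> t \<Longrightarrow> B t \<in> borel_measurable M"
  using B_adapted[of t t] F_meas by auto

lemma increment_moments:
  assumes "0 \<le> s" "s \<le> t"
  shows "integrable M (\<lambda>\<omega>. (B t \<omega> - B s \<omega>) ^ k)"
    and "expectation (\<lambda>\<omega>. B t \<omega> - B s \<omega>) = 0"
    and "expectation (\<lambda>\<omega>. (B t \<omega> - B s \<omega>) ^ 2) = t - s"
    and "expectation (\<lambda>\<omega>. (B t \<omega> - B s \<omega>) ^ 3) = 0"
    and "expectation (\<lambda>\<omega>. (B t \<omega> - B s \<omega>) ^ 4) = 3 * (t - s)\<^sup>2"
proof -
  have "integrable M (\<lambda>\<omega>. (B t \<omega> - B s \<omega>) ^ k) \<and> expectation (\<lambda>\<omega>. B t \<omega> - B s \<omega>) = 0 \<and>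
    expectation (\<lambda>\<omega>. (B t \<omega> - B s \<omega>) ^ 2) = t - s \<and> expectation (\<lambda>\<omega>. (B t \<omega> - B s \<omega>) ^ 3) = 0 \<and>
    expectation (\<lambda>\<omega>. (B t \<omega> - B s \<omega>) ^ 4) = 3 * (t - s)\<^sup>2"
  \<comment> \<open>The definition of Brownian motion speaks of s < t only; an increment of length
    zero has no density.\<close>
  proof (cases "s = t")
    case True
    then show ?thesis by (cases k) auto
  next
    case False
    with assms have st: "s < t" by auto
    define \<sigma> where "\<sigma> = sqrt (t - s)"
    have \<sigma>: "0 < \<sigma>" "\<sigma>\<^sup>2 = t - s" using st by (auto simp: \<sigma>_def)
    have D: "distributed M lborel (\<lambda>\<omega>. B t \<omega> - B s \<omega>) (normal_density 0 \<sigma>)"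
      using brownian assms st by (auto simp: brownian_motion_def \<sigma>_def)
    have E: "expectation (\<lambda>\<omega>. (B t \<omega> - B s \<omega>) ^ k) = integral\<^sup>L lborel (\<lambda>x. normal_density 0 \<sigma> x * x ^ k)" for k
      using distributed_integral[OF D, of "\<lambda>x. x ^ k"] by (simp add: normal_density_nonneg)
    have I: "integrable M (\<lambda>\<omega>. (B t \<omega> - B s \<omega>) ^ k)"
      using distributed_integrable[OF D, of "\<lambda>x. x ^ k"] integrable_normal_moment[OF \<sigma>(1), of 0 k]
      by (simp add: normal_density_nonneg)
    have "expectation (\<lambda>\<omega>. (B t \<omega> - B s \<omega>) ^ 1) = 0"
      unfolding E using integral_normal_moment_odd[OF \<sigma>(1), of 0 0] by simp
    moreover have "expectation (\<lambda>\<omega>. (B t \<omega> - B s \<omega>) ^ 3) = 0"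
      unfolding E using integral_normal_moment_odd[OF \<sigma>(1), of 0 1] by (simp add: numeral_eq_Suc)
    moreover have "expectation (\<lambda>\<omega>. (B t \<omega> - B s \<omega>) ^ 2) = t - s"
      unfolding E using integral_normal_moment_even[OF \<sigma>(1), of 0 1] \<sigma> by simp
    moreover have "expectation (\<lambda>\<omega>. (B t \<omega> - B s \<omega>) ^ 4) = 3 * (t - s)\<^sup>2"
      unfolding E using integral_normal_moment_even[OF \<sigma>(1), of 0 2, unfolded \<sigma>(2)] st
      by (simp add: fact_numeral power_divide)
    ultimately show ?thesis using I by simp
  qed
  then show "integrable M (\<lambda>\<omega>. (B t \<omega> - B s \<omega>) ^ k)"
    and "expectation (\<lambda>\<omega>. B t \<omega> - B s \<omega>) = 0"
    and "expectation (\<lambda>\<omega>. (B t \<omega> - B s \<omega>) ^ 2) = t - s"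
    and "expectation (\<lambda>\<omega>. (B t \<omega> - B s \<omega>) ^ 3) = 0"
    and "expectation (\<lambda>\<omega>. (B t \<omega> - B s \<omega>) ^ 4) = 3 * (t - s)\<^sup>2"
    by auto
qed

text \<open>Independence of the increment from \<open>F s\<close> gives the product rule.
  \<open>G\<close> is merely integrable, not bounded, so that it may contain powers of an earlier
  simple integral.\<close>

lemma increment_indep:
  assumes "0 \<le> s" "s \<le> t" "G \<in> borel_measurable (F s)" "integrable M G"
  shows "integrable M (\<lambda>\<omega>. G \<omega> * (B t \<omega> - B s \<omega>) ^ k)"
    and "expectation (\<lambda>\<omega>. G \<omega> * (B t \<omega> - B s \<omega>) ^ k) = expectation G * expectation (\<lambda>\<omega>. (B t \<omega> - B s \<omega>) ^ k)"
proof -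
  have "integrable M (\<lambda>\<omega>. G \<omega> * (B t \<omega> - B s \<omega>) ^ k) \<and>
    expectation (\<lambda>\<omega>. G \<omega> * (B t \<omega> - B s \<omega>) ^ k) = expectation G * expectation (\<lambda>\<omega>. (B t \<omega> - B s \<omega>) ^ k)"
  proof (cases "s = t")
    case True
    then show ?thesis using assms by (cases k) (auto simp: prob_space)
  next
    case False
    with assms have st: "s < t" by auto
    have [measurable]: "B s \<in> borel_measurable M" "B t \<in> borel_measurable M"
      using assms by (auto intro!: B_meas)
    have "indep_set (sets (F s)) (sets (vimage_algebra (space M) (\<lambda>\<omega>. B t \<omega> - B s \<omega>) borel))"
      using brownian assms st by (auto simp: brownian_motion_def)
    then have "indep_var borel G borel (\<lambda>\<omega>. B t \<omega> - B s \<omega>)"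
      by (rule indep_var_of_indep_set[OF _ assms(3)]) (auto simp: space_F intro: F_meas[OF assms(3)])
    then have "indep_var borel ((\<lambda>x. x) \<circ> G) borel ((\<lambda>x. x ^ k) \<circ> (\<lambda>\<omega>. B t \<omega> - B s \<omega>))"
      by (rule indep_var_compose) auto
    then have iv: "indep_var borel G borel (\<lambda>\<omega>. (B t \<omega> - B s \<omega>) ^ k)" by (simp add: o_def)
    show ?thesis
      using indep_var_integrable[OF iv assms(4) increment_moments(1)[OF assms(1,2)]]
        indep_var_lebesgue_integral[OF iv assms(4) increment_moments(1)[OF assms(1,2)]] by simp
  qed
  then show "integrable M (\<lambda>\<omega>. G \<omega> * (B t \<omega> - B s \<omega>) ^ k)"
    and "expectation (\<lambda>\<omega>. G \<omega> * (B t \<omega> - B s \<omega>) ^ k) = expectation G * expectation (\<lambda>\<omega>. (B t \<omega> - B s \<omega>) ^ k)"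
    by auto
qed

text \<open>The weights of simple integrands, detached from a partition, so that arbitrary families
  of intervals can be treated.\<close>

definition adm :: "real \<Rightarrow> ('w \<Rightarrow> real) \<Rightarrow> bool" where
  "adm u \<xi> \<longleftrightarrow> \<xi> \<in> borel_measurable (F u) \<and> bounded (\<xi> ` space M)"

lemma adm_mono: "adm u \<xi> \<Longrightarrow> u \<le> v \<Longrightarrow> adm v \<xi>"
  by (auto simp: adm_def intro: F_mono)

lemma adm_mult: "adm u \<xi> \<Longrightarrow> adm u \<eta> \<Longrightarrow> adm u (\<lambda>\<omega>. \<xi> \<omega> * \<eta> \<omega>)"
proof -
  assume a: "adm u \<xi>" "adm u \<eta>"
  then obtain C D where "\<forall>\<omega>\<in>space M. \<bar>\<xi> \<omega>\<bar> \<le> C" "\<forall>\<omega>\<in>space M. \<bar>\<eta> \<omega>\<bar> \<le> D"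
    by (auto simp: adm_def bounded_iff)
  then have "\<forall>\<omega>\<in>space M. \<bar>\<xi> \<omega> * \<eta> \<omega>\<bar> \<le> C * D"
    unfolding abs_mult using abs_ge_zero order_trans by (blast intro: mult_mono)
  with a show ?thesis by (auto simp: adm_def bounded_iff)
qed

lemma adm_integrable: "adm u \<xi> \<Longrightarrow> integrable M \<xi>"
proof -
  assume a: "adm u \<xi>"
  then obtain C where "\<And>\<omega>. \<omega> \<in> space M \<Longrightarrow> norm (\<xi> \<omega>) \<le> C" by (auto simp: adm_def bounded_iff)
  then show "integrable M \<xi>"
    using a by (intro integrable_const_bound[of _ C]) (auto simp: adm_def intro: F_meas)
qed

text \<open>For \<open>t1 \<le> t2\<close>, split the longer increment at \<open>t1\<close>: this
  leaves the square of the shorter one, plus its product with an increment after \<open>t1\<close>,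
  which has mean zero and is independent of \<open>F t1\<close>.\<close>

lemma increment_cross:
  assumes "adm s G" "0 \<le> s" "s \<le> t1" "s \<le> t2"
  shows "integrable M (\<lambda>\<omega>. G \<omega> * ((B t1 \<omega> - B s \<omega>) * (B t2 \<omega> - B s \<omega>)))"
    and "expectation (\<lambda>\<omega>. G \<omega> * ((B t1 \<omega> - B s \<omega>) * (B t2 \<omega> - B s \<omega>))) = expectation G * (min t1 t2 - s)"
proof -
  have *: "integrable M (\<lambda>\<omega>. G \<omega> * ((B t1 \<omega> - B s \<omega>) * (B t2 \<omega> - B s \<omega>))) \<and>
    expectation (\<lambda>\<omega>. G \<omega> * ((B t1 \<omega> - B s \<omega>) * (B t2 \<omega> - B s \<omega>))) = expectation G * (t1 - s)"
    if t: "s \<le> t1" "t1 \<le> t2" for t1 t2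
  proof -
    have t0: "0 \<le> t1" using t assms by auto
    note G = adm_integrable[OF assms(1)] assms(1)[unfolded adm_def, THEN conjunct1]
    note sq = increment_indep[OF assms(2) t(1) G(2,1), of 2]
    note i1 = increment_indep(1)[OF assms(2) t(1) G(2,1), of 1]
    have [measurable]: "G \<in> borel_measurable (F t1)" "B t1 \<in> borel_measurable (F t1)"
       "B s \<in> borel_measurable (F t1)"
      using F_mono[OF t(1) G(2)] B_adapted assms t by auto
    have m: "(\<lambda>\<omega>. G \<omega> * (B t1 \<omega> - B s \<omega>) ^ 1) \<in> borel_measurable (F t1)"
      by measurable
    note cr = increment_indep[OF t0 t(2) m i1, of 1]
    have eq: "G \<omega> * ((B t1 \<omega> - B s \<omega>) * (B t2 \<omega> - B s \<omega>)) =
      G \<omega> * (B t1 \<omega> - B s \<omega>)\<^sup>2 + G \<omega> * (B t1 \<omega> - B s \<omega>) ^ 1 * (B t2 \<omega> - B t1 \<omega>) ^ 1" for \<omega>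
      by (simp add: power2_eq_square algebra_simps)
    show ?thesis
      unfolding eq using sq cr increment_moments(2)[OF t0 t(2)] increment_moments(3)[OF assms(2) t(1)]
      by auto
  qed
  show "integrable M (\<lambda>\<omega>. G \<omega> * ((B t1 \<omega> - B s \<omega>) * (B t2 \<omega> - B s \<omega>)))"
    using *[of t1 t2] *[of t2 t1] assms by (cases "t1 \<le> t2") (auto simp: mult.commute)
  show "expectation (\<lambda>\<omega>. G \<omega> * ((B t1 \<omega> - B s \<omega>) * (B t2 \<omega> - B s \<omega>))) = expectation G * (min t1 t2 - s)"
    using *[of t1 t2] *[of t2 t1] assms by (cases "t1 \<le> t2") (auto simp: mult.commute min_def)
qed

text \<open>By symmetry let \<open>u \<le> u'\<close>. What the first interval has before
  \<open>u'\<close> is known at time \<open>u'\<close> and multiplies an increment of mean zero;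
  what it has after \<open>u'\<close> shares its left end with the second interval, which is the
  case of \<open>increment_cross\<close>.\<close>

lemma increment_pair:
  assumes "adm u \<xi>" "0 \<le> u" "u \<le> v" "adm u' \<eta>" "0 \<le> u'" "u' \<le> v'"
  shows "integrable M (\<lambda>\<omega>. \<xi> \<omega> * (B v \<omega> - B u \<omega>) * (\<eta> \<omega> * (B v' \<omega> - B u' \<omega>)))"
    and "expectation (\<lambda>\<omega>. \<xi> \<omega> * (B v \<omega> - B u \<omega>) * (\<eta> \<omega> * (B v' \<omega> - B u' \<omega>)))
      = expectation (\<lambda>\<omega>. \<xi> \<omega> * \<eta> \<omega>) * measure lborel ({u<..v} \<inter> {u'<..v'})"
proof -
  have *: "integrable M (\<lambda>\<omega>. \<xi> \<omega> * (B v \<omega> - B u \<omega>) * (\<eta> \<omega> * (B v' \<omega> - B u' \<omega>))) \<and>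
     expectation (\<lambda>\<omega>. \<xi> \<omega> * (B v \<omega> - B u \<omega>) * (\<eta> \<omega> * (B v' \<omega> - B u' \<omega>)))
      = expectation (\<lambda>\<omega>. \<xi> \<omega> * \<eta> \<omega>) * measure lborel ({u<..v} \<inter> {u'<..v'})"
    if a: "adm u \<xi>" "0 \<le> u" "u \<le> v" "adm u' \<eta>" "0 \<le> u'" "u' \<le> v'" "u \<le> u'" for u v u' v' \<xi> \<eta>
  proof -
    have p: "adm u' (\<lambda>\<omega>. \<xi> \<omega> * \<eta> \<omega>)" using adm_mono[OF a(1,7)] a(4) by (rule adm_mult)
    have I: "{u<..v} \<inter> {u'<..v'} = {u'<..min v v'}" using a by auto
    \<comment> \<open>Used with \<open>w = v\<close> for disjoint intervals and with
      \<open>w = u'\<close> for overlapping ones.\<close>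
    have h: "integrable M (\<lambda>\<omega>. \<xi> \<omega> * \<eta> \<omega> * (B w \<omega> - B u \<omega>) * (B v' \<omega> - B u' \<omega>)) \<and>
       expectation (\<lambda>\<omega>. \<xi> \<omega> * \<eta> \<omega> * (B w \<omega> - B u \<omega>) * (B v' \<omega> - B u' \<omega>)) = 0"
      if w: "u \<le> w" "w \<le> u'" for w
    proof -
      obtain C where C: "\<And>\<omega>. \<omega> \<in> space M \<Longrightarrow> \<bar>\<xi> \<omega> * \<eta> \<omega>\<bar> \<le> C"
        using p by (auto simp: adm_def bounded_iff)
      have [measurable]: "\<xi> \<in> borel_measurable (F u')" "\<eta> \<in> borel_measurable (F u')"
        "B u \<in> borel_measurable (F u')" "B w \<in> borel_measurable (F u')"
        using a adm_mono[OF a(1,7)] B_adapted w by (auto simp: adm_def)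
      have m: "(\<lambda>\<omega>. \<xi> \<omega> * \<eta> \<omega> * (B w \<omega> - B u \<omega>)) \<in> borel_measurable (F u')" by measurable
      have i: "integrable M (\<lambda>\<omega>. \<xi> \<omega> * \<eta> \<omega> * (B w \<omega> - B u \<omega>))"
      proof (rule Bochner_Integration.integrable_bound)
        show "integrable M (\<lambda>\<omega>. C * (B w \<omega> - B u \<omega>))"
          using increment_moments(1)[OF a(2) w(1), of 1] by simp
        show "(\<lambda>\<omega>. \<xi> \<omega> * \<eta> \<omega> * (B w \<omega> - B u \<omega>)) \<in> borel_measurable M" using F_meas[OF m] .
        show "AE \<omega> in M. norm (\<xi> \<omega> * \<eta> \<omega> * (B w \<omega> - B u \<omega>)) \<le> norm (C * (B w \<omega> - B u \<omega>))"
          using C by (auto simp: abs_mult intro!: mult_right_mono AE_I2) fastforce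
      qed
      show ?thesis
        using increment_indep[OF a(5,6) m i, of 1] increment_moments(2)[OF a(5,6)] by simp
    qed
    show ?thesis
    proof (cases "v \<le> u'")
      case True
      then show ?thesis using h[of v] a I by (simp add: mult_ac)
    next
      case False
      then have v: "u' \<le> v" by auto
      have eq: "\<xi> \<omega> * (B v \<omega> - B u \<omega>) * (\<eta> \<omega> * (B v' \<omega> - B u' \<omega>)) =
        \<xi> \<omega> * \<eta> \<omega> * (B u' \<omega> - B u \<omega>) * (B v' \<omega> - B u' \<omega>) +
        \<xi> \<omega> * \<eta> \<omega> * ((B v \<omega> - B u' \<omega>) * (B v' \<omega> - B u' \<omega>))" for \<omega>
        by (simp add: algebra_simps)
      show ?thesis unfolding eq I
        using h[of u'] a increment_cross[OF p a(5) v a(6)] v by (auto simp: min_def)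
    qed
  qed
  have eq: "\<xi> \<omega> * (B v \<omega> - B u \<omega>) * (\<eta> \<omega> * (B v' \<omega> - B u' \<omega>)) = \<eta> \<omega> * (B v' \<omega> - B u' \<omega>) * (\<xi> \<omega> * (B v \<omega> - B u \<omega>))" for \<omega>
    by simp
  show "integrable M (\<lambda>\<omega>. \<xi> \<omega> * (B v \<omega> - B u \<omega>) * (\<eta> \<omega> * (B v' \<omega> - B u' \<omega>)))"
    using *[OF assms] *[OF assms(4-6,1-3)] by (cases "u \<le> u'") (auto simp: eq)
  show "expectation (\<lambda>\<omega>. \<xi> \<omega> * (B v \<omega> - B u \<omega>) * (\<eta> \<omega> * (B v' \<omega> - B u' \<omega>)))
      = expectation (\<lambda>\<omega>. \<xi> \<omega> * \<eta> \<omega>) * measure lborel ({u<..v} \<inter> {u'<..v'})"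
    using *[OF assms] *[OF assms(4-6,1-3)] by (cases "u \<le> u'") (auto simp: eq mult.commute Int_commute)
qed

end

section \<open>The Ito isometry for families of intervals\<close>

context brownian_space
begin

text \<open>
  The intervals may overlap, so the difference of simple integrals over unrelated partitions is
  covered without passing to a common refinement.
\<close>

lemma simple_isometry:
  fixes I :: "'i set" and J :: "'j set"
  assumes "finite I" "\<And>i. i \<in> I \<Longrightarrow> adm (u i) (\<xi> i) \<and> 0 \<le> u i \<and> u i \<le> v i"
    and "finite J" "\<And>j. j \<in> J \<Longrightarrow> adm (u' j) (\<eta> j) \<and> 0 \<le> u' j \<and> u' j \<le> v' j"
  shows "integrable M (\<lambda>\<omega>. (\<Sum>i\<in>I. \<xi> i \<omega> * (B (v i) \<omega> - B (u i) \<omega>)) * (\<Sum>j\<in>J. \<eta> j \<omega> * (B (v' j) \<omega> - B (u' j) \<omega>)))"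
    and "integrable M (\<lambda>\<omega>. LINT r|lborel. (\<Sum>i\<in>I. \<xi> i \<omega> * indicator {u i<..v i} r) * (\<Sum>j\<in>J. \<eta> j \<omega> * indicator {u' j<..v' j} r))"
    and "expectation (\<lambda>\<omega>. (\<Sum>i\<in>I. \<xi> i \<omega> * (B (v i) \<omega> - B (u i) \<omega>)) * (\<Sum>j\<in>J. \<eta> j \<omega> * (B (v' j) \<omega> - B (u' j) \<omega>)))
      = expectation (\<lambda>\<omega>. LINT r|lborel. (\<Sum>i\<in>I. \<xi> i \<omega> * indicator {u i<..v i} r) * (\<Sum>j\<in>J. \<eta> j \<omega> * indicator {u' j<..v' j} r))"
    and "integrable lborel (\<lambda>r. (\<Sum>i\<in>I. \<xi> i \<omega> * indicator {u i<..v i} r) * (\<Sum>j\<in>J. \<eta> j \<omega> * indicator {u' j<..v' j} r))"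
proof -
  let ?S = "\<lambda>\<omega>. \<Sum>i\<in>I. \<xi> i \<omega> * (B (v i) \<omega> - B (u i) \<omega>)" and ?T = "\<lambda>\<omega>. \<Sum>j\<in>J. \<eta> j \<omega> * (B (v' j) \<omega> - B (u' j) \<omega>)"
  let ?P = "\<lambda>\<omega> r :: real. \<Sum>i\<in>I. \<xi> i \<omega> * indicator {u i<..v i} r" and ?Q = "\<lambda>\<omega> r :: real. \<Sum>j\<in>J. \<eta> j \<omega> * indicator {u' j<..v' j} r"
  have e1: "?S \<omega> * ?T \<omega> =
    (\<Sum>i\<in>I. \<Sum>j\<in>J. \<xi> i \<omega> * (B (v i) \<omega> - B (u i) \<omega>) * (\<eta> j \<omega> * (B (v' j) \<omega> - B (u' j) \<omega>)))" for \<omega>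
    by (simp add: sum_product)
  have e2: "?P \<omega> r * ?Q \<omega> r
     = (\<Sum>i\<in>I. \<Sum>j\<in>J. \<xi> i \<omega> * \<eta> j \<omega> * indicator ({u i<..v i} \<inter> {u' j<..v' j}) r)" for \<omega> r
  proof -
    have "x * indicator A r * (y * indicator C r) = x * y * indicator (A \<inter> C) r" for x y r :: real and A C
      by (simp add: indicator_inter_arith)
    then show ?thesis unfolding sum_product by (intro sum.cong refl)
  qed
  have fin: "emeasure lborel ({u i<..v i} \<inter> {u' j<..v' j}) < \<infinity>" for i j
    by (rule le_less_trans[OF emeasure_mono[of _ "{u i..v i}"]]) (auto simp: emeasure_lborel_Icc_eq)
  have li: "integrable lborel (\<lambda>r. c * indicator ({u i<..v i} \<inter> {u' j<..v' j}) r :: real)" for i j c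
    using fin[of i j] by (intro integrable_mult_right integrable_real_indicator) auto
  have e3: "(LINT r|lborel. ?P \<omega> r * ?Q \<omega> r)
     = (\<Sum>i\<in>I. \<Sum>j\<in>J. \<xi> i \<omega> * \<eta> j \<omega> * measure lborel ({u i<..v i} \<inter> {u' j<..v' j}))" for \<omega>
    unfolding e2
    apply (subst Bochner_Integration.integral_sum, intro Bochner_Integration.integrable_sum li)
    apply (intro sum.cong refl)
    apply (subst Bochner_Integration.integral_sum, rule li)
    apply (intro sum.cong refl)
    apply (simp del: Int_greaterThanAtMost)
    done
  have adm: "integrable M (\<lambda>\<omega>. \<xi> i \<omega> * \<eta> j \<omega>)" if "i \<in> I" "j \<in> J" for i j
    using adm_mono[of "u i" "\<xi> i" "max (u i) (u' j)"] adm_mono[of "u' j" "\<eta> j" "max (u i) (u' j)"] assms that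
    by (intro adm_integrable adm_mult) auto
  note P = increment_pair
  show "integrable M (\<lambda>\<omega>. ?S \<omega> * ?T \<omega>)"
    unfolding e1 using assms by (intro Bochner_Integration.integrable_sum P) auto
  show "integrable M (\<lambda>\<omega>. LINT r|lborel. ?P \<omega> r * ?Q \<omega> r)"
    unfolding e3 by (intro Bochner_Integration.integrable_sum integrable_mult_left adm)
  show "integrable lborel (\<lambda>r. ?P \<omega> r * ?Q \<omega> r)"
    unfolding e2 by (intro Bochner_Integration.integrable_sum li)
  have "expectation (\<lambda>\<omega>. ?S \<omega> * ?T \<omega>)
    = (\<Sum>i\<in>I. \<Sum>j\<in>J. expectation (\<lambda>\<omega>. \<xi> i \<omega> * \<eta> j \<omega>) * measure lborel ({u i<..v i} \<inter> {u' j<..v' j}))"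
    unfolding e1
    apply (subst Bochner_Integration.integral_sum)
     apply (intro Bochner_Integration.integrable_sum P; use assms in auto)
    apply (intro sum.cong refl)
    apply (subst Bochner_Integration.integral_sum)
     apply (intro P; use assms in auto)
    apply (intro sum.cong refl P; use assms in auto)
    done
  also have "\<dots> = expectation (\<lambda>\<omega>. LINT r|lborel. ?P \<omega> r * ?Q \<omega> r)"
    unfolding e3
    apply (subst Bochner_Integration.integral_sum)
     apply (intro Bochner_Integration.integrable_sum integrable_mult_left adm; simp)
    apply (intro sum.cong refl)
    apply (subst Bochner_Integration.integral_sum)
     apply (intro integrable_mult_left adm; simp)
    apply (intro sum.cong refl)
    apply simp
    done
  finally show "expectation (\<lambda>\<omega>. ?S \<omega> * ?T \<omega>)
      = expectation (\<lambda>\<omega>. LINT r|lborel. ?P \<omega> r * ?Q \<omega> r)" .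
qed

text \<open>The definition of the Ito integral measures distances by nonnegative integrals, hence
  this form of the isometry for a family paired with itself.\<close>

lemma simple_isometry_nn:
  fixes I :: "'i set"
  assumes I: "finite I" "\<And>i. i \<in> I \<Longrightarrow> adm (u i) (\<xi> i) \<and> 0 \<le> u i \<and> u i \<le> v i"
  shows "(\<integral>\<^sup>+\<omega>. ennreal ((\<Sum>i\<in>I. \<xi> i \<omega> * (B (v i) \<omega> - B (u i) \<omega>))\<^sup>2) \<partial>M) =
    (\<integral>\<^sup>+\<omega>. (\<integral>\<^sup>+r. ennreal ((\<Sum>i\<in>I. \<xi> i \<omega> * indicator {u i<..v i} r)\<^sup>2) \<partial>lborel) \<partial>M)"
proof -
  let ?S = "\<lambda>\<omega>. \<Sum>i\<in>I. \<xi> i \<omega> * (B (v i) \<omega> - B (u i) \<omega>)" and ?P = "\<lambda>\<omega> r :: real. \<Sum>i\<in>I. \<xi> i \<omega> * indicator {u i<..v i} r"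
  note S = simple_isometry[where u=u and \<xi>=\<xi> and v=v and u'=u and \<eta>=\<xi> and v'=v and I=I and J=I, OF I I]
  have 1: "(\<integral>\<^sup>+r. ennreal ((?P \<omega> r)\<^sup>2) \<partial>lborel) =
    ennreal (LINT r|lborel. ?P \<omega> r * ?P \<omega> r)" for \<omega>
    unfolding power2_eq_square by (rule nn_integral_eq_integral[OF S(4)]) auto
  have nn: "0 \<le> (LINT r|lborel. ?P \<omega> r * ?P \<omega> r)" for \<omega>
    by (rule integral_nonneg_AE) auto
  have "(\<integral>\<^sup>+\<omega>. ennreal ((?S \<omega>)\<^sup>2) \<partial>M) =
     ennreal (expectation (\<lambda>\<omega>. ?S \<omega> * ?S \<omega>))"
    unfolding power2_eq_square by (rule nn_integral_eq_integral[OF S(1)]) auto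
  also note S(3)
  also have "ennreal (expectation (\<lambda>\<omega>. LINT r|lborel. ?P \<omega> r * ?P \<omega> r))
     = (\<integral>\<^sup>+\<omega>. (\<integral>\<^sup>+r. ennreal ((?P \<omega> r)\<^sup>2) \<partial>lborel) \<partial>M)"
    unfolding 1 by (subst nn_integral_eq_integral[OF S(2)]) (use nn in auto)
  finally show ?thesis .
qed

end

section \<open>Simple processes at a fixed time, and truncation\<close>

lemma partition_mono:
  fixes \<tau> :: "nat \<Rightarrow> real"
  assumes "\<And>i. i < n \<Longrightarrow> \<tau> i \<le> \<tau> (Suc i)" "i \<le> j" "j \<le> n"
  shows "\<tau> i \<le> \<tau> j"
  using assms(2,3)
proof (induction j rule: dec_induct)
  case (step k)
  then show ?case using assms(1)[of k] by auto
qed auto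

lemma simple_process_cases:
  fixes \<tau> :: "nat \<Rightarrow> real"
  assumes "\<And>i. i < n \<Longrightarrow> \<tau> i \<le> \<tau> (Suc i)"
  shows "(\<forall>i<n. r \<notin> {\<tau> i<..\<tau> (Suc i)}) \<or>
    (\<exists>j<n. r \<in> {\<tau> j<..\<tau> (Suc j)} \<and> (\<forall>i<n. i \<noteq> j \<longrightarrow> r \<notin> {\<tau> i<..\<tau> (Suc i)}))"
proof -
  note mono = partition_mono[where \<tau>=\<tau> and n=n, OF assms]
  have "i = j" if "i < n" "j < n" "r \<in> {\<tau> i<..\<tau> (Suc i)}" "r \<in> {\<tau> j<..\<tau> (Suc j)}" for i j
  proof (rule ccontr)
    assume "i \<noteq> j"
    then have "Suc i \<le> j \<or> Suc j \<le> i" by auto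
    with that mono[of "Suc i" j] mono[of "Suc j" i] show False by auto
  qed
  then show ?thesis by blast
qed

text \<open>The intervals of a partition are disjoint, so at time \<open>r\<close> at most one
  weight is visible, and its index depends on the partition alone, not on \<open>\<xi>\<close>.
  Hence applying a function that fixes 0 to the weights is the same as applying it to the
  process.\<close>

lemma simple_process_select:
  assumes "\<And>i. i < n \<Longrightarrow> \<tau> i \<le> \<tau> (Suc i)"
  obtains "\<And>\<xi> (\<omega> :: 'w). simple_process n \<tau> \<xi> r \<omega> = 0"
  | j where "j < n" "\<And>\<xi> (\<omega> :: 'w). simple_process n \<tau> \<xi> r \<omega> = \<xi> j \<omega>"
proof -
  from simple_process_cases[where \<tau>=\<tau> and n=n and r=r, OF assms]
  consider "\<forall>i<n. r \<notin> {\<tau> i<..\<tau> (Suc i)}" |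
    j where "j < n" "r \<in> {\<tau> j<..\<tau> (Suc j)}" "\<forall>i<n. i \<noteq> j \<longrightarrow> r \<notin> {\<tau> i<..\<tau> (Suc i)}" by auto
  then show thesis
  proof cases
    case 1
    then have "simple_process n \<tau> \<xi> r \<omega> = 0" for \<xi> :: "nat \<Rightarrow> 'w \<Rightarrow> real" and \<omega>
      unfolding simple_process_def by (intro sum.neutral) auto
    then show thesis by (rule that(1))
  next
    case (2 j)
    have "simple_process n \<tau> \<xi> r \<omega> = \<xi> j \<omega>" for \<xi> :: "nat \<Rightarrow> 'w \<Rightarrow> real" and \<omega>
    proof -
      have "simple_process n \<tau> \<xi> r \<omega> = (\<Sum>i<n. if i = j then \<xi> j \<omega> else 0)"
        unfolding simple_process_def using 2 by (intro sum.cong) (auto split: split_indicator)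
      then show ?thesis using 2(1) by simp
    qed
    then show thesis using that(2) 2(1) by blast
  qed
qed

lemma sq_sum3: "(x + y + z)\<^sup>2 \<le> 3 * (x\<^sup>2 + y\<^sup>2 + (z::real)\<^sup>2)"
proof -
  have "0 \<le> (x - y)\<^sup>2 + (y - z)\<^sup>2 + (z - x)\<^sup>2" by simp
  then show ?thesis by (simp add: power2_eq_square algebra_simps)
qed

lemma sq_diff2: "(x - y)\<^sup>2 \<le> 2 * ((x - z)\<^sup>2 + (y - (z::real))\<^sup>2)"
proof -
  have "0 \<le> ((x - z) + (y - z))\<^sup>2" by simp
  then show ?thesis by (simp add: power2_eq_square algebra_simps)
qed

definition clamp :: "real \<Rightarrow> real \<Rightarrow> real" where "clamp K y = max (- K) (min K y)"

text \<open>Clamping is the projection onto an interval that contains \<open>h\<close>.\<close>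

lemma clamp_dist: "\<bar>h\<bar> \<le> K \<Longrightarrow> \<bar>clamp K y - h\<bar> \<le> \<bar>y - h\<bar>"
  unfolding clamp_def by linarith

lemma clamp_bound: "0 \<le> K \<Longrightarrow> \<bar>clamp K y\<bar> \<le> K"
  by (auto simp: clamp_def)

section \<open>Increments of Ito integrals as limits of single simple integrals\<close>

context brownian_space
begin

lemma simple_integrand_adm:
  "simple_integrand F T n \<tau> \<xi> \<Longrightarrow> i < n \<Longrightarrow> adm (\<tau> i) (\<xi> i) \<and> 0 \<le> \<tau> i \<and> \<tau> i \<le> \<tau> (Suc i) \<and> \<tau> (Suc i) \<le> T"
proof -
  assume a: "simple_integrand F T n \<tau> \<xi>" "i < n"
  then have "\<And>i. i < n \<Longrightarrow> \<tau> i \<le> \<tau> (Suc i)" by (simp add: simple_integrand_def)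
  note mono = partition_mono[where \<tau>=\<tau> and n=n, OF this]
  show ?thesis using a mono[of 0 i] mono[of "Suc i" n]
    by (auto simp: simple_integrand_def adm_def space_F)
qed

lemma ito_approx:
  assumes "has_ito_integral M F B T H J" "0 < \<gamma>"
  obtains n \<tau> \<xi> where "simple_integrand F T n \<tau> \<xi>"
    "(\<integral>\<^sup>+\<omega>. (\<integral>\<^sup>+r\<in>{0..T}. ennreal ((simple_process n \<tau> \<xi> r \<omega> - H r \<omega>)\<^sup>2) \<partial>lborel) \<partial>M) \<le> \<gamma>"
    "(\<integral>\<^sup>+\<omega>. ennreal ((simple_integral B n \<tau> \<xi> \<omega> - J \<omega>)\<^sup>2) \<partial>M) \<le> \<gamma>"
proof -
  from assms(1) obtain n \<tau> \<xi> where si: "\<And>k. simple_integrand F T (n k) (\<tau> k) (\<xi> k)"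
    and l1: "(\<lambda>k. \<integral>\<^sup>+\<omega>. (\<integral>\<^sup>+r\<in>{0..T}. ennreal ((simple_process (n k) (\<tau> k) (\<xi> k) r \<omega> - H r \<omega>)\<^sup>2) \<partial>lborel) \<partial>M) \<longlonglongrightarrow> 0"
    and l2: "(\<lambda>k. \<integral>\<^sup>+\<omega>. ennreal ((simple_integral B (n k) (\<tau> k) (\<xi> k) \<omega> - J \<omega>)\<^sup>2) \<partial>M) \<longlonglongrightarrow> 0"
    unfolding has_ito_integral_def by blast
  from eventually_conj[OF order_tendstoD(2)[OF l1 assms(2)] order_tendstoD(2)[OF l2 assms(2)]]
  obtain k where "(\<integral>\<^sup>+\<omega>. (\<integral>\<^sup>+r\<in>{0..T}. ennreal ((simple_process (n k) (\<tau> k) (\<xi> k) r \<omega> - H r \<omega>)\<^sup>2) \<partial>lborel) \<partial>M) < \<gamma> \<and>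
     (\<integral>\<^sup>+\<omega>. ennreal ((simple_integral B (n k) (\<tau> k) (\<xi> k) \<omega> - J \<omega>)\<^sup>2) \<partial>M) < \<gamma>"
    by (auto simp: eventually_sequentially)
  then show thesis by (intro that[OF si]) (auto intro: less_imp_le)
qed

text \<open>
  \<open>J\<close> and \<open>J'\<close> come with unrelated approximating sequences; the isometry for the combined family of
  intervals shows that a single simple integral over \<open>[s, t]\<close> approximates \<open>J - J'\<close>.  Clamping its
  weights to \<open>[-K, K]\<close> brings them no further away from \<open>H\<close> and makes fourth moments available.
\<close>

lemma ito_increment_approx:
  assumes J: "has_ito_integral M F B t H J" and J': "has_ito_integral M F B s H J'"
    and st: "0 \<le> s" "s \<le> t" and K: "0 \<le> K" "\<And>r \<omega>. \<bar>H r \<omega>\<bar> \<le> K"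
    and H: "(\<lambda>(r, \<omega>). H (max 0 r) \<omega>) \<in> borel_measurable (borel \<Otimes>\<^sub>M M)"
    and \<epsilon>: "0 < \<epsilon>"
  obtains n \<rho> \<zeta> where "s \<le> \<rho> 0" "\<And>i. i < n \<Longrightarrow> \<rho> i \<le> \<rho> (Suc i)" "\<rho> n \<le> t"
    "\<And>i. i < n \<Longrightarrow> \<zeta> i \<in> borel_measurable (F (\<rho> i))" "\<And>i \<omega>. \<bar>\<zeta> i \<omega>\<bar> \<le> K"
    "(\<integral>\<^sup>+\<omega>. ennreal ((J \<omega> - J' \<omega> - simple_integral B n \<rho> \<zeta> \<omega>)\<^sup>2) \<partial>M) \<le> ennreal \<epsilon>"
    "(\<integral>\<^sup>+\<omega>. (\<integral>\<^sup>+r\<in>{s<..t}. ennreal ((simple_process n \<rho> \<zeta> r \<omega> - H r \<omega>)\<^sup>2) \<partial>lborel) \<partial>M) \<le> ennreal \<epsilon>"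
proof -
  \<comment> \<open>The final estimate collects 3 (1 + 1 + 4 + 2) = 24 times
    \<open>\<gamma>\<close>.\<close>
  define \<gamma> where "\<gamma> = ennreal (\<epsilon> / 24)"
  have \<gamma>: "0 < \<gamma>" using \<epsilon> by (simp add: \<gamma>_def)
  obtain n \<tau> \<xi> where S: "simple_integrand F t n \<tau> \<xi>"
     and g1: "(\<integral>\<^sup>+\<omega>. (\<integral>\<^sup>+r\<in>{0..t}. ennreal ((simple_process n \<tau> \<xi> r \<omega> - H r \<omega>)\<^sup>2) \<partial>lborel) \<partial>M) \<le> \<gamma>"
     and g2: "(\<integral>\<^sup>+\<omega>. ennreal ((simple_integral B n \<tau> \<xi> \<omega> - J \<omega>)\<^sup>2) \<partial>M) \<le> \<gamma>"
    by (rule ito_approx[OF J \<gamma>]) (rule that)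
  obtain n' \<tau>' \<xi>' where S': "simple_integrand F s n' \<tau>' \<xi>'"
     and g3: "(\<integral>\<^sup>+\<omega>. (\<integral>\<^sup>+r\<in>{0..s}. ennreal ((simple_process n' \<tau>' \<xi>' r \<omega> - H r \<omega>)\<^sup>2) \<partial>lborel) \<partial>M) \<le> \<gamma>"
     and g4: "(\<integral>\<^sup>+\<omega>. ennreal ((simple_integral B n' \<tau>' \<xi>' \<omega> - J' \<omega>)\<^sup>2) \<partial>M) \<le> \<gamma>"
    by (rule ito_approx[OF J' \<gamma>]) (rule that)
  note A = simple_integrand_adm[OF S] and A' = simple_integrand_adm[OF S']
  \<comment> \<open>Raising the partition points to at least \<open>s\<close> empties the intervals
    before \<open>s\<close> and cuts the one across \<open>s\<close>, with no change of indices. The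
    weights stay measurable because points only move to the right.\<close>
  define \<rho> \<zeta> where "\<rho> i = max s (\<tau> i)" and "\<zeta> i \<omega> = clamp K (\<xi> i \<omega>)" for i \<omega>
  let ?P = "simple_process n \<tau> \<xi>" and ?P' = "simple_process n' \<tau>' \<xi>'" and ?Q = "simple_process n \<rho> \<zeta>"
  let ?S = "simple_integral B n \<tau> \<xi>" and ?S' = "simple_integral B n' \<tau>' \<xi>'" and ?R = "simple_integral B n \<rho> \<zeta>"
  have \<zeta>b: "\<bar>\<zeta> i \<omega>\<bar> \<le> K" for i \<omega> using K(1) by (simp add: \<zeta>_def clamp_bound)
  have \<zeta>m: "\<zeta> i \<in> borel_measurable (F (\<rho> i))" if "i < n" for i
  proof -
    have [measurable]: "\<xi> i \<in> borel_measurable (F (\<rho> i))"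
      using A[OF that] by (intro F_mono[of "\<tau> i" "\<rho> i"]) (auto simp: adm_def \<rho>_def)
    show ?thesis unfolding \<zeta>_def clamp_def by measurable
  qed
  have \<zeta>a: "adm (\<rho> i) (\<zeta> i) \<and> 0 \<le> \<rho> i \<and> \<rho> i \<le> \<rho> (Suc i) \<and> \<rho> (Suc i) \<le> t" if "i < n" for i
    using \<zeta>m[OF that] \<zeta>b A[OF that] st by (auto simp: adm_def bounded_iff \<rho>_def)
  have \<rho>n: "\<rho> n \<le> t" using S st by (auto simp: \<rho>_def simple_integrand_def)
  have [measurable]: "\<xi> i \<in> borel_measurable M" "\<zeta> i \<in> borel_measurable M" if "i < n" for i
    using A[OF that] \<zeta>m[OF that] by (auto simp: adm_def intro: F_meas)
  have [measurable]: "\<xi>' i \<in> borel_measurable M" if "i < n'" for i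
    using A'[OF that] by (auto simp: adm_def intro: F_meas)
  have Bm[measurable]: "B (\<tau> i) \<in> borel_measurable M" "B (\<tau> (Suc i)) \<in> borel_measurable M"
    "B (\<rho> i) \<in> borel_measurable M" "B (\<rho> (Suc i)) \<in> borel_measurable M" if "i < n" for i
    using A[OF that] \<zeta>a[OF that] by (auto intro!: B_meas)
  have Bm'[measurable]: "B (\<tau>' i) \<in> borel_measurable M" "B (\<tau>' (Suc i)) \<in> borel_measurable M" if "i < n'" for i
    using A'[OF that] by (auto intro!: B_meas)
  have [measurable]: "J \<in> borel_measurable M" "J' \<in> borel_measurable M"
    using J J' by (auto simp: has_ito_integral_def)
  have SIm[measurable]: "?S \<in> borel_measurable M" "?S' \<in> borel_measurable M"
     "?R \<in> borel_measurable M"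
    unfolding simple_integral_def[abs_def] by measurable
  have SPm[measurable]: "(\<lambda>(\<omega>, r). ?P r \<omega>) \<in> borel_measurable (M \<Otimes>\<^sub>M lborel)"
    "(\<lambda>(\<omega>, r). ?P' r \<omega>) \<in> borel_measurable (M \<Otimes>\<^sub>M lborel)"
    "(\<lambda>(\<omega>, r). ?Q r \<omega>) \<in> borel_measurable (M \<Otimes>\<^sub>M lborel)"
    unfolding simple_process_def[abs_def] by measurable
  \<comment> \<open>Nothing is known of \<open>H\<close> at negative times; \<open>H'\<close> takes
    the value at 0 there and agrees with \<open>H\<close> on all ranges of integration
    below.\<close>
  define H' where "H' \<omega> r = H (max 0 r) \<omega>" for \<omega> r
  have H'm[measurable]: "(\<lambda>(\<omega>, r). H' \<omega> r) \<in> borel_measurable (M \<Otimes>\<^sub>M lborel)"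
  proof -
    have "(\<lambda>(\<omega>, r). (r, \<omega>)) \<in> measurable (M \<Otimes>\<^sub>M lborel) (borel \<Otimes>\<^sub>M M)" by measurable
    from measurable_compose[OF this H] show ?thesis by (simp add: H'_def split_beta')
  qed
  have H': "H r \<omega> = H' \<omega> r" if "0 \<le> r" for r \<omega> using that by (simp add: H'_def)
  have P\<rho>: "?Q r \<omega> = (if s < r then clamp K (?P r \<omega>) else 0)" for r \<omega>
  proof (cases "s < r")
    case True
    then have "?Q r \<omega> = simple_process n \<tau> \<zeta> r \<omega>"
      unfolding simple_process_def \<rho>_def by (intro sum.cong refl arg_cong2[where f="(*)"]) (auto split: split_indicator)
    also have "\<dots> = clamp K (?P r \<omega>)"
    proof (rule simple_process_select[where 'w='w and n=n and \<tau>=\<tau> and r=r])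
      show "\<tau> i \<le> \<tau> (Suc i)" if "i < n" for i using A[OF that] by simp
    qed (use K(1) in \<open>auto simp: \<zeta>_def clamp_def\<close>)
    finally show ?thesis using True by simp
  next
    case False
    then show ?thesis unfolding simple_process_def \<rho>_def by (auto intro!: sum.neutral split: split_indicator)
  qed
  have P0: "?P r \<omega> = 0" if "r \<le> 0 \<or> t < r" for r \<omega>
    unfolding simple_process_def using A that by (intro sum.neutral) (auto split: split_indicator, force+)
  have P'0: "?P' r \<omega> = 0" if "r \<le> 0 \<or> s < r" for r \<omega>
    unfolding simple_process_def using A' that by (intro sum.neutral) (auto split: split_indicator, force+)
  have R0: "?Q r \<omega> = 0" if "r \<le> s \<or> t < r" for r \<omega>
    using that unfolding P\<rho> by (auto simp: P0 clamp_def K(1))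
  let ?D1 = "\<lambda>r \<omega>. (?P r \<omega> - H' \<omega> r)\<^sup>2 * indicator {0..t} r"
  let ?D2 = "\<lambda>r \<omega>. (?P' r \<omega> - H' \<omega> r)\<^sup>2 * indicator {0..s} r"
  let ?I1 = "\<lambda>\<omega>. \<integral>\<^sup>+r. ennreal (?D1 r \<omega>) \<partial>lborel" and ?I2 = "\<lambda>\<omega>. \<integral>\<^sup>+r. ennreal (?D2 r \<omega>) \<partial>lborel"
  let ?I12 = "\<lambda>\<omega>. \<integral>\<^sup>+r. 4 * ennreal (?D1 r \<omega>) + 2 * ennreal (?D2 r \<omega>) \<partial>lborel"
  let ?SD = "\<integral>\<^sup>+\<omega>. ennreal ((?S \<omega> - ?S' \<omega> - ?R \<omega>)\<^sup>2) \<partial>M"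
  have Dm: "(\<lambda>p. ennreal (?D1 (snd p) (fst p))) \<in> borel_measurable (M \<Otimes>\<^sub>M lborel)"
    "(\<lambda>p. ennreal (?D2 (snd p) (fst p))) \<in> borel_measurable (M \<Otimes>\<^sub>M lborel)"
    using SPm(1,2) H'm by (auto simp: split_beta')
  have clos: "\<bar>?Q r \<omega> - H' \<omega> r\<bar> \<le> \<bar>?P r \<omega> - H' \<omega> r\<bar>" if "s < r" for r \<omega>
    unfolding P\<rho> using that clamp_dist[OF K(2)] by (simp add: H'_def)
  \<comment> \<open>Outside (0, t] all three processes vanish. On (0, s] the third vanishes and the
    first two are both close to \<open>H'\<close>. On (s, t] the second vanishes, and the clamped
    third is no further from \<open>H'\<close> than the first, which doubles the factor 2 to
    4.\<close>
  have bound: "(?P r \<omega> - ?P' r \<omega> - ?Q r \<omega>)\<^sup>2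
    \<le> 4 * ?D1 r \<omega> + 2 * ?D2 r \<omega>" for r \<omega>
  proof -
    consider "r \<le> 0 \<or> t < r" | "0 < r" "r \<le> s" | "s < r" "0 < r" "r \<le> t" using st by linarith
    then show ?thesis
    proof cases
      case 1
      then have "r \<le> 0 \<or> s < r" "r \<le> s \<or> t < r" using st by auto
      with 1 show ?thesis by (simp add: P0 P'0 R0)
    next
      case 2
      have "(?P r \<omega> - ?P' r \<omega>)\<^sup>2
         \<le> 2 * ((?P r \<omega> - H' \<omega> r)\<^sup>2 + (?P' r \<omega> - H' \<omega> r)\<^sup>2)"
        by (rule sq_diff2)
      then show ?thesis using 2 st by (simp add: R0) (erule order_trans, simp)
    next
      case 3
      have "(?P r \<omega> - ?Q r \<omega>)\<^sup>2
         \<le> 2 * ((?P r \<omega> - H' \<omega> r)\<^sup>2 + (?Q r \<omega> - H' \<omega> r)\<^sup>2)"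
        by (rule sq_diff2)
      moreover have "(?Q r \<omega> - H' \<omega> r)\<^sup>2 \<le> (?P r \<omega> - H' \<omega> r)\<^sup>2"
        using clos[OF 3(1)] by (simp add: abs_le_square_iff)
      ultimately show ?thesis using 3 st by (simp add: P'0)
    qed
  qed
  \<comment> \<open>A sum type joins the three families, with signs +, -, -, into one, so that the
    isometry applies to the whole combination.\<close>
  define I where "I = {..<n} <+> ({..<n'} <+> {..<n})"
  have sumI: "(\<Sum>i\<in>I. f i) = (\<Sum>i<n. f (Inl i)) + ((\<Sum>i<n'. f (Inr (Inl i))) + (\<Sum>i<n. f (Inr (Inr i))))" for f :: "_ \<Rightarrow> real"
    unfolding I_def by (simp add: sum.Plus)
  have "?SD =
    (\<integral>\<^sup>+\<omega>. (\<integral>\<^sup>+r. ennreal ((?P r \<omega> - ?P' r \<omega> - ?Q r \<omega>)\<^sup>2) \<partial>lborel) \<partial>M)"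
  proof -
    define u v \<eta> where "u = case_sum \<tau> (case_sum \<tau>' \<rho>)"
      and "v = case_sum (\<lambda>i. \<tau> (Suc i)) (case_sum (\<lambda>i. \<tau>' (Suc i)) (\<lambda>i. \<rho> (Suc i)))"
      and "\<eta> = case_sum \<xi> (case_sum (\<lambda>i \<omega>. - \<xi>' i \<omega>) (\<lambda>i \<omega>. - \<zeta> i \<omega>))"
    have "finite I" by (simp add: I_def)
    moreover have "adm (u i) (\<eta> i) \<and> 0 \<le> u i \<and> u i \<le> v i" if "i \<in> I" for i
      using that A A' \<zeta>a unfolding I_def u_def v_def \<eta>_def by (auto simp: adm_def bounded_iff)
    ultimately have "(\<integral>\<^sup>+\<omega>. ennreal ((\<Sum>i\<in>I. \<eta> i \<omega> * (B (v i) \<omega> - B (u i) \<omega>))\<^sup>2) \<partial>M) =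
      (\<integral>\<^sup>+\<omega>. (\<integral>\<^sup>+r. ennreal ((\<Sum>i\<in>I. \<eta> i \<omega> * indicator {u i<..v i} r)\<^sup>2) \<partial>lborel) \<partial>M)"
      by (rule simple_isometry_nn)
    moreover have "(\<Sum>i\<in>I. \<eta> i \<omega> * (B (v i) \<omega> - B (u i) \<omega>)) =
      ?S \<omega> - ?S' \<omega> - ?R \<omega>" for \<omega>
      by (simp add: sumI u_def v_def \<eta>_def simple_integral_def sum_negf del: sum_mult_indicator)
    moreover have "(\<Sum>i\<in>I. \<eta> i \<omega> * indicator {u i<..v i} r) =
      ?P r \<omega> - ?P' r \<omega> - ?Q r \<omega>" for r \<omega>
      by (simp add: sumI u_def v_def \<eta>_def simple_process_def sum_negf del: sum_mult_indicator)
    ultimately show ?thesis by simp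
  qed
  also have "\<dots> \<le> (\<integral>\<^sup>+\<omega>. ?I12 \<omega> \<partial>M)"
  proof (intro nn_integral_mono)
    fix \<omega> and r :: real
    have eq: "4 * ennreal (?D1 r \<omega>) + 2 * ennreal (?D2 r \<omega>) = ennreal (4 * ?D1 r \<omega> + 2 * ?D2 r \<omega>)"
      by (simp add: ennreal_plus ennreal_mult)
    show "ennreal ((?P r \<omega> - ?P' r \<omega> - ?Q r \<omega>)\<^sup>2)
      \<le> 4 * ennreal (?D1 r \<omega>) + 2 * ennreal (?D2 r \<omega>)"
      unfolding eq by (rule ennreal_leI[OF bound])
  qed
  also have "\<dots> = 4 * (\<integral>\<^sup>+\<omega>. ?I1 \<omega> \<partial>M) + 2 * (\<integral>\<^sup>+\<omega>. ?I2 \<omega> \<partial>M)"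
  proof -
    have "?I12 \<omega> =
      4 * ?I1 \<omega> + 2 * ?I2 \<omega>" if "\<omega> \<in> space M" for \<omega>
      using measurable_compose[OF measurable_Pair1'[OF that] Dm(1)] measurable_compose[OF measurable_Pair1'[OF that] Dm(2)]
      by (simp add: nn_integral_add nn_integral_cmult)
    then have "(\<integral>\<^sup>+\<omega>. ?I12 \<omega> \<partial>M) =
      (\<integral>\<^sup>+\<omega>. 4 * ?I1 \<omega> + 2 * ?I2 \<omega> \<partial>M)"
      by (rule nn_integral_cong)
    also have "\<dots> = 4 * (\<integral>\<^sup>+\<omega>. ?I1 \<omega> \<partial>M) + 2 * (\<integral>\<^sup>+\<omega>. ?I2 \<omega> \<partial>M)"
      using lborel.borel_measurable_nn_integral[of "\<lambda>\<omega> r. ennreal (?D1 r \<omega>)" M]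
        lborel.borel_measurable_nn_integral[of "\<lambda>\<omega> r. ennreal (?D2 r \<omega>)" M] Dm
      unfolding split_beta' by (simp add: nn_integral_add nn_integral_cmult)
    finally show ?thesis .
  qed
  also have "(\<integral>\<^sup>+\<omega>. ?I1 \<omega> \<partial>M) =
    (\<integral>\<^sup>+\<omega>. (\<integral>\<^sup>+r\<in>{0..t}. ennreal ((?P r \<omega> - H r \<omega>)\<^sup>2) \<partial>lborel) \<partial>M)"
    by (intro nn_integral_cong) (auto simp: H' split: split_indicator)
  also have "(\<integral>\<^sup>+\<omega>. ?I2 \<omega> \<partial>M) =
    (\<integral>\<^sup>+\<omega>. (\<integral>\<^sup>+r\<in>{0..s}. ennreal ((?P' r \<omega> - H r \<omega>)\<^sup>2) \<partial>lborel) \<partial>M)"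
    by (intro nn_integral_cong) (auto simp: H' split: split_indicator)
  finally have main: "?SD
     \<le> 4 * \<gamma> + 2 * \<gamma>"
    by (rule order_trans) (intro add_mono mult_left_mono g1 g3; simp)
  have "(\<integral>\<^sup>+\<omega>. ennreal ((J \<omega> - J' \<omega> - ?R \<omega>)\<^sup>2) \<partial>M) \<le>
    (\<integral>\<^sup>+\<omega>. 3 * (ennreal ((?S \<omega> - J \<omega>)\<^sup>2) + ennreal ((?S' \<omega> - J' \<omega>)\<^sup>2)
     + ennreal ((?S \<omega> - ?S' \<omega> - ?R \<omega>)\<^sup>2)) \<partial>M)"
  proof (intro nn_integral_mono)
    fix \<omega>
    let ?a = "?S \<omega>" and ?b = "?S' \<omega>" and ?c = "?R \<omega>"
    have "(J \<omega> - J' \<omega> - ?c)\<^sup>2 \<le> 3 * ((?a - J \<omega>)\<^sup>2 + (?b - J' \<omega>)\<^sup>2 + (?a - ?b - ?c)\<^sup>2)"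
      using sq_sum3[of "J \<omega> - ?a" "?b - J' \<omega>" "?a - ?b - ?c"] by (simp add: power2_commute[of "J \<omega>"] algebra_simps)
    then have "ennreal ((J \<omega> - J' \<omega> - ?c)\<^sup>2) \<le> ennreal (3 * ((?a - J \<omega>)\<^sup>2 + (?b - J' \<omega>)\<^sup>2 + (?a - ?b - ?c)\<^sup>2))"
      by (rule ennreal_leI)
    then show "ennreal ((J \<omega> - J' \<omega> - ?c)\<^sup>2) \<le> 3 * (ennreal ((?a - J \<omega>)\<^sup>2) + ennreal ((?b - J' \<omega>)\<^sup>2) + ennreal ((?a - ?b - ?c)\<^sup>2))"
      by (simp add: ennreal_plus ennreal_mult)
  qed
  also have "\<dots> = 3 * ((\<integral>\<^sup>+\<omega>. ennreal ((?S \<omega> - J \<omega>)\<^sup>2) \<partial>M) + (\<integral>\<^sup>+\<omega>. ennreal ((?S' \<omega> - J' \<omega>)\<^sup>2) \<partial>M)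
     + ?SD)"
    by (simp add: nn_integral_add nn_integral_cmult)
  also have "\<dots> \<le> 3 * (\<gamma> + \<gamma> + (4 * \<gamma> + 2 * \<gamma>))"
    by (intro mult_left_mono add_mono g2 g4 main) simp
  also have "\<dots> = ennreal \<epsilon>"
    unfolding \<gamma>_def using \<epsilon> by (simp add: ennreal_plus[symmetric] ennreal_mult[symmetric] ennreal_numeral[symmetric] del: ennreal_plus ennreal_numeral)
  finally have r1: "(\<integral>\<^sup>+\<omega>. ennreal ((J \<omega> - J' \<omega> - ?R \<omega>)\<^sup>2) \<partial>M) \<le> ennreal \<epsilon>" .
  have "(\<integral>\<^sup>+\<omega>. (\<integral>\<^sup>+r\<in>{s<..t}. ennreal ((?Q r \<omega> - H r \<omega>)\<^sup>2) \<partial>lborel) \<partial>M)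
    \<le> (\<integral>\<^sup>+\<omega>. (\<integral>\<^sup>+r\<in>{0..t}. ennreal ((?P r \<omega> - H r \<omega>)\<^sup>2) \<partial>lborel) \<partial>M)"
    using clos st by (intro nn_integral_mono) (auto simp: H' abs_le_square_iff[symmetric] split: split_indicator intro!: ennreal_leI)
  also have "\<dots> \<le> ennreal \<epsilon>"
    using \<epsilon> by (intro order_trans[OF g1]) (simp add: \<gamma>_def ennreal_leI)
  finally show thesis
    using r1 \<zeta>m \<zeta>b \<rho>n \<zeta>a by (intro that[of \<rho> n \<zeta>]) (auto simp: \<rho>_def)
qed

end

section \<open>Moments of simple integrals with bounded weights\<close>

lemma abs_power_le_one_plus_power4: "j \<le> 4 \<Longrightarrow> \<bar>y ^ j\<bar> \<le> 1 + (y::real) ^ 4"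
proof (cases "\<bar>y\<bar> \<le> 1")
  case True
  then have "\<bar>y ^ j\<bar> \<le> 1" by (simp add: power_abs power_le_one)
  moreover have "0 \<le> y ^ 4" by (rule zero_le_even_power) simp
  ultimately show ?thesis by linarith
next
  case False
  moreover assume "j \<le> 4"
  ultimately have "\<bar>y ^ j\<bar> \<le> \<bar>y\<bar> ^ 4" unfolding power_abs by (intro power_increasing) auto
  then show ?thesis by (simp add: power_even_abs)
qed

context brownian_space
begin

text \<open>Induction on the number of intervals: the last increment is independent of everything
  before it, so its odd moments drop out. With d the length so far and \<delta> the new length, the
  fourth moment is at most 3 K^4 d^2 + 6 K^4 d \<delta> + 3 K^4 \<delta>^2. This is again 3 K^4
  times a square, so the Gaussian constant 3 reproduces itself.\<close>

lemma simple_integral_moments: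
  assumes "0 \<le> \<rho> 0" "\<And>i. i < n \<Longrightarrow> \<rho> i \<le> \<rho> (Suc i)"
    and "\<And>i. i < n \<Longrightarrow> \<zeta> i \<in> borel_measurable (F (\<rho> i))" "\<And>i \<omega>. \<bar>\<zeta> i \<omega>\<bar> \<le> K"
  shows "simple_integral B n \<rho> \<zeta> \<in> borel_measurable (F (\<rho> n)) \<and>
    (\<forall>j\<le>4. integrable M (\<lambda>\<omega>. simple_integral B n \<rho> \<zeta> \<omega> ^ j)) \<and>
    expectation (\<lambda>\<omega>. simple_integral B n \<rho> \<zeta> \<omega> ^ 2) \<le> K ^ 2 * (\<rho> n - \<rho> 0) \<and>
    expectation (\<lambda>\<omega>. simple_integral B n \<rho> \<zeta> \<omega> ^ 4) \<le> 3 * K ^ 4 * (\<rho> n - \<rho> 0)\<^sup>2 \<and> \<rho> 0 \<le> \<rho> n"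
  using assms(2,3)
proof (induction n)
  case 0
  then show ?case by (auto simp: simple_integral_def[abs_def] power_0_left)
next
  case (Suc n)
  let ?T = "simple_integral B (Suc n) \<rho> \<zeta>"
  define S where "S = simple_integral B n \<rho> \<zeta>"
  define \<Delta> where "\<Delta> \<omega> = B (\<rho> (Suc n)) \<omega> - B (\<rho> n) \<omega>" for \<omega>
  define \<delta> where "\<delta> = \<rho> (Suc n) - \<rho> n"
  define d where "d = \<rho> n - \<rho> 0"
  have IH: "S \<in> borel_measurable (F (\<rho> n))" "\<And>j. j \<le> 4 \<Longrightarrow> integrable M (\<lambda>\<omega>. S \<omega> ^ j)"
    "expectation (\<lambda>\<omega>. S \<omega> ^ 2) \<le> K ^ 2 * d" "expectation (\<lambda>\<omega>. S \<omega> ^ 4) \<le> 3 * K ^ 4 * d\<^sup>2" "0 \<le> d"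
    using Suc.IH Suc.prems by (auto simp: S_def d_def)
  have \<rho>0: "0 \<le> \<rho> n" using IH(5) assms(1) by (simp add: d_def)
  have \<rho>1: "\<rho> n \<le> \<rho> (Suc n)" using Suc.prems(1) by auto
  then have \<delta>: "0 \<le> \<delta>" by (simp add: \<delta>_def)
  have [measurable]: "S \<in> borel_measurable (F (\<rho> n))" "\<zeta> n \<in> borel_measurable (F (\<rho> n))"
    using IH(1) Suc.prems(2)[of n] by auto
  have eq: "?T \<omega> = S \<omega> + \<zeta> n \<omega> * \<Delta> \<omega>" for \<omega>
    by (simp add: simple_integral_def S_def \<Delta>_def)
  have K0: "0 \<le> K" using assms(4)[of 0 undefined] by linarith
  have Gm: "(\<lambda>\<omega>. S \<omega> ^ j * \<zeta> n \<omega> ^ m) \<in> borel_measurable (F (\<rho> n))" for j m by measurable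
  have Gi: "integrable M (\<lambda>\<omega>. S \<omega> ^ j * \<zeta> n \<omega> ^ m)" if "j \<le> 4" for j m
  proof (rule Bochner_Integration.integrable_bound)
    show "integrable M (\<lambda>\<omega>. K ^ m * S \<omega> ^ j)" using IH(2)[OF that] by auto
    show "(\<lambda>\<omega>. S \<omega> ^ j * \<zeta> n \<omega> ^ m) \<in> borel_measurable M" using F_meas[OF Gm] .
    have "\<bar>S \<omega> ^ j\<bar> * \<bar>\<zeta> n \<omega>\<bar> ^ m \<le> \<bar>S \<omega> ^ j\<bar> * K ^ m" for \<omega>
      by (intro mult_left_mono power_mono assms(4)) auto
    then show "AE \<omega> in M. norm (S \<omega> ^ j * \<zeta> n \<omega> ^ m) \<le> norm (K ^ m * S \<omega> ^ j)"
      using K0 by (simp add: abs_mult power_abs mult.commute)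
  qed
  note inc = increment_indep[OF \<rho>0 \<rho>1 Gm Gi, folded \<Delta>_def]
  note mom = increment_moments[OF \<rho>0 \<rho>1, folded \<Delta>_def \<delta>_def]
  have bd: "expectation (\<lambda>\<omega>. S \<omega> ^ j * \<zeta> n \<omega> ^ m) \<le> K ^ m * expectation (\<lambda>\<omega>. S \<omega> ^ j)" if "j \<le> 4" "even j" "even m" for j m
  proof -
    have "expectation (\<lambda>\<omega>. S \<omega> ^ j * \<zeta> n \<omega> ^ m) \<le> expectation (\<lambda>\<omega>. K ^ m * S \<omega> ^ j)"
    proof (rule integral_mono[OF Gi[OF that(1)]])
      show "integrable M (\<lambda>\<omega>. K ^ m * S \<omega> ^ j)" using IH(2)[OF that(1)] by auto
      fix \<omega>
      have "\<zeta> n \<omega> ^ m \<le> K ^ m"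
        using power_mono[OF assms(4)[of n \<omega>], of m] that(3) by (simp add: power_even_abs)
      then show "S \<omega> ^ j * \<zeta> n \<omega> ^ m \<le> K ^ m * S \<omega> ^ j"
        using mult_left_mono[OF _ zero_le_even_power[OF that(2)]] by (subst mult.commute[of "K ^ m"]) blast
    qed
    then show ?thesis by simp
  qed
  \<comment> \<open>The exponents 0 and 1 are kept so that every summand with an increment is
    literally an instance of \<open>inc\<close>.\<close>
  have e2: "(S \<omega> + \<zeta> n \<omega> * \<Delta> \<omega>) ^ 2 = S \<omega> ^ 2 + 2 * (S \<omega> ^ 1 * \<zeta> n \<omega> ^ 1 * \<Delta> \<omega> ^ 1) + S \<omega> ^ 0 * \<zeta> n \<omega> ^ 2 * \<Delta> \<omega> ^ 2" for \<omega>
    by (simp add: power2_eq_square algebra_simps)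
  have e4: "(S \<omega> + \<zeta> n \<omega> * \<Delta> \<omega>) ^ 4 = S \<omega> ^ 4 + 4 * (S \<omega> ^ 3 * \<zeta> n \<omega> ^ 1 * \<Delta> \<omega> ^ 1) + 6 * (S \<omega> ^ 2 * \<zeta> n \<omega> ^ 2 * \<Delta> \<omega> ^ 2)
     + 4 * (S \<omega> ^ 1 * \<zeta> n \<omega> ^ 3 * \<Delta> \<omega> ^ 3) + S \<omega> ^ 0 * \<zeta> n \<omega> ^ 4 * \<Delta> \<omega> ^ 4" for \<omega>
    by (simp add: power_numeral_reduce algebra_simps)
  have m: "?T \<in> borel_measurable (F (\<rho> (Suc n)))"
  proof -
    have [measurable]: "S \<in> borel_measurable (F (\<rho> (Suc n)))" "\<zeta> n \<in> borel_measurable (F (\<rho> (Suc n)))"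
      "\<Delta> \<in> borel_measurable (F (\<rho> (Suc n)))"
      using F_mono[OF \<rho>1 IH(1)] F_mono[OF \<rho>1 Suc.prems(2)[of n]] \<rho>0 \<rho>1 unfolding \<Delta>_def[abs_def]
      by (auto intro!: borel_measurable_diff B_adapted)
    show ?thesis unfolding eq[abs_def] by measurable
  qed
  have i4: "integrable M (\<lambda>\<omega>. ?T \<omega> ^ 4)"
    unfolding eq e4 by (intro Bochner_Integration.integrable_add integrable_mult_right inc IH(2)) auto
  have ij: "integrable M (\<lambda>\<omega>. ?T \<omega> ^ j)" if "j \<le> 4" for j
  proof (rule Bochner_Integration.integrable_bound)
    show "integrable M (\<lambda>\<omega>. 1 + ?T \<omega> ^ 4)" using i4 by simp
    have [measurable]: "?T \<in> borel_measurable M" using F_meas[OF m] .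
    show "(\<lambda>\<omega>. ?T \<omega> ^ j) \<in> borel_measurable M" by measurable
    show "AE \<omega> in M. norm (?T \<omega> ^ j) \<le> norm (1 + ?T \<omega> ^ 4)"
      using abs_power_le_one_plus_power4[OF that] by (auto intro: order_trans)
  qed
  have "expectation (\<lambda>\<omega>. ?T \<omega> ^ 2) = expectation (\<lambda>\<omega>. S \<omega> ^ 2) + expectation (\<lambda>\<omega>. S \<omega> ^ 0 * \<zeta> n \<omega> ^ 2) * \<delta>"
  proof -
    have "expectation (\<lambda>\<omega>. S \<omega> ^ 1 * \<zeta> n \<omega> ^ 1 * \<Delta> \<omega> ^ 1) = 0"
      by (subst inc(2)) (use mom in auto)
    moreover have "expectation (\<lambda>\<omega>. S \<omega> ^ 0 * \<zeta> n \<omega> ^ 2 * \<Delta> \<omega> ^ 2) = expectation (\<lambda>\<omega>. S \<omega> ^ 0 * \<zeta> n \<omega> ^ 2) * \<delta>"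
      by (subst inc(2)) (use mom in auto)
    moreover note IH(2)[of 2] inc(1)[of 1 1 1] inc(1)[of 0 2 2]
    ultimately show ?thesis unfolding eq e2 by simp
  qed
  also have "\<dots> \<le> K\<^sup>2 * d + (K\<^sup>2 * expectation (\<lambda>\<omega>. S \<omega> ^ 0)) * \<delta>"
    by (intro add_mono IH mult_right_mono bd \<delta>) auto
  also have "\<dots> = K\<^sup>2 * (d + \<delta>)" by (simp add: prob_space algebra_simps)
  finally have E2: "expectation (\<lambda>\<omega>. ?T \<omega> ^ 2) \<le> K\<^sup>2 * (d + \<delta>)" .
  have "expectation (\<lambda>\<omega>. ?T \<omega> ^ 4) = expectation (\<lambda>\<omega>. S \<omega> ^ 4)
     + 6 * (expectation (\<lambda>\<omega>. S \<omega> ^ 2 * \<zeta> n \<omega> ^ 2) * \<delta>) + expectation (\<lambda>\<omega>. S \<omega> ^ 0 * \<zeta> n \<omega> ^ 4) * (3 * \<delta>\<^sup>2)"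
  proof -
    have "expectation (\<lambda>\<omega>. S \<omega> ^ 3 * \<zeta> n \<omega> ^ 1 * \<Delta> \<omega> ^ 1) = 0"
      by (subst inc(2)) (use mom in auto)
    moreover have "expectation (\<lambda>\<omega>. S \<omega> ^ 1 * \<zeta> n \<omega> ^ 3 * \<Delta> \<omega> ^ 3) = 0"
      by (subst inc(2)) (use mom in auto)
    moreover have "expectation (\<lambda>\<omega>. S \<omega> ^ 2 * \<zeta> n \<omega> ^ 2 * \<Delta> \<omega> ^ 2) = expectation (\<lambda>\<omega>. S \<omega> ^ 2 * \<zeta> n \<omega> ^ 2) * \<delta>"
      by (subst inc(2)) (use mom in auto)
    moreover have "expectation (\<lambda>\<omega>. S \<omega> ^ 0 * \<zeta> n \<omega> ^ 4 * \<Delta> \<omega> ^ 4) = expectation (\<lambda>\<omega>. S \<omega> ^ 0 * \<zeta> n \<omega> ^ 4) * (3 * \<delta>\<^sup>2)"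
      by (subst inc(2)) (use mom in auto)
    moreover note IH(2)[of 4] inc(1)[of 3 1 1] inc(1)[of 2 2 2] inc(1)[of 1 3 3] inc(1)[of 0 4 4]
    ultimately show ?thesis unfolding eq e4 by simp
  qed
  also have "\<dots> \<le> 3 * K ^ 4 * d\<^sup>2 + 6 * ((K ^ 2 * (K ^ 2 * d)) * \<delta>) + (K ^ 4 * expectation (\<lambda>\<omega>. S \<omega> ^ 0)) * (3 * \<delta>\<^sup>2)"
    by (intro add_mono IH mult_right_mono mult_left_mono bd \<delta> order_trans[OF bd mult_left_mono[OF IH(3)]]) auto
  also have "\<dots> = 3 * K ^ 4 * (d + \<delta>)\<^sup>2" by (simp add: prob_space power_numeral_reduce algebra_simps)
  finally have E4: "expectation (\<lambda>\<omega>. ?T \<omega> ^ 4) \<le> 3 * K ^ 4 * (d + \<delta>)\<^sup>2" .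
  have "d + \<delta> = \<rho> (Suc n) - \<rho> 0" by (simp add: d_def \<delta>_def)
  then show ?case using m ij E2 E4 IH(5) \<delta> by (simp add: d_def \<delta>_def)
qed

text \<open>As \<open>G\<close> is bounded and known before the first interval, the products of
  \<open>G\<close> with the weights are again admissible, and \<open>G\<close> times the simple
  integral is itself a simple integral. The second moment is the isometry between this one and the
  original. In the Taylor expansion \<open>G\<close> is a derivative of the test function at
  \<open>X s\<close>.\<close>

lemma simple_integral_weighted:
  assumes "0 \<le> s" "s \<le> \<rho> 0" "\<And>i. i < n \<Longrightarrow> \<rho> i \<le> \<rho> (Suc i)"
    and "\<And>i. i < n \<Longrightarrow> \<zeta> i \<in> borel_measurable (F (\<rho> i))" "\<And>i \<omega>. \<bar>\<zeta> i \<omega>\<bar> \<le> K"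
    and G: "adm s G"
  shows "expectation (\<lambda>\<omega>. G \<omega> * simple_integral B n \<rho> \<zeta> \<omega>) = 0"
    and "expectation (\<lambda>\<omega>. G \<omega> * (simple_integral B n \<rho> \<zeta> \<omega>)\<^sup>2) =
      expectation (\<lambda>\<omega>. LINT r|lborel. G \<omega> * (simple_process n \<rho> \<zeta> r \<omega>)\<^sup>2)"
    and "integrable M (\<lambda>\<omega>. G \<omega> * simple_integral B n \<rho> \<zeta> \<omega>)"
    and "integrable M (\<lambda>\<omega>. G \<omega> * (simple_integral B n \<rho> \<zeta> \<omega>)\<^sup>2)"
proof -
  have \<rho>s: "s \<le> \<rho> i" if "i \<le> n" for i
    using order_trans[OF assms(2) partition_mono[where \<tau>=\<rho> and n=n and i=0 and j=i, OF assms(3)]] that by simp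
  have a: "adm (\<rho> i) (\<zeta> i) \<and> 0 \<le> \<rho> i \<and> \<rho> i \<le> \<rho> (Suc i)" if "i \<in> {..<n}" for i
    using assms(1,3,4,5) \<rho>s[of i] that by (auto simp: adm_def bounded_iff intro!: exI[of _ K])
  have ga: "adm (\<rho> i) (\<lambda>\<omega>. G \<omega> * \<zeta> i \<omega>) \<and> 0 \<le> \<rho> i \<and> \<rho> i \<le> \<rho> (Suc i)" if "i \<in> {..<n}" for i
    using adm_mult[OF adm_mono[OF G \<rho>s[of i]]] a[OF that] that by auto
  have t: "integrable M (\<lambda>\<omega>. G \<omega> * \<zeta> i \<omega> * (B (\<rho> (Suc i)) \<omega> - B (\<rho> i) \<omega>) ^ 1) \<and>
    expectation (\<lambda>\<omega>. G \<omega> * \<zeta> i \<omega> * (B (\<rho> (Suc i)) \<omega> - B (\<rho> i) \<omega>) ^ 1) = 0" if "i < n" for i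
  proof -
    have ad: "adm (\<rho> i) (\<lambda>\<omega>. G \<omega> * \<zeta> i \<omega>)" and le: "0 \<le> \<rho> i" "\<rho> i \<le> \<rho> (Suc i)"
      using ga[of i] that by simp_all
    note inc = increment_indep[OF le conjunct1[OF ad[unfolded adm_def]] adm_integrable[OF ad], of 1]
    show ?thesis
      using inc increment_moments(2)[OF le] by simp
  qed
  have GS: "G \<omega> * simple_integral B n \<rho> \<zeta> \<omega> = (\<Sum>i<n. G \<omega> * \<zeta> i \<omega> * (B (\<rho> (Suc i)) \<omega> - B (\<rho> i) \<omega>))" for \<omega>
    by (simp add: simple_integral_def sum_distrib_left mult.assoc)
  have GP: "G \<omega> * simple_process n \<rho> \<zeta> r \<omega> = (\<Sum>i<n. G \<omega> * \<zeta> i \<omega> * indicator {\<rho> i<..\<rho> (Suc i)} r)" for \<omega> r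
    unfolding simple_process_def sum_distrib_left by (simp only: mult.assoc)
  have t1: "integrable M (\<lambda>\<omega>. G \<omega> * \<zeta> i \<omega> * (B (\<rho> (Suc i)) \<omega> - B (\<rho> i) \<omega>))"
    and t2: "expectation (\<lambda>\<omega>. G \<omega> * \<zeta> i \<omega> * (B (\<rho> (Suc i)) \<omega> - B (\<rho> i) \<omega>)) = 0" if "i \<in> {..<n}" for i
    using t[of i] that by simp_all
  show "integrable M (\<lambda>\<omega>. G \<omega> * simple_integral B n \<rho> \<zeta> \<omega>)"
    unfolding GS by (rule Bochner_Integration.integrable_sum[OF t1])
  show "expectation (\<lambda>\<omega>. G \<omega> * simple_integral B n \<rho> \<zeta> \<omega>) = 0"
    unfolding GS by (subst Bochner_Integration.integral_sum[OF t1]) (assumption, rule sum.neutral, intro ballI t2)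
  note iso = simple_isometry[OF finite_lessThan ga finite_lessThan a]
  have "integrable M (\<lambda>\<omega>. (G \<omega> * simple_integral B n \<rho> \<zeta> \<omega>) * simple_integral B n \<rho> \<zeta> \<omega>)"
    unfolding GS unfolding simple_integral_def by (rule iso(1))
  then show "integrable M (\<lambda>\<omega>. G \<omega> * (simple_integral B n \<rho> \<zeta> \<omega>)\<^sup>2)"
    by (simp only: power2_eq_square mult.assoc)
  have "expectation (\<lambda>\<omega>. (G \<omega> * simple_integral B n \<rho> \<zeta> \<omega>) * simple_integral B n \<rho> \<zeta> \<omega>) =
      expectation (\<lambda>\<omega>. LINT r|lborel. (G \<omega> * simple_process n \<rho> \<zeta> r \<omega>) * simple_process n \<rho> \<zeta> r \<omega>)"
    unfolding GS GP unfolding simple_integral_def simple_process_def by (rule iso(3))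
  then show "expectation (\<lambda>\<omega>. G \<omega> * (simple_integral B n \<rho> \<zeta> \<omega>)\<^sup>2) =
      expectation (\<lambda>\<omega>. LINT r|lborel. G \<omega> * (simple_process n \<rho> \<zeta> r \<omega>)\<^sup>2)"
    by (simp only: power2_eq_square mult.assoc)
qed

end

text \<open>Round time down to a multiple of 1/(n + 1): only countably many members of the process
  are then involved, and path continuity gives the limit in n.\<close>

lemma continuous_process_measurable:
  fixes X :: "real \<Rightarrow> 'w \<Rightarrow> real"
  assumes "\<And>t. 0 \<le> t \<Longrightarrow> X t \<in> borel_measurable N"
    and "\<And>\<omega>. \<omega> \<in> space N \<Longrightarrow> continuous_on {0..} (\<lambda>t. X t \<omega>)"
  shows "(\<lambda>(r, \<omega>). X (max 0 r) \<omega>) \<in> borel_measurable (borel \<Otimes>\<^sub>M N)"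
proof -
  define g where "g n r = real_of_int \<lfloor>real (Suc n) * r\<rfloor> / real (Suc n)" for n r
  have lim: "(\<lambda>n. g n r) \<longlonglongrightarrow> r" for r
  proof -
    have "(\<lambda>n. r - 1 / real (Suc n)) \<longlonglongrightarrow> r - 0"
      by (intro tendsto_diff tendsto_const LIMSEQ_inverse_real_of_nat[unfolded inverse_eq_divide])
    then have lim: "(\<lambda>n. r - 1 / real (Suc n)) \<longlonglongrightarrow> r" by simp
    have lo: "r - 1 / real (Suc n) \<le> g n r" for n
    proof -
      have "real (Suc n) * r - 1 \<le> real_of_int \<lfloor>real (Suc n) * r\<rfloor>" by linarith
      then have "(real (Suc n) * r - 1) / real (Suc n) \<le> real_of_int \<lfloor>real (Suc n) * r\<rfloor> / real (Suc n)"
        by (intro divide_right_mono) auto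
      then show ?thesis unfolding g_def by (simp add: diff_divide_distrib del: of_nat_Suc)
    qed
    have up: "g n r \<le> r" for n
    proof -
      have "real_of_int \<lfloor>real (Suc n) * r\<rfloor> \<le> r * real (Suc n)"
        by (subst mult.commute[of r]) (rule of_int_floor_le)
      then show ?thesis unfolding g_def by (simp add: pos_divide_le_eq del: of_nat_Suc)
    qed
    show ?thesis
      by (rule tendsto_sandwich[OF always_eventually always_eventually lim tendsto_const]) (use lo up in auto)
  qed
  have meas: "(\<lambda>(r, \<omega>). X (max 0 (g n r)) \<omega>) \<in> borel_measurable (borel \<Otimes>\<^sub>M N)" for n
  proof -
    have f: "(\<lambda>p. X (max 0 (real_of_int i / real (Suc n))) (snd p)) \<in> borel_measurable (borel \<Otimes>\<^sub>M N)" for i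
      by (rule measurable_compose[OF measurable_snd]) (rule assms(1), simp)
    have "(\<lambda>p. X (max 0 (real_of_int \<lfloor>real (Suc n) * fst p\<rfloor> / real (Suc n))) (snd p)) \<in> borel_measurable (borel \<Otimes>\<^sub>M N)"
      by (rule measurable_compose_countable[where f="\<lambda>i p. X (max 0 (real_of_int i / real (Suc n))) (snd p)"
            and g="\<lambda>p. \<lfloor>real (Suc n) * fst p\<rfloor>", OF f]) measurable
    then show ?thesis by (simp add: g_def split_beta')
  qed
  have "(\<lambda>n. X (max 0 (g n (fst p))) (snd p)) \<longlonglongrightarrow> X (max 0 (fst p)) (snd p)"
    if p: "p \<in> space (borel \<Otimes>\<^sub>M N)" for p
  proof (rule continuous_on_tendsto_compose[where s="{0..}" and f="\<lambda>t. X t (snd p)"])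
    show "continuous_on {0..} (\<lambda>t. X t (snd p))" using assms(2) p by (auto simp: space_pair_measure)
    show "(\<lambda>n. max 0 (g n (fst p))) \<longlonglongrightarrow> max 0 (fst p)" by (intro tendsto_max tendsto_const lim)
  qed auto
  then show ?thesis
    by (intro borel_measurable_LIMSEQ_real[OF _ meas]) (simp add: split_beta)
qed

lemma set_integrable_const_Ioc: "set_integrable lborel {s<..t::real} (\<lambda>r. c::real)"
  by (cases "s \<le> t") (auto simp: set_integrable_def intro!: integrable_mult_left integrable_real_indicator)

section \<open>Diffusions with bounded coefficients\<close>

context prob_space
begin

text \<open>Lebesgue measure on (s, t] as a density on the whole line, not as a restricted space, so
  that measurability always refers to \<open>borel\<close> on the line.\<close>

abbreviation interval_measure_on :: "real \<Rightarrow> real \<Rightarrow> real measure" where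
  "interval_measure_on s t \<equiv> density lborel (\<lambda>r. ennreal (indicator {s<..t} r))"

definition time_prod :: "real \<Rightarrow> real \<Rightarrow> ('a \<times> real) measure" where
  "time_prod s t = M \<Otimes>\<^sub>M interval_measure_on s t"

lemma sets_time_prod [measurable_cong]: "sets (time_prod s t) = sets (M \<Otimes>\<^sub>M borel)"
  unfolding time_prod_def by (intro sets_pair_measure_cong) auto

lemma emeasure_time_density:
  "s \<le> t \<Longrightarrow> emeasure (interval_measure_on s t) UNIV = ennreal (t - s)"
  by (subst emeasure_density) (auto simp: nn_integral_indicator ennreal_indicator)

lemma time_density_finite: "(s :: real) \<le> t \<Longrightarrow> finite_measure (interval_measure_on s t)"
  by (intro finite_measureI) (simp add: emeasure_time_density)

lemma time_prod_integrable:
  assumes "s \<le> t" "f \<in> borel_measurable (M \<Otimes>\<^sub>M borel)" "\<And>p. \<bar>f p\<bar> \<le> (C::real)"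
  shows "integrable (time_prod s t) f"
proof -
  interpret U: finite_measure "interval_measure_on s t"
    using time_density_finite[OF assms(1)] .
  interpret P: finite_measure "time_prod s t"
    unfolding time_prod_def by (rule finite_measure_pair_measure) unfold_locales
  show ?thesis
    using assms(2,3) measurable_cong_sets[OF sets_time_prod refl] by (intro P.integrable_const_bound[where B=C]) auto
qed

lemma time_prod_fubini:
  assumes "s \<le> t" "f \<in> borel_measurable (M \<Otimes>\<^sub>M borel)" "integrable (time_prod s t) f"
  shows "integral\<^sup>L (time_prod s t) f = expectation (\<lambda>\<omega>. LINT r:{s<..t}|lborel. (f (\<omega>, r) :: real))"
    and "integral\<^sup>L (time_prod s t) f = (LINT r:{s<..t}|lborel. expectation (\<lambda>\<omega>. f (\<omega>, r)))"
    and "integrable M (\<lambda>\<omega>. LINT r:{s<..t}|lborel. f (\<omega>, r))"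
    and "set_integrable lborel {s<..t} (\<lambda>r. expectation (\<lambda>\<omega>. f (\<omega>, r)))"
proof -
  interpret U: finite_measure "interval_measure_on s t"
    using time_density_finite[OF assms(1)] .
  interpret P: pair_sigma_finite M "interval_measure_on s t" ..
  have sec: "(\<lambda>r. f (\<omega>, r)) \<in> borel_measurable borel" if "\<omega> \<in> space M" for \<omega>
    using measurable_compose[OF measurable_Pair1'[OF that] assms(2)] .
  have sec2: "(\<lambda>r. expectation (\<lambda>\<omega>. f (\<omega>, r))) \<in> borel_measurable borel"
    by (rule borel_measurable_lebesgue_integral)
      (use measurable_compose[OF measurable_pair_swap' assms(2)] in \<open>simp add: split_beta'\<close>)
  have d: "(LINT r|interval_measure_on s t. f (\<omega>, r)) = (LINT r:{s<..t}|lborel. f (\<omega>, r))"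
    if "\<omega> \<in> space M" for \<omega>
    using sec[OF that] by (subst integral_density) (auto simp: set_lebesgue_integral_def)
  show "integral\<^sup>L (time_prod s t) f = expectation (\<lambda>\<omega>. LINT r:{s<..t}|lborel. f (\<omega>, r))"
    using P.integral_fst'[OF assms(3)[unfolded time_prod_def]]
    unfolding time_prod_def by (simp add: d cong: Bochner_Integration.integral_cong)
  show "integrable M (\<lambda>\<omega>. LINT r:{s<..t}|lborel. f (\<omega>, r))"
    using P.integrable_fst'[OF assms(3)[unfolded time_prod_def]]
    by (simp add: d cong: Bochner_Integration.integrable_cong)
  have a3: "integrable (M \<Otimes>\<^sub>M interval_measure_on s t) (case_prod (\<lambda>\<omega> r. f (\<omega>, r)))"
    using assms(3) by (simp add: time_prod_def)
  show "integral\<^sup>L (time_prod s t) f = (LINT r:{s<..t}|lborel. expectation (\<lambda>\<omega>. f (\<omega>, r)))"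
    using P.integral_snd[OF a3] sec2
    unfolding time_prod_def by (simp add: integral_density set_lebesgue_integral_def)
  show "set_integrable lborel {s<..t} (\<lambda>r. expectation (\<lambda>\<omega>. f (\<omega>, r)))"
    using P.integrable_snd[OF a3] sec2
    by (simp add: integrable_density set_integrable_def)
qed

lemma time_prod_le:
  assumes "s \<le> t" "f \<in> borel_measurable (M \<Otimes>\<^sub>M borel)" "\<And>p. \<bar>f p\<bar> \<le> C"
    and "\<And>r. s < r \<Longrightarrow> r \<le> t \<Longrightarrow> expectation (\<lambda>\<omega>. f (\<omega>, r)) \<le> (c::real)"
  shows "integral\<^sup>L (time_prod s t) f \<le> c * (t - s)"
proof -
  note F = time_prod_fubini[OF assms(1,2) time_prod_integrable[OF assms(1-3)]]
  have "integral\<^sup>L (time_prod s t) f \<le> (LINT r:{s<..t}|lborel. c)"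
    unfolding F(2)
    by (rule set_integral_mono[OF F(4)]) (use assms in \<open>auto intro: set_integrable_const_Ioc\<close>)
  also have "\<dots> = c * (t - s)"
    using assms(1) by (simp add: set_lebesgue_integral_def)
  finally show ?thesis .
qed

end

text \<open>Adaptedness is to \<open>F\<close> itself, the filtration of which the Brownian
  increments are independent; the augmented filtration of \<open>B\<close> is contained in it, as
  shown in \<open>augmented_subset\<close>. One constant \<open>K\<close> bounds both coefficients.
  They need only be measurable, so jumps are allowed.\<close>

locale diffusion = brownian_space M F B
  for M :: "'w measure" and F :: "real \<Rightarrow> 'w measure" and B :: "real \<Rightarrow> 'w \<Rightarrow> real" +
  fixes b v :: "real \<Rightarrow> real" and K :: real and x0 :: real and X :: "real \<Rightarrow> 'w \<Rightarrow> real"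
  assumes b_meas [measurable]: "b \<in> borel_measurable borel"
    and v_meas [measurable]: "v \<in> borel_measurable borel"
    and b_bound: "\<And>y. \<bar>b y\<bar> \<le> K" and v_bound: "\<And>y. \<bar>v y\<bar> \<le> K"
    and X_adapted: "\<And>t. 0 \<le> t \<Longrightarrow> X t \<in> borel_measurable (F t)"
    and X_cont: "\<And>\<omega>. \<omega> \<in> space M \<Longrightarrow> continuous_on {0..} (\<lambda>t. X t \<omega>)"
    and X_0: "AE \<omega> in M. X 0 \<omega> = x0"
    and X_eq: "\<And>t. 0 \<le> t \<Longrightarrow> \<exists>J. has_ito_integral M F B t (\<lambda>s \<omega>. v (X s \<omega>)) J \<and>
        (AE \<omega> in M. X t \<omega> = x0 + (LINT s:{0..t}|lborel. b (X s \<omega>)) + J \<omega>)"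
begin

lemma K_nonneg: "0 \<le> K"
  using b_bound[of 0] by linarith

lemma X_meas [measurable]: "0 \<le> t \<Longrightarrow> X t \<in> borel_measurable M"
  using X_adapted F_meas by blast

text \<open>Nothing is known about \<open>X\<close> at negative times, hence the \<open>max 0\<close> here and below.\<close>

lemma X_joint: "(\<lambda>(r, \<omega>). X (max 0 r) \<omega>) \<in> borel_measurable (borel \<Otimes>\<^sub>M M)"
  by (rule continuous_process_measurable) (auto intro: X_cont)

lemma X_joint' [measurable]: "(\<lambda>p. X (max 0 (snd p)) (fst p)) \<in> borel_measurable (M \<Otimes>\<^sub>M borel)"
  using measurable_compose[OF measurable_pair_swap' X_joint] by (simp add: split_beta')

lemma X_section: "\<omega> \<in> space M \<Longrightarrow> (\<lambda>r. X (max 0 r) \<omega>) \<in> borel_measurable borel"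
  using measurable_compose[OF measurable_Pair1' X_joint'] by simp

definition drift :: "real \<Rightarrow> real \<Rightarrow> 'w \<Rightarrow> real" where
  "drift s t \<omega> = (LINT r:{s<..t}|lborel. b (X (max 0 r) \<omega>))"

lemma drift_integrable:
  assumes "\<omega> \<in> space M"
  shows "set_integrable lborel {s<..t} (\<lambda>r. b (X (max 0 r) \<omega>))"
proof -
  have [measurable]: "(\<lambda>r. b (X (max 0 r) \<omega>)) \<in> borel_measurable borel"
    using X_section[OF assms] by measurable
  have "set_integrable lborel {s<..t} (\<lambda>r. K)" by (rule set_integrable_const_Ioc)
  then show ?thesis
    unfolding set_integrable_def
    by (rule Bochner_Integration.integrable_bound) (use b_bound K_nonneg in \<open>auto split: split_indicator\<close>)
qed

lemma drift_bound: "\<omega> \<in> space M \<Longrightarrow> s \<le> t \<Longrightarrow> \<bar>drift s t \<omega>\<bar> \<le> K * (t - s)"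
proof -
  assume a: "\<omega> \<in> space M" "s \<le> t"
  have "\<bar>drift s t \<omega>\<bar> \<le> (LINT r:{s<..t}|lborel. \<bar>b (X (max 0 r) \<omega>)\<bar>)"
    unfolding drift_def using set_integral_norm_bound[OF drift_integrable[OF a(1)]] by simp
  also have "\<dots> \<le> (LINT r:{s<..t}|lborel. K)"
    by (intro set_integral_mono set_integrable_abs drift_integrable[OF a(1)] b_bound set_integrable_const_Ioc)
  also have "\<dots> = K * (t - s)" using a by (simp add: set_lebesgue_integral_def)
  finally show ?thesis .
qed

lemma drift_meas [measurable]: "drift s t \<in> borel_measurable M"
  unfolding drift_def[abs_def] set_lebesgue_integral_def
  by (rule lborel.borel_measurable_lebesgue_integral) measurable

lemma drift_eq:
  assumes "\<omega> \<in> space M" "0 \<le> s" "s \<le> t"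
  shows "(LINT r:{0..t}|lborel. b (X r \<omega>)) - (LINT r:{0..s}|lborel. b (X r \<omega>)) = drift s t \<omega>"
proof -
  have *: "(LINT r:{0..u}|lborel. b (X r \<omega>)) = drift 0 u \<omega>" if "0 \<le> u" for u
  proof -
    have "(LINT r:{0..u}|lborel. b (X r \<omega>)) = (LINT r:{0..u}|lborel. b (X (max 0 r) \<omega>))"
      by (intro set_lebesgue_integral_cong) auto
    also have "\<dots> = drift 0 u \<omega>"
      unfolding drift_def set_lebesgue_integral_def
    proof (rule integral_cong_AE)
      show "AE r in lborel. indicat_real {0..u} r *\<^sub>R b (X (max 0 r) \<omega>) = indicat_real {0<..u} r *\<^sub>R b (X (max 0 r) \<omega>)"
        using AE_lborel_singleton[of 0] by eventually_elim (auto split: split_indicator)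
    qed (use X_section[OF assms(1)] in measurable)
    finally show ?thesis .
  qed
  have "drift 0 t \<omega> = drift 0 s \<omega> + drift s t \<omega>"
  proof -
    have "{0<..t} = {0<..s} \<union> {s<..t}" using assms by auto
    then show ?thesis unfolding drift_def
      by (simp add: set_integral_Un drift_integrable[OF assms(1)])
  qed
  then show ?thesis using assms by (simp add: *)
qed

text \<open>By the integral equation at \<open>s\<close> and \<open>t\<close>, this is almost surely
  the difference of the two Ito integrals minus a simple integral, and so can be made small in
  L2.\<close>

definition residual :: "real \<Rightarrow> real \<Rightarrow> nat \<Rightarrow> (nat \<Rightarrow> real) \<Rightarrow> (nat \<Rightarrow> 'w \<Rightarrow> real) \<Rightarrow> 'w \<Rightarrow> real" where
  "residual s t n \<rho> \<zeta> \<omega> = X t \<omega> - X s \<omega> - drift s t \<omega> - simple_integral B n \<rho> \<zeta> \<omega>"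

text \<open>One simple integral has to serve twice: it is close to the martingale part of
  \<open>X t - X s\<close>, and its integrand is close to \<open>v\<close> along the path. The
  errors are squares because later each is divided by \<open>\<epsilon>\<close> once.\<close>

lemma increment_approx:
  assumes "0 \<le> s" "s \<le> t" "0 < \<epsilon>"
  shows "\<exists>n \<rho> \<zeta>. s \<le> \<rho> 0 \<and> (\<forall>i<n. \<rho> i \<le> \<rho> (Suc i)) \<and> \<rho> n \<le> t \<and>
    (\<forall>i<n. \<zeta> i \<in> borel_measurable (F (\<rho> i))) \<and> (\<forall>i \<omega>. \<bar>\<zeta> i \<omega>\<bar> \<le> K) \<and>
    integrable M (\<lambda>\<omega>. (residual s t n \<rho> \<zeta> \<omega>)\<^sup>2) \<and>
    expectation (\<lambda>\<omega>. (residual s t n \<rho> \<zeta> \<omega>)\<^sup>2) \<le> \<epsilon>\<^sup>2 \<and>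
    (\<lambda>p. simple_process n \<rho> \<zeta> (snd p) (fst p)) \<in> borel_measurable (M \<Otimes>\<^sub>M borel) \<and>
    (\<forall>r \<omega>. \<bar>simple_process n \<rho> \<zeta> r \<omega>\<bar> \<le> K) \<and>
    (\<forall>r \<omega>. r \<notin> {s<..t} \<longrightarrow> simple_process n \<rho> \<zeta> r \<omega> = 0) \<and>
    integral\<^sup>L (time_prod s t) (\<lambda>p. (simple_process n \<rho> \<zeta> (snd p) (fst p) - v (X (max 0 (snd p)) (fst p)))\<^sup>2) \<le> \<epsilon>\<^sup>2"
proof -
  have t0: "0 \<le> t" using assms by simp
  obtain J where J: "has_ito_integral M F B t (\<lambda>s \<omega>. v (X s \<omega>)) J"
    "AE \<omega> in M. X t \<omega> = x0 + (LINT s:{0..t}|lborel. b (X s \<omega>)) + J \<omega>" using X_eq[OF t0] by auto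
  obtain J' where J': "has_ito_integral M F B s (\<lambda>s \<omega>. v (X s \<omega>)) J'"
    "AE \<omega> in M. X s \<omega> = x0 + (LINT s:{0..s}|lborel. b (X s \<omega>)) + J' \<omega>" using X_eq[OF assms(1)] by auto
  have H: "(\<lambda>(r, \<omega>). v (X (max 0 r) \<omega>)) \<in> borel_measurable (borel \<Otimes>\<^sub>M M)"
    using measurable_compose[OF X_joint v_meas] by (simp add: split_beta')
  have \<epsilon>2: "0 < \<epsilon>\<^sup>2" using assms by simp
  show ?thesis
  proof (rule ito_increment_approx[OF J(1) J'(1) assms(1,2) K_nonneg v_bound H \<epsilon>2])
    fix n \<rho> \<zeta>
    assume A: "s \<le> \<rho> 0" "\<And>i. i < n \<Longrightarrow> \<rho> i \<le> \<rho> (Suc i)" "\<rho> n \<le> t"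
      "\<And>i. i < n \<Longrightarrow> \<zeta> i \<in> borel_measurable (F (\<rho> i))" "\<And>i \<omega>. \<bar>\<zeta> i \<omega>\<bar> \<le> K"
      and A1: "(\<integral>\<^sup>+\<omega>. ennreal ((J \<omega> - J' \<omega> - simple_integral B n \<rho> \<zeta> \<omega>)\<^sup>2) \<partial>M) \<le> ennreal (\<epsilon>\<^sup>2)"
      and A2: "(\<integral>\<^sup>+\<omega>. (\<integral>\<^sup>+r\<in>{s<..t}. ennreal ((simple_process n \<rho> \<zeta> r \<omega> - v (X r \<omega>))\<^sup>2) \<partial>lborel) \<partial>M) \<le> ennreal (\<epsilon>\<^sup>2)"
    define Z where "Z \<omega> = X t \<omega> - X s \<omega> - drift s t \<omega> - simple_integral B n \<rho> \<zeta> \<omega>" for \<omega>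
    note mono = partition_mono[where \<tau>=\<rho> and n=n, OF A(2)]
    have [measurable]: "simple_integral B n \<rho> \<zeta> \<in> borel_measurable M"
      unfolding simple_integral_def[abs_def] using A(1,4) mono[of 0] assms(1)
      by (intro borel_measurable_sum borel_measurable_times borel_measurable_diff B_meas)
        (auto intro: F_meas order_trans)
    have [measurable]: "Z \<in> borel_measurable M"
      unfolding Z_def[abs_def] using assms t0 by measurable
    have nnZ: "(\<integral>\<^sup>+\<omega>. ennreal ((Z \<omega>)\<^sup>2) \<partial>M) \<le> ennreal (\<epsilon>\<^sup>2)"
    proof -
      have "AE \<omega> in M. Z \<omega> = J \<omega> - J' \<omega> - simple_integral B n \<rho> \<zeta> \<omega>"
        using J(2) J'(2) AE_space
      proof eventually_elim
        case (elim \<omega>)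
        then show ?case using drift_eq[OF elim(3) assms(1,2)] unfolding Z_def by linarith
      qed
      then have "(\<integral>\<^sup>+\<omega>. ennreal ((Z \<omega>)\<^sup>2) \<partial>M) = (\<integral>\<^sup>+\<omega>. ennreal ((J \<omega> - J' \<omega> - simple_integral B n \<rho> \<zeta> \<omega>)\<^sup>2) \<partial>M)"
        by (intro nn_integral_cong_AE) (auto elim: eventually_mono)
      then show ?thesis using A1 by simp
    qed
    have Zi: "integrable M (\<lambda>\<omega>. (Z \<omega>)\<^sup>2)"
      by (rule integrableI_nonneg) (use nnZ in \<open>auto intro: le_less_trans\<close>)
    have ZE: "expectation (\<lambda>\<omega>. (Z \<omega>)\<^sup>2) \<le> \<epsilon>\<^sup>2"
      using nnZ nn_integral_eq_integral[OF Zi] \<epsilon>2 by simp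
    have Qm: "(\<lambda>p. simple_process n \<rho> \<zeta> (snd p) (fst p)) \<in> borel_measurable (M \<Otimes>\<^sub>M borel)"
      unfolding simple_process_def
    proof (intro borel_measurable_sum)
      fix i assume "i \<in> {..<n}"
      then have [measurable]: "\<zeta> i \<in> borel_measurable M" using A(4) F_meas by auto
      show "(\<lambda>p. \<zeta> i (fst p) * indicat_real {\<rho> i<..\<rho> (Suc i)} (snd p)) \<in> borel_measurable (M \<Otimes>\<^sub>M borel)"
        by measurable
    qed
    have Qb: "\<bar>simple_process n \<rho> \<zeta> r \<omega>\<bar> \<le> K" for r \<omega>
      using A(2) by (rule simple_process_select[where 'w='w and n=n and \<tau>=\<rho> and r=r]) (auto simp: A(5) K_nonneg)
    have Q0: "simple_process n \<rho> \<zeta> r \<omega> = 0" if "r \<notin> {s<..t}" for r \<omega>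
      unfolding simple_process_def
    proof (intro sum.neutral ballI)
      fix i assume "i \<in> {..<n}"
      then show "\<zeta> i \<omega> * indicat_real {\<rho> i<..\<rho> (Suc i)} r = 0"
        using that A(1,3) mono[of 0 i] mono[of "Suc i" n] by (auto split: split_indicator)
    qed
    have "integral\<^sup>L (time_prod s t) (\<lambda>p. (simple_process n \<rho> \<zeta> (snd p) (fst p) - v (X (max 0 (snd p)) (fst p)))\<^sup>2) \<le> \<epsilon>\<^sup>2"
      (is "integral\<^sup>L _ ?f \<le> _")
    proof -
      interpret U: finite_measure "interval_measure_on s t"
        using time_density_finite[OF assms(2)] .
      have fm [measurable]: "?f \<in> borel_measurable (M \<Otimes>\<^sub>M borel)" using Qm by measurable
      have fi: "integrable (time_prod s t) ?f"
      proof (rule time_prod_integrable[OF assms(2) fm])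
        fix p
        have "\<bar>simple_process n \<rho> \<zeta> (snd p) (fst p) - v (X (max 0 (snd p)) (fst p))\<bar> \<le> 2 * K"
          using Qb[of "snd p" "fst p"] v_bound[of "X (max 0 (snd p)) (fst p)"] by linarith
        then show "\<bar>?f p\<bar> \<le> (2 * K)\<^sup>2" using power_mono[of _ "2 * K" 2] by fastforce
      qed
      have "ennreal (integral\<^sup>L (time_prod s t) ?f) = (\<integral>\<^sup>+p. ennreal (?f p) \<partial>time_prod s t)"
        by (rule nn_integral_eq_integral[OF fi, symmetric]) simp
      also have "\<dots> = (\<integral>\<^sup>+\<omega>. (\<integral>\<^sup>+r. ennreal (?f (\<omega>, r)) \<partial>interval_measure_on s t) \<partial>M)"
        unfolding time_prod_def by (rule U.nn_integral_fst[symmetric]) measurable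
      also have "\<dots> = (\<integral>\<^sup>+\<omega>. (\<integral>\<^sup>+r\<in>{s<..t}. ennreal ((simple_process n \<rho> \<zeta> r \<omega> - v (X r \<omega>))\<^sup>2) \<partial>lborel) \<partial>M)"
      proof (rule nn_integral_cong)
        fix \<omega> assume w: "\<omega> \<in> space M"
        have [measurable]: "(\<lambda>r. ?f (\<omega>, r)) \<in> borel_measurable borel"
          using measurable_compose[OF measurable_Pair1'[OF w] fm] .
        have "(\<integral>\<^sup>+r. ennreal (?f (\<omega>, r)) \<partial>interval_measure_on s t) =
          (\<integral>\<^sup>+r. ennreal (indicator {s<..t} r) * ennreal (?f (\<omega>, r)) \<partial>lborel)"
          by (rule nn_integral_density) measurable
        also have "\<dots> = (\<integral>\<^sup>+r\<in>{s<..t}. ennreal ((simple_process n \<rho> \<zeta> r \<omega> - v (X r \<omega>))\<^sup>2) \<partial>lborel)"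
          using assms(1) by (intro nn_integral_cong) (auto split: split_indicator)
        finally show "(\<integral>\<^sup>+r. ennreal (?f (\<omega>, r)) \<partial>interval_measure_on s t) =
          (\<integral>\<^sup>+r\<in>{s<..t}. ennreal ((simple_process n \<rho> \<zeta> r \<omega> - v (X r \<omega>))\<^sup>2) \<partial>lborel)" .
      qed
      also have "\<dots> \<le> ennreal (\<epsilon>\<^sup>2)" by (rule A2)
      finally show ?thesis using \<epsilon>2 by simp
    qed
    then show ?thesis
      using A Zi ZE Qm Qb Q0 unfolding Z_def residual_def by (intro exI[of _ n] exI[of _ \<rho>] exI[of _ \<zeta>] conjI) simp_all
  qed
qed

end

text \<open>The inequality between arithmetic and geometric mean. It turns second moments into first
  moments in place of the Cauchy-Schwarz inequality, at no loss of order when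
  \<open>\<epsilon>\<close> has the size of the L2 norm.\<close>

lemma abs_le_half_sum_sq:
  assumes "0 < \<epsilon>"
  shows "\<bar>z\<bar> \<le> (\<epsilon> + z\<^sup>2 / \<epsilon>) / (2::real)"
proof -
  have "0 \<le> (\<bar>z\<bar> - \<epsilon>)\<^sup>2" by simp
  then have "2 * \<bar>z\<bar> * \<epsilon> \<le> \<epsilon> * \<epsilon> + z\<^sup>2" by (simp add: power2_eq_square algebra_simps)
  then show ?thesis using assms by (simp add: field_simps)
qed

text \<open>A Lipschitz second derivative stands in for a third one. This is exactly the regularity
  that averaging gives to a function whose first derivative is only Lipschitz.\<close>

definition smooth_test :: "real \<Rightarrow> (real \<Rightarrow> real) \<Rightarrow> (real \<Rightarrow> real) \<Rightarrow> (real \<Rightarrow> real) \<Rightarrow> bool" where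
  "smooth_test C \<phi> \<phi>1 \<phi>2 \<longleftrightarrow>
     (\<forall>y. (\<phi> has_real_derivative \<phi>1 y) (at y)) \<and> (\<forall>y. (\<phi>1 has_real_derivative \<phi>2 y) (at y)) \<and>
     (\<forall>y. \<bar>\<phi> y\<bar> \<le> C) \<and> (\<forall>y. \<bar>\<phi>1 y\<bar> \<le> C) \<and> (\<forall>y. \<bar>\<phi>2 y\<bar> \<le> C) \<and>
     (\<forall>y z. \<bar>\<phi>2 y - \<phi>2 z\<bar> \<le> C * \<bar>y - z\<bar>)"

lemma lipschitz_of_deriv_bound:
  fixes f f' :: "real \<Rightarrow> real"
  assumes "\<And>y. (f has_real_derivative f' y) (at y)" "\<And>y. \<bar>f' y\<bar> \<le> C"
  shows "\<bar>f y - f z\<bar> \<le> C * \<bar>y - z\<bar>"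
  using field_differentiable_bound[of UNIV f f' C y z] assms by simp

lemma smooth_testD:
  assumes "smooth_test C \<phi> \<phi>1 \<phi>2"
  shows "(\<phi> has_real_derivative \<phi>1 y) (at y)" "(\<phi>1 has_real_derivative \<phi>2 y) (at y)"
    "\<bar>\<phi> y\<bar> \<le> C" "\<bar>\<phi>1 y\<bar> \<le> C" "\<bar>\<phi>2 y\<bar> \<le> C" "\<bar>\<phi>2 y - \<phi>2 z\<bar> \<le> C * \<bar>y - z\<bar>"
    "\<bar>\<phi> y - \<phi> z\<bar> \<le> C * \<bar>y - z\<bar>" "\<bar>\<phi>1 y - \<phi>1 z\<bar> \<le> C * \<bar>y - z\<bar>" "0 \<le> C"
    "\<phi> \<in> borel_measurable borel" "\<phi>1 \<in> borel_measurable borel" "\<phi>2 \<in> borel_measurable borel"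
proof -
  show D: "(\<phi> has_real_derivative \<phi>1 y) (at y)" "(\<phi>1 has_real_derivative \<phi>2 y) (at y)"
    "\<bar>\<phi> y\<bar> \<le> C" "\<bar>\<phi>1 y\<bar> \<le> C" "\<bar>\<phi>2 y\<bar> \<le> C" "\<bar>\<phi>2 y - \<phi>2 z\<bar> \<le> C * \<bar>y - z\<bar>" for y z
    using assms by (auto simp: smooth_test_def)
  show "\<bar>\<phi> y - \<phi> z\<bar> \<le> C * \<bar>y - z\<bar>" "\<bar>\<phi>1 y - \<phi>1 z\<bar> \<le> C * \<bar>y - z\<bar>"
    by (rule lipschitz_of_deriv_bound[OF D(1) D(4)]) (rule lipschitz_of_deriv_bound[OF D(2) D(5)])
  show "0 \<le> C" using D(3)[of 0] by linarith
  show "\<phi> \<in> borel_measurable borel" "\<phi>1 \<in> borel_measurable borel"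
    by (rule borel_measurable_continuous_onI[OF DERIV_continuous_on[OF has_field_derivative_at_within[OF D(1)]]],
        rule borel_measurable_continuous_onI[OF DERIV_continuous_on[OF has_field_derivative_at_within[OF D(2)]]])
  have "C-lipschitz_on UNIV \<phi>2"
    using D(6) \<open>0 \<le> C\<close> by (auto intro!: lipschitz_onI simp: dist_real_def)
  then show "\<phi>2 \<in> borel_measurable borel"
    by (intro borel_measurable_continuous_onI lipschitz_on_continuous_on)
qed

text \<open>Lagrange remainder at a point within \<open>\<bar>S\<bar>\<close> of \<open>y\<close>,
  where the Lipschitz bound for \<open>\<phi>2\<close> applies; the factor 1/2 is given
  away.\<close>

lemma taylor2_bound:
  assumes "smooth_test C \<phi> \<phi>1 \<phi>2"
  shows "\<bar>\<phi> (y + S) - \<phi> y - \<phi>1 y * S - \<phi>2 y * S\<^sup>2 / 2\<bar> \<le> C * \<bar>S\<bar> ^ 3"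
proof (cases "S = 0")
  case False
  note D = smooth_testD[OF assms]
  define diff where "diff m = (if m = 0 then \<phi> else if m = 1 then \<phi>1 else \<phi>2)" for m :: nat
  have "\<exists>t. (if y + S < y then y + S < t \<and> t < y else y < t \<and> t < y + S) \<and>
    \<phi> (y + S) = (\<Sum>m<2. (diff m y / fact m) * (y + S - y) ^ m) + (diff 2 t / fact 2) * (y + S - y) ^ 2"
    by (rule Taylor[where a="min y (y + S)" and b="max y (y + S)"])
      (use D(1,2) False in \<open>auto simp: diff_def less_2_cases_iff\<close>)
  then obtain t where t1: "if y + S < y then y + S < t \<and> t < y else y < t \<and> t < y + S"
    and t2: "\<phi> (y + S) = (\<Sum>m<2. (diff m y / fact m) * (y + S - y) ^ m) + (diff 2 t / fact 2) * (y + S - y) ^ 2"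
    by (elim exE conjE) (rule that)
  have t: "\<bar>t - y\<bar> \<le> \<bar>S\<bar>" using t1 by (cases "y + S < y") auto
  have eq: "\<phi> (y + S) = \<phi> y + \<phi>1 y * S + \<phi>2 t * S\<^sup>2 / 2"
    using t2 by (simp add: diff_def lessThan_Suc numeral_2_eq_2)
  have eq3: "\<bar>S\<bar> ^ 3 = \<bar>S\<bar> * S\<^sup>2"
    by (cases "0 \<le> S") (auto simp: power3_eq_cube power2_eq_square)
  have "\<phi> (y + S) - \<phi> y - \<phi>1 y * S - \<phi>2 y * S\<^sup>2 / 2 = (\<phi>2 t - \<phi>2 y) * S\<^sup>2 / 2"
    unfolding eq by (simp add: left_diff_distrib diff_divide_distrib)
  then have "\<bar>\<phi> (y + S) - \<phi> y - \<phi>1 y * S - \<phi>2 y * S\<^sup>2 / 2\<bar> = \<bar>(\<phi>2 t - \<phi>2 y) * S\<^sup>2 / 2\<bar>"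
    by (rule arg_cong)
  also have "\<dots> = \<bar>\<phi>2 t - \<phi>2 y\<bar> * S\<^sup>2 / 2"
    by (simp add: abs_mult)
  also have "\<dots> \<le> (C * \<bar>S\<bar>) * S\<^sup>2 / 2"
    using D(6)[of t y] mult_left_mono[OF t D(9)] by (intro divide_right_mono mult_right_mono) auto
  also have "\<dots> \<le> C * \<bar>S\<bar> ^ 3"
  proof -
    have "0 \<le> C * \<bar>S\<bar> * S\<^sup>2" using D(9) by simp
    then show ?thesis unfolding eq3 by (simp add: mult.assoc)
  qed
  finally show ?thesis .
qed simp

text \<open>\<open>D\<close> will be of order t - s and \<open>S\<close> of order sqrt(t - s), so
  first order in \<open>D\<close> is enough: both error terms have order (t - s)^(3/2). The shift by
  \<open>D\<close> is treated by the mean value inequality for the function with its slope at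
  \<open>y\<close> removed.\<close>

lemma taylor_drift_bound:
  assumes "smooth_test C \<phi> \<phi>1 \<phi>2"
  shows "\<bar>\<phi> (y + D + S) - \<phi> y - \<phi>1 y * S - \<phi>2 y * S\<^sup>2 / 2 - \<phi>1 y * D\<bar> \<le> C * \<bar>S\<bar> ^ 3 + C * \<bar>D\<bar> * (\<bar>S\<bar> + \<bar>D\<bar>)"
proof -
  note T = smooth_testD[OF assms]
  define f where "f h = \<phi> (y + S + h) - \<phi>1 y * h" for h
  have "norm (f D - f 0) \<le> C * (\<bar>S\<bar> + \<bar>D\<bar>) * norm (D - 0)"
  proof (rule field_differentiable_bound[where f=f and x=D and y=0 and S="{- \<bar>D\<bar>..\<bar>D\<bar>}" and f'="\<lambda>h. \<phi>1 (y + S + h) - \<phi>1 y"])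
    fix h assume h: "h \<in> {- \<bar>D\<bar>..\<bar>D\<bar>}"
    have "((\<lambda>h. \<phi> (y + S + h)) has_real_derivative \<phi>1 (y + S + h) * (0 + 1)) (at h)"
      by (rule DERIV_chain2[OF T(1)]) (rule DERIV_add[OF DERIV_const DERIV_ident])
    from DERIV_diff[OF this DERIV_cmult_Id]
    have "(f has_real_derivative \<phi>1 (y + S + h) * (0 + 1) - \<phi>1 y) (at h)" unfolding f_def[abs_def] .
    then show "(f has_field_derivative \<phi>1 (y + S + h) - \<phi>1 y) (at h within {- \<bar>D\<bar>..\<bar>D\<bar>})"
      by (simp add: has_field_derivative_at_within)
    have "\<bar>\<phi>1 (y + S + h) - \<phi>1 y\<bar> \<le> C * \<bar>S + h\<bar>" using T(8)[of "y + S + h" y] by (simp add: add.assoc)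
    also have "\<dots> \<le> C * (\<bar>S\<bar> + \<bar>D\<bar>)" using h T(9) by (intro mult_left_mono) auto
    finally show "norm (\<phi>1 (y + S + h) - \<phi>1 y) \<le> C * (\<bar>S\<bar> + \<bar>D\<bar>)" by simp
  qed auto
  then have step: "\<bar>\<phi> (y + S + D) - \<phi> (y + S) - \<phi>1 y * D\<bar> \<le> C * \<bar>D\<bar> * (\<bar>S\<bar> + \<bar>D\<bar>)"
    by (simp add: f_def mult.assoc mult.commute[of "\<bar>D\<bar>"]) (simp add: algebra_simps)?
  have eq: "y + D + S = y + S + D" by simp
  have "\<phi> (y + S + D) - \<phi> y - \<phi>1 y * S - \<phi>2 y * S\<^sup>2 / 2 - \<phi>1 y * D =
    (\<phi> (y + S) - \<phi> y - \<phi>1 y * S - \<phi>2 y * S\<^sup>2 / 2) + (\<phi> (y + S + D) - \<phi> (y + S) - \<phi>1 y * D)"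
    by simp
  then show ?thesis
    unfolding eq by (simp only:) (rule order_trans[OF abs_triangle_ineq add_mono[OF taylor2_bound[OF assms] step]])
qed

section \<open>First absolute moments of the increments of the diffusion\<close>

context diffusion
begin

lemma abs_increment_bound:
  assumes "0 \<le> s" "s < t" "t - s \<le> 1"
  shows "integrable M (\<lambda>\<omega>. \<bar>X t \<omega> - X s \<omega>\<bar>)"
    and "expectation (\<lambda>\<omega>. \<bar>X t \<omega> - X s \<omega>\<bar>) \<le> (3/2 + K + K\<^sup>2/2) * sqrt (t - s)"
proof -
  \<comment> \<open>The approximation error is put on the scale of the increment itself. Then the
    residual contributes at most \<open>\<epsilon>\<close>, the drift \<open>K * \<epsilon>\<close>
    and the simple integral \<open>(1 + K\<^sup>2) / 2 * \<epsilon>\<close>, which add up to the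
    constant in the claim.\<close>
  define \<epsilon> where "\<epsilon> = sqrt (t - s)"
  have \<epsilon>: "0 < \<epsilon>" "t - s = \<epsilon>\<^sup>2" "\<epsilon> \<le> 1" using assms by (auto simp: \<epsilon>_def)
  obtain n \<rho> \<zeta> where A0: "s \<le> \<rho> 0" "\<forall>i<n. \<rho> i \<le> \<rho> (Suc i)" "\<rho> n \<le> t"
    "\<forall>i<n. \<zeta> i \<in> borel_measurable (F (\<rho> i))" "\<forall>i \<omega>. \<bar>\<zeta> i \<omega>\<bar> \<le> K"
    and Zi: "integrable M (\<lambda>\<omega>. (residual s t n \<rho> \<zeta> \<omega>)\<^sup>2)"
    and ZE: "expectation (\<lambda>\<omega>. (residual s t n \<rho> \<zeta> \<omega>)\<^sup>2) \<le> \<epsilon>\<^sup>2"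
    using increment_approx[OF assms(1) less_imp_le[OF assms(2)] \<epsilon>(1)] by (elim exE conjE) (rule that)
  have A: "s \<le> \<rho> 0" "\<And>i. i < n \<Longrightarrow> \<rho> i \<le> \<rho> (Suc i)" "\<rho> n \<le> t"
    "\<And>i. i < n \<Longrightarrow> \<zeta> i \<in> borel_measurable (F (\<rho> i))" "\<And>i \<omega>. \<bar>\<zeta> i \<omega>\<bar> \<le> K"
    using A0 by auto
  let ?Z = "residual s t n \<rho> \<zeta>" and ?R = "simple_integral B n \<rho> \<zeta>"
  have \<rho>0: "0 \<le> \<rho> 0" using A(1) assms(1) by simp
  have mom: "integrable M (\<lambda>\<omega>. ?R \<omega> ^ 2)" "expectation (\<lambda>\<omega>. ?R \<omega> ^ 2) \<le> K\<^sup>2 * (\<rho> n - \<rho> 0)"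
    using simple_integral_moments[of \<rho> n \<zeta> K, OF \<rho>0 A(2,4,5)] by auto
  have RE: "expectation (\<lambda>\<omega>. ?R \<omega> ^ 2) \<le> K\<^sup>2 * \<epsilon>\<^sup>2"
    using A(1,3) \<epsilon>(2) by (intro order_trans[OF mom(2)] mult_left_mono) auto
  define g where "g \<omega> = (\<epsilon> + (?Z \<omega>)\<^sup>2 / \<epsilon>) / 2 + K * \<epsilon>\<^sup>2 + (\<epsilon> + (?R \<omega>)\<^sup>2 / \<epsilon>) / 2" for \<omega>
  have gi: "integrable M g" unfolding g_def[abs_def] using Zi mom(1) by simp
  have bound: "\<bar>X t \<omega> - X s \<omega>\<bar> \<le> g \<omega>" if "\<omega> \<in> space M" for \<omega>
  proof -
    have "X t \<omega> - X s \<omega> = ?Z \<omega> + drift s t \<omega> + ?R \<omega>" by (simp add: residual_def)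
    then have "\<bar>X t \<omega> - X s \<omega>\<bar> \<le> \<bar>?Z \<omega>\<bar> + \<bar>drift s t \<omega>\<bar> + \<bar>?R \<omega>\<bar>" by linarith
    also have "\<dots> \<le> g \<omega>"
      unfolding g_def using drift_bound[OF that less_imp_le[OF assms(2)]]
      by (intro add_mono abs_le_half_sum_sq \<epsilon>(1)) (simp add: \<epsilon>(2))
    finally show ?thesis .
  qed
  show i: "integrable M (\<lambda>\<omega>. \<bar>X t \<omega> - X s \<omega>\<bar>)"
  proof (rule Bochner_Integration.integrable_bound[OF gi])
    have [measurable]: "X s \<in> borel_measurable M" "X t \<in> borel_measurable M" using assms by (auto intro!: X_meas)
    show "(\<lambda>\<omega>. \<bar>X t \<omega> - X s \<omega>\<bar>) \<in> borel_measurable M" by measurable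
    show "AE \<omega> in M. norm \<bar>X t \<omega> - X s \<omega>\<bar> \<le> norm (g \<omega>)" using order_trans[OF bound abs_ge_self] by (auto intro!: AE_I2)
  qed
  have "expectation (\<lambda>\<omega>. \<bar>X t \<omega> - X s \<omega>\<bar>) \<le> expectation g"
    by (rule integral_mono[OF i gi bound])
  also have "\<dots> = (\<epsilon> + expectation (\<lambda>\<omega>. (?Z \<omega>)\<^sup>2) / \<epsilon>) / 2 + K * \<epsilon>\<^sup>2 + (\<epsilon> + expectation (\<lambda>\<omega>. (?R \<omega>)\<^sup>2) / \<epsilon>) / 2"
    unfolding g_def[abs_def] using Zi mom(1) by (simp add: prob_space)
  also have "\<dots> \<le> (\<epsilon> + \<epsilon>\<^sup>2 / \<epsilon>) / 2 + K * \<epsilon> + (\<epsilon> + K\<^sup>2 * \<epsilon>\<^sup>2 / \<epsilon>) / 2"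
    using ZE RE \<epsilon> K_nonneg power_decreasing[of 1 2 \<epsilon>]
    by (intro add_mono divide_right_mono mult_left_mono) auto
  also have "\<dots> = (3/2 + K + K\<^sup>2/2) * \<epsilon>" using \<epsilon>(1) by (simp add: field_simps power2_eq_square)
  finally show "expectation (\<lambda>\<omega>. \<bar>X t \<omega> - X s \<omega>\<bar>) \<le> (3/2 + K + K\<^sup>2/2) * sqrt (t - s)" by (simp add: \<epsilon>_def)
qed

end

lemma abs_integral_le_integral:
  fixes f g :: "'a \<Rightarrow> real"
  assumes "integrable M f" "integrable M g" "AE x in M. \<bar>f x\<bar> \<le> g x"
  shows "\<bar>integral\<^sup>L M f\<bar> \<le> integral\<^sup>L M g"
proof -
  have "\<bar>integral\<^sup>L M f\<bar> \<le> (\<integral>x. \<bar>f x\<bar> \<partial>M)" by (rule integral_abs_bound)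
  also have "\<dots> \<le> integral\<^sup>L M g"
    using assms by (intro integral_mono_AE integrable_abs)
  finally show ?thesis .
qed

section \<open>Dynkin's formula over one short time step\<close>

context diffusion
begin

lemma adm_comp:
  assumes "0 \<le> s" "f \<in> borel_measurable borel" "\<And>y. \<bar>f y\<bar> \<le> (C::real)"
  shows "adm s (\<lambda>\<omega>. f (X s \<omega>))"
  unfolding adm_def
proof
  show "(\<lambda>\<omega>. f (X s \<omega>)) \<in> borel_measurable (F s)"
    by (rule measurable_compose[OF X_adapted[OF assms(1)] assms(2)])
  show "bounded ((\<lambda>\<omega>. f (X s \<omega>)) ` space M)"
    unfolding bounded_iff by (rule exI[of _ C]) (use assms(3) in auto)
qed

text \<open>The generator, with both derivatives as separate arguments, so that a left derivative
  can later take the place of the second one.\<close>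

definition gen :: "(real \<Rightarrow> real) \<Rightarrow> (real \<Rightarrow> real) \<Rightarrow> real \<Rightarrow> real" where
  "gen \<phi>1 \<phi>2 y = \<phi>1 y * b y + \<phi>2 y * (v y)\<^sup>2 / 2"

lemma gen_meas:
  assumes "smooth_test C \<phi> \<phi>1 \<phi>2"
  shows "gen \<phi>1 \<phi>2 \<in> borel_measurable borel"
proof -
  note [measurable] = smooth_testD(11,12)[OF assms]
  show ?thesis unfolding gen_def[abs_def] by measurable
qed

lemma gen_bound:
  assumes "\<bar>\<phi>1 y\<bar> \<le> C" "\<bar>\<phi>2 y\<bar> \<le> C"
  shows "\<bar>gen \<phi>1 \<phi>2 y\<bar> \<le> C * K + C * K\<^sup>2 / 2"
proof -
  have C: "0 \<le> C" using assms(1) by linarith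
  have "\<bar>(v y)\<^sup>2\<bar> \<le> K\<^sup>2" using power_mono[OF v_bound[of y] abs_ge_zero, of 2] by simp
  then have "\<bar>\<phi>2 y * (v y)\<^sup>2\<bar> \<le> C * K\<^sup>2" unfolding abs_mult by (intro mult_mono assms C) auto
  moreover have "\<bar>\<phi>1 y * b y\<bar> \<le> C * K" unfolding abs_mult by (intro mult_mono assms C b_bound) auto
  ultimately show ?thesis unfolding gen_def by linarith
qed

lemma gen_bound_smooth:
  "smooth_test C \<phi> \<phi>1 \<phi>2 \<Longrightarrow> \<bar>gen \<phi>1 \<phi>2 y\<bar> \<le> C * K + C * K\<^sup>2 / 2"
  by (rule gen_bound) (rule smooth_testD(4), assumption, rule smooth_testD(5), assumption)

text \<open>The summands are the cubic Taylor remainder, the cross term of drift and martingale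
  part, and the freezing of the derivatives at time s. The last factor is the constant of
  \<open>abs_increment_bound\<close>.\<close>

definition dynkin_const :: "real \<Rightarrow> real" where
  "dynkin_const C = C * ((K\<^sup>2 + 3 * K ^ 4) / 2) + C * K * ((1 + K\<^sup>2) / 2 + K)
     + C * (K + K\<^sup>2 / 2) * (3/2 + K + K\<^sup>2/2)"

text \<open>Two scales are kept apart: \<open>\<eta>\<close>, the root of the step length, appears
  in the bound, while the accuracy \<open>\<epsilon>\<close> of the simple integral is arbitrary and
  is paid for by the slack \<open>e\<close>. The chain is: replace \<open>X t\<close> by
  \<open>X s\<close> plus drift plus simple integral (\<open>e1\<close>), expand
  (\<open>e2\<close>), turn the surviving terms into time integrals (\<open>e3\<close>,
  \<open>e4\<close>), replace the simple integrand by \<open>v\<close> (\<open>e5\<close>), and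
  unfreeze the derivatives (\<open>e6\<close>).\<close>

lemma dynkin_local:
  assumes T: "smooth_test C \<phi> \<phi>1 \<phi>2" and st: "0 \<le> s" "s < t" "t - s \<le> 1"
  shows "\<bar>expectation (\<lambda>\<omega>. \<phi> (X t \<omega>)) - expectation (\<lambda>\<omega>. \<phi> (X s \<omega>)) -
    integral\<^sup>L (time_prod s t) (\<lambda>p. gen \<phi>1 \<phi>2 (X (max 0 (snd p)) (fst p)))\<bar>
    \<le> dynkin_const C * ((t - s) * sqrt (t - s))" (is "?L \<le> _")
proof (rule field_le_epsilon)
  fix e :: real assume e: "0 < e"
  note TD = smooth_testD[OF T]
  note [measurable] = TD(10-12)
  \<comment> \<open>The slack has to cover \<open>C * \<epsilon>\<close> from \<open>e1\<close> and
    half of the error in \<open>e5\<close>; the summand 1 avoids division by zero.\<close>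
  define \<epsilon> where "\<epsilon> = e / (C + C * K + 1)"
  have CK: "0 \<le> C * K" using TD(9) K_nonneg by simp
  have \<epsilon>: "0 < \<epsilon>" using e TD(9) CK by (simp add: \<epsilon>_def add_nonneg_pos)
  have \<epsilon>e: "(C + C * K) * \<epsilon> \<le> e"
  proof -
    have "(C + C * K) * \<epsilon> \<le> (C + C * K + 1) * \<epsilon>" using \<epsilon> by (intro mult_right_mono) auto
    also have "\<dots> = e" using TD(9) CK by (simp add: \<epsilon>_def)
    finally show ?thesis .
  qed
  define \<eta> where "\<eta> = sqrt (t - s)"
  have \<eta>: "0 < \<eta>" "t - s = \<eta>\<^sup>2" "\<eta> \<le> 1" using st by (auto simp: \<eta>_def)
  have t0: "0 \<le> t" and stle: "s \<le> t" using st by auto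
  have Xm [measurable]: "X s \<in> borel_measurable M" "X t \<in> borel_measurable M" using st(1) t0 by (auto intro!: X_meas)
  obtain n \<rho> \<zeta> where A0: "s \<le> \<rho> 0" "\<forall>i<n. \<rho> i \<le> \<rho> (Suc i)" "\<rho> n \<le> t"
    "\<forall>i<n. \<zeta> i \<in> borel_measurable (F (\<rho> i))" "\<forall>i \<omega>. \<bar>\<zeta> i \<omega>\<bar> \<le> K"
    and Zi: "integrable M (\<lambda>\<omega>. (residual s t n \<rho> \<zeta> \<omega>)\<^sup>2)"
    and ZE: "expectation (\<lambda>\<omega>. (residual s t n \<rho> \<zeta> \<omega>)\<^sup>2) \<le> \<epsilon>\<^sup>2"
    and Qm: "(\<lambda>p. simple_process n \<rho> \<zeta> (snd p) (fst p)) \<in> borel_measurable (M \<Otimes>\<^sub>M borel)"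
    and Qb: "\<forall>r \<omega>. \<bar>simple_process n \<rho> \<zeta> r \<omega>\<bar> \<le> K"
    and Q0: "\<forall>r \<omega>. r \<notin> {s<..t} \<longrightarrow> simple_process n \<rho> \<zeta> r \<omega> = 0"
    and QE: "integral\<^sup>L (time_prod s t) (\<lambda>p. (simple_process n \<rho> \<zeta> (snd p) (fst p) - v (X (max 0 (snd p)) (fst p)))\<^sup>2) \<le> \<epsilon>\<^sup>2"
    using increment_approx[OF st(1) stle \<epsilon>] by (elim exE conjE) (rule that)
  have A: "s \<le> \<rho> 0" "\<And>i. i < n \<Longrightarrow> \<rho> i \<le> \<rho> (Suc i)" "\<rho> n \<le> t"
    "\<And>i. i < n \<Longrightarrow> \<zeta> i \<in> borel_measurable (F (\<rho> i))" "\<And>i \<omega>. \<bar>\<zeta> i \<omega>\<bar> \<le> K"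
    using A0 by auto
  define R where "R = simple_integral B n \<rho> \<zeta>"
  define D where "D = drift s t"
  define Z where "Z \<omega> = X t \<omega> - X s \<omega> - D \<omega> - R \<omega>" for \<omega>
  define Q where "Q p = simple_process n \<rho> \<zeta> (snd p) (fst p)" for p
  define Y where "Y p = X (max 0 (snd p)) (fst p)" for p
  have Ym [measurable]: "Y \<in> borel_measurable (M \<Otimes>\<^sub>M borel)" unfolding Y_def[abs_def] by (rule X_joint')
  have Qm' [measurable]: "Q \<in> borel_measurable (M \<Otimes>\<^sub>M borel)" unfolding Q_def[abs_def] by (rule Qm)
  have Qb': "\<bar>Q p\<bar> \<le> K" for p using Qb by (simp add: Q_def)
  have Dm [measurable]: "D \<in> borel_measurable M" unfolding D_def by (rule drift_meas)
  have Db: "\<bar>D \<omega>\<bar> \<le> K * \<eta>\<^sup>2" if "\<omega> \<in> space M" for \<omega>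
    using drift_bound[OF that stle] \<eta>(2) by (simp add: D_def)
  have Zi': "integrable M (\<lambda>\<omega>. (Z \<omega>)\<^sup>2)" and ZE': "expectation (\<lambda>\<omega>. (Z \<omega>)\<^sup>2) \<le> \<epsilon>\<^sup>2"
    using Zi ZE by (simp_all add: Z_def D_def R_def residual_def)
  have \<rho>0: "0 \<le> \<rho> 0" using A(1) st(1) by simp
  have mom: "R \<in> borel_measurable (F (\<rho> n))" "\<forall>j\<le>4. integrable M (\<lambda>\<omega>. R \<omega> ^ j)"
    "expectation (\<lambda>\<omega>. R \<omega> ^ 2) \<le> K\<^sup>2 * (\<rho> n - \<rho> 0)"
    "expectation (\<lambda>\<omega>. R \<omega> ^ 4) \<le> 3 * K ^ 4 * (\<rho> n - \<rho> 0)\<^sup>2" "\<rho> 0 \<le> \<rho> n"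
    using simple_integral_moments[of \<rho> n \<zeta> K, OF \<rho>0 A(2,4,5)] unfolding R_def by simp_all
  have Rm [measurable]: "R \<in> borel_measurable M" using F_meas[OF mom(1)] .
  have R2i: "integrable M (\<lambda>\<omega>. R \<omega> ^ 2)" and R4i: "integrable M (\<lambda>\<omega>. R \<omega> ^ 4)"
    using mom(2) by simp_all
  have len: "\<rho> n - \<rho> 0 \<le> \<eta>\<^sup>2" "0 \<le> \<rho> n - \<rho> 0" using A(1,3) mom(5) \<eta>(2) by linarith+
  have R2: "expectation (\<lambda>\<omega>. R \<omega> ^ 2) \<le> K\<^sup>2 * \<eta>\<^sup>2"
    by (rule order_trans[OF mom(3) mult_left_mono[OF len(1)]]) simp
  have R4: "expectation (\<lambda>\<omega>. R \<omega> ^ 4) \<le> 3 * K ^ 4 * \<eta> ^ 4"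
  proof (rule order_trans[OF mom(4)])
    have "(\<rho> n - \<rho> 0)\<^sup>2 \<le> (\<eta>\<^sup>2)\<^sup>2" by (rule power_mono[OF len])
    also have "\<dots> = \<eta> ^ 4" by simp
    finally show "3 * K ^ 4 * (\<rho> n - \<rho> 0)\<^sup>2 \<le> 3 * K ^ 4 * \<eta> ^ 4"
      by (rule mult_left_mono) (simp add: K_nonneg)
  qed
  have a1: "adm s (\<lambda>\<omega>. \<phi>1 (X s \<omega>))" by (rule adm_comp[OF st(1) TD(11) TD(4)])
  have a2: "adm s (\<lambda>\<omega>. \<phi>2 (X s \<omega>))" by (rule adm_comp[OF st(1) TD(12) TD(5)])
  note W1 = simple_integral_weighted(1,3)[where n=n and \<rho>=\<rho> and \<zeta>=\<zeta> and K=K, OF st(1) A(1,2,4,5) a1, folded R_def]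
  note W2 = simple_integral_weighted(2,4)[where n=n and \<rho>=\<rho> and \<zeta>=\<zeta> and K=K, OF st(1) A(1,2,4,5) a2, folded R_def]
  have i\<phi>: "integrable M (\<lambda>\<omega>. \<phi> (f \<omega>))" if [measurable]: "f \<in> borel_measurable M" for f
    by (rule integrable_const_bound[where B=C]) (use TD(3) in auto)
  have i1: "integrable M (\<lambda>\<omega>. \<phi> (X t \<omega>))" "integrable M (\<lambda>\<omega>. \<phi> (X s \<omega>))"
    "integrable M (\<lambda>\<omega>. \<phi> (X s \<omega> + D \<omega> + R \<omega>))"
    by (intro i\<phi>; measurable)+
  have i2: "integrable M (\<lambda>\<omega>. \<phi>1 (X s \<omega>) * D \<omega>)"
  proof (rule integrable_const_bound[where B="C * (K * \<eta>\<^sup>2)"])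
    show "AE \<omega> in M. norm (\<phi>1 (X s \<omega>) * D \<omega>) \<le> C * (K * \<eta>\<^sup>2)"
      unfolding real_norm_def abs_mult by (intro AE_I2 mult_mono TD(4) Db TD(9)) auto
  qed measurable

  have e1: "\<bar>expectation (\<lambda>\<omega>. \<phi> (X t \<omega>)) - expectation (\<lambda>\<omega>. \<phi> (X s \<omega> + D \<omega> + R \<omega>))\<bar> \<le> C * \<epsilon>"
  proof -
    let ?U = "\<lambda>\<omega>. \<phi> (X t \<omega>) - \<phi> (X s \<omega> + D \<omega> + R \<omega>)" and ?V = "\<lambda>\<omega>. C * ((\<epsilon> + (Z \<omega>)\<^sup>2 / \<epsilon>) / 2)"
    have "\<bar>expectation ?U\<bar> \<le> expectation ?V"
    proof (rule abs_integral_le_integral)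
      show "integrable M ?U" using i1 by simp
      show "integrable M ?V" using Zi' by simp
      show "AE \<omega> in M. \<bar>?U \<omega>\<bar> \<le> ?V \<omega>"
      proof (rule AE_I2)
        fix \<omega>
        have "\<bar>?U \<omega>\<bar> \<le> C * \<bar>X t \<omega> - (X s \<omega> + D \<omega> + R \<omega>)\<bar>" by (rule TD(7))
        also have "X t \<omega> - (X s \<omega> + D \<omega> + R \<omega>) = Z \<omega>" by (simp add: Z_def)
        also have "C * \<bar>Z \<omega>\<bar> \<le> ?V \<omega>"
          by (rule mult_left_mono[OF abs_le_half_sum_sq[OF \<epsilon>] TD(9)])
        finally show "\<bar>?U \<omega>\<bar> \<le> ?V \<omega>" .
      qed
    qed
    also have "\<dots> = C * ((\<epsilon> + expectation (\<lambda>\<omega>. (Z \<omega>)\<^sup>2) / \<epsilon>) / 2)" using Zi' by (simp add: prob_space)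
    also have "\<dots> \<le> C * ((\<epsilon> + \<epsilon>\<^sup>2 / \<epsilon>) / 2)"
      using \<epsilon> by (intro mult_left_mono divide_right_mono add_left_mono ZE' TD(9)) auto
    also have "\<dots> = C * \<epsilon>" using \<epsilon> by (simp add: power2_eq_square)
    finally show ?thesis using i1 by simp
  qed

  define h where "h \<omega> = \<phi> (X s \<omega> + D \<omega> + R \<omega>) - \<phi> (X s \<omega>) - \<phi>1 (X s \<omega>) * R \<omega> - \<phi>2 (X s \<omega>) * (R \<omega>)\<^sup>2 / 2 - \<phi>1 (X s \<omega>) * D \<omega>" for \<omega>
  have hi: "integrable M h" unfolding h_def[abs_def] using i1 i2 W1 W2 by simp
  have e2: "\<bar>expectation h\<bar> \<le> (C * ((K\<^sup>2 + 3 * K ^ 4) / 2) + C * K * ((1 + K\<^sup>2) / 2 + K)) * \<eta> ^ 3"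
  proof -
    \<comment> \<open>Multiplying
      \<open>\<bar>R\<bar> \<le> (\<eta> + R\<^sup>2 / \<eta>) / 2\<close> by the square of
      \<open>R\<close> leaves only second and fourth powers. With moments of order
      \<open>\<eta>\<^sup>2\<close> and \<open>\<eta> ^ 4\<close>, every term has order at least
      \<open>\<eta> ^ 3\<close>.\<close>
    let ?W = "\<lambda>\<omega>. C * ((\<eta> * R \<omega> ^ 2 + R \<omega> ^ 4 / \<eta>) / 2) + C * (K * \<eta>\<^sup>2) * ((\<eta> + R \<omega> ^ 2 / \<eta>) / 2 + K * \<eta>\<^sup>2)"
    have "\<bar>expectation h\<bar> \<le> expectation ?W"
    proof (rule abs_integral_le_integral[OF hi])
      show "integrable M ?W"
        using R2i R4i by simp
      show "AE \<omega> in M. \<bar>h \<omega>\<bar> \<le> ?W \<omega>"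
      proof (rule AE_I2)
        fix \<omega> assume w: "\<omega> \<in> space M"
        note am = abs_le_half_sum_sq[OF \<eta>(1), of "R \<omega>"]
        have "\<bar>h \<omega>\<bar> \<le> C * \<bar>R \<omega>\<bar> ^ 3 + C * \<bar>D \<omega>\<bar> * (\<bar>R \<omega>\<bar> + \<bar>D \<omega>\<bar>)"
          unfolding h_def by (rule taylor_drift_bound[OF T])
        also have "\<dots> \<le> ?W \<omega>"
        proof (intro add_mono)
          have "\<bar>R \<omega>\<bar> ^ 3 = \<bar>R \<omega>\<bar> * (R \<omega>)\<^sup>2" by (cases "0 \<le> R \<omega>") (auto simp: power3_eq_cube power2_eq_square)
          also have "\<dots> \<le> (\<eta> + (R \<omega>)\<^sup>2 / \<eta>) / 2 * (R \<omega>)\<^sup>2" by (rule mult_right_mono[OF am]) simp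
          also have "\<dots> = (\<eta> * R \<omega> ^ 2 + R \<omega> ^ 4 / \<eta>) / 2"
            by (simp add: power_numeral_reduce distrib_right)
          finally show "C * \<bar>R \<omega>\<bar> ^ 3 \<le> C * ((\<eta> * R \<omega> ^ 2 + R \<omega> ^ 4 / \<eta>) / 2)"
            by (rule mult_left_mono[OF _ TD(9)])
          show "C * \<bar>D \<omega>\<bar> * (\<bar>R \<omega>\<bar> + \<bar>D \<omega>\<bar>) \<le> C * (K * \<eta>\<^sup>2) * ((\<eta> + R \<omega> ^ 2 / \<eta>) / 2 + K * \<eta>\<^sup>2)"
            using K_nonneg TD(9) by (intro mult_mono add_mono am Db[OF w]) auto
        qed
        finally show "\<bar>h \<omega>\<bar> \<le> ?W \<omega>" .
      qed
    qed
    also have "\<dots> = C * ((\<eta> * expectation (\<lambda>\<omega>. R \<omega> ^ 2) + expectation (\<lambda>\<omega>. R \<omega> ^ 4) / \<eta>) / 2)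
       + C * (K * \<eta>\<^sup>2) * ((\<eta> + expectation (\<lambda>\<omega>. R \<omega> ^ 2) / \<eta>) / 2 + K * \<eta>\<^sup>2)"
      using R2i R4i by (simp add: prob_space)
    also have "\<dots> \<le> C * ((\<eta> * (K\<^sup>2 * \<eta>\<^sup>2) + (3 * K ^ 4 * \<eta> ^ 4) / \<eta>) / 2) + C * (K * \<eta>\<^sup>2) * ((\<eta> + (K\<^sup>2 * \<eta>\<^sup>2) / \<eta>) / 2 + K * \<eta>)"
      using \<eta> TD(9) K_nonneg power_decreasing[of 1 2 \<eta>]
      by (intro add_mono mult_left_mono divide_right_mono R2 R4 mult_nonneg_nonneg order_refl) auto
    also have "\<dots> = (C * ((K\<^sup>2 + 3 * K ^ 4) / 2) + C * K * ((1 + K\<^sup>2) / 2 + K)) * \<eta> ^ 3"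
    proof -
      have "(3 * K ^ 4 * \<eta> ^ 4) / \<eta> = 3 * K ^ 4 * \<eta> ^ 3" "(K\<^sup>2 * \<eta>\<^sup>2) / \<eta> = K\<^sup>2 * \<eta>"
        using \<eta>(1) by (simp_all add: power_numeral_reduce)
      then show ?thesis by (simp add: power_numeral_reduce algebra_simps add_divide_distrib)
    qed
    finally show ?thesis .
  qed

  let ?I = "integral\<^sup>L (time_prod s t)"
  define f1 f2 fQ g where "f1 p = \<phi>1 (X s (fst p)) * b (Y p)" and "f2 p = \<phi>2 (X s (fst p)) * (v (Y p))\<^sup>2"
    and "fQ p = \<phi>2 (X s (fst p)) * (Q p)\<^sup>2" and "g p = \<phi>1 (Y p) * b (Y p) + \<phi>2 (Y p) * (v (Y p))\<^sup>2 / 2" for p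
  have fm [measurable]: "f1 \<in> borel_measurable (M \<Otimes>\<^sub>M borel)" "f2 \<in> borel_measurable (M \<Otimes>\<^sub>M borel)"
    "fQ \<in> borel_measurable (M \<Otimes>\<^sub>M borel)" "g \<in> borel_measurable (M \<Otimes>\<^sub>M borel)"
    unfolding f1_def[abs_def] f2_def[abs_def] fQ_def[abs_def] g_def[abs_def] by measurable
  have sqb: "\<bar>y\<^sup>2\<bar> \<le> K\<^sup>2" if "\<bar>y\<bar> \<le> K" for y :: real
    using power_mono[OF that abs_ge_zero, of 2] by simp
  have fb: "\<bar>f1 p\<bar> \<le> C * K" "\<bar>f2 p\<bar> \<le> C * K\<^sup>2" "\<bar>fQ p\<bar> \<le> C * K\<^sup>2" "\<bar>g p\<bar> \<le> C * K + C * K\<^sup>2 / 2" for p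
  proof -
    show "\<bar>f1 p\<bar> \<le> C * K" unfolding f1_def abs_mult by (intro mult_mono TD(4,9) b_bound) auto
    show "\<bar>f2 p\<bar> \<le> C * K\<^sup>2" unfolding f2_def abs_mult by (intro mult_mono TD(5,9) sqb v_bound) auto
    show "\<bar>fQ p\<bar> \<le> C * K\<^sup>2" unfolding fQ_def abs_mult by (intro mult_mono TD(5,9) sqb Qb') auto
    have "\<bar>\<phi>1 (Y p) * b (Y p)\<bar> \<le> C * K" unfolding abs_mult by (intro mult_mono TD(4,9) b_bound) auto
    moreover have "\<bar>\<phi>2 (Y p) * (v (Y p))\<^sup>2\<bar> \<le> C * K\<^sup>2" unfolding abs_mult by (intro mult_mono TD(5,9) sqb v_bound) auto
    ultimately show "\<bar>g p\<bar> \<le> C * K + C * K\<^sup>2 / 2" unfolding g_def by linarith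
  qed
  have fi: "integrable (time_prod s t) f1" "integrable (time_prod s t) f2" "integrable (time_prod s t) fQ" "integrable (time_prod s t) g"
    using time_prod_integrable[OF stle fm(1) fb(1)] time_prod_integrable[OF stle fm(2) fb(2)]
      time_prod_integrable[OF stle fm(3) fb(3)] time_prod_integrable[OF stle fm(4) fb(4)] by auto

  have e3: "expectation (\<lambda>\<omega>. \<phi>1 (X s \<omega>) * D \<omega>) = ?I f1"
    unfolding time_prod_fubini(1)[OF stle fm(1) fi(1)] by (simp add: f1_def Y_def D_def drift_def)
  have e4: "expectation (\<lambda>\<omega>. \<phi>2 (X s \<omega>) * (R \<omega>)\<^sup>2) = ?I fQ"
  proof -
    note W2(1)
    also have "expectation (\<lambda>\<omega>. LINT r|lborel. \<phi>2 (X s \<omega>) * (simple_process n \<rho> \<zeta> r \<omega>)\<^sup>2)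
       = expectation (\<lambda>\<omega>. LINT r:{s<..t}|lborel. fQ (\<omega>, r))"
      unfolding set_lebesgue_integral_def
      by (intro Bochner_Integration.integral_cong refl) (use Q0 in \<open>auto simp: fQ_def Q_def indicator_def\<close>)
    also have "\<dots> = ?I fQ"
      by (rule time_prod_fubini(1)[OF stle fm(3) fi(3), symmetric])
    finally show ?thesis .
  qed

  \<comment> \<open>A difference of squares: the sum \<open>Q + v\<close> is at most
    \<open>2 * K\<close>, and the difference, small in L2, is handled by the arithmetic-geometric
    inequality with parameter \<open>\<epsilon>\<close>. The length of the step enters only as a
    factor at most 1.\<close>
  have e5: "\<bar>?I fQ - ?I f2\<bar> \<le> 2 * (C * K * \<epsilon>)"
  proof -
    let ?q = "\<lambda>p. (Q p - v (Y p))\<^sup>2"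
    have qb: "\<bar>?q p\<bar> \<le> (2 * K)\<^sup>2" for p
    proof -
      have "\<bar>Q p - v (Y p)\<bar> \<le> 2 * K" using Qb'[of p] v_bound[of "Y p"] by linarith
      from power_mono[OF this abs_ge_zero, of 2] show ?thesis by simp
    qed
    have qi: "integrable (time_prod s t) ?q" by (rule time_prod_integrable[OF stle _ qb]) measurable
    have ci: "integrable (time_prod s t) (\<lambda>p. C * K * \<epsilon>)"
      by (rule time_prod_integrable[OF stle _ order_refl]) measurable
    have "\<bar>?I (\<lambda>p. fQ p - f2 p)\<bar> \<le> ?I (\<lambda>p. C * K * \<epsilon> + C * K / \<epsilon> * ?q p)"
    proof (rule abs_integral_le_integral)
      show "integrable (time_prod s t) (\<lambda>p. fQ p - f2 p)" using fi by simp
      show "integrable (time_prod s t) (\<lambda>p. C * K * \<epsilon> + C * K / \<epsilon> * ?q p)"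
        by (intro Bochner_Integration.integrable_add ci integrable_mult_right qi)
      show "AE p in time_prod s t. \<bar>fQ p - f2 p\<bar> \<le> C * K * \<epsilon> + C * K / \<epsilon> * ?q p"
      proof (rule AE_I2)
        fix p
        have "fQ p - f2 p = \<phi>2 (X s (fst p)) * ((Q p + v (Y p)) * (Q p - v (Y p)))"
          by (simp add: fQ_def f2_def power2_eq_square algebra_simps)
        then have "\<bar>fQ p - f2 p\<bar> = \<bar>\<phi>2 (X s (fst p))\<bar> * (\<bar>Q p + v (Y p)\<bar> * \<bar>Q p - v (Y p)\<bar>)"
          by (simp add: abs_mult)
        also have "\<dots> \<le> C * ((2 * K) * ((\<epsilon> + ?q p / \<epsilon>) / 2))"
        proof (intro mult_mono TD(5) TD(9) abs_le_half_sum_sq[OF \<epsilon>])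
          show "\<bar>Q p + v (Y p)\<bar> \<le> 2 * K" using Qb'[of p] v_bound[of "Y p"] by linarith
        qed (use K_nonneg in auto)
        also have "\<dots> = C * K * \<epsilon> + C * K / \<epsilon> * ?q p" by (simp add: distrib_left)
        finally show "\<bar>fQ p - f2 p\<bar> \<le> C * K * \<epsilon> + C * K / \<epsilon> * ?q p" .
      qed
    qed
    also have "\<dots> = ?I (\<lambda>p. C * K * \<epsilon>) + C * K / \<epsilon> * ?I ?q"
      by (subst Bochner_Integration.integral_add[OF ci integrable_mult_right[OF qi]]) simp
    also have "\<dots> \<le> C * K * \<epsilon> * (t - s) + C * K / \<epsilon> * \<epsilon>\<^sup>2"
    proof (intro add_mono mult_left_mono)
      show "?I (\<lambda>p. C * K * \<epsilon>) \<le> C * K * \<epsilon> * (t - s)"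
        by (rule time_prod_le[OF stle _ order_refl]) (auto simp: prob_space)
      show "?I ?q \<le> \<epsilon>\<^sup>2" using QE by (simp add: Q_def Y_def)
    qed (use CK \<epsilon> in auto)
    also have "\<dots> \<le> C * K * \<epsilon> * 1 + C * K * \<epsilon>"
      using CK \<epsilon> st(3) by (intro add_mono mult_left_mono) (auto simp: power2_eq_square)
    finally show ?thesis using fi by simp
  qed

  \<comment> \<open>On both sides \<open>b\<close> and \<open>v\<close> are taken at time r, so only
    the Lipschitz functions \<open>\<phi>1\<close> and \<open>\<phi>2\<close> are compared at
    different positions.\<close>
  have e6: "\<bar>?I f1 + ?I f2 / 2 - ?I g\<bar>
     \<le> C * (K + K\<^sup>2 / 2) * (3/2 + K + K\<^sup>2/2) * \<eta> ^ 3"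
  proof -
    let ?\<psi> = "\<lambda>p. \<bar>f1 p + f2 p / 2 - g p\<bar>"
    have pb: "\<bar>?\<psi> p\<bar> \<le> 2 * (C * K + C * K\<^sup>2 / 2)" for p
    proof -
      have "\<bar>?\<psi> p\<bar> \<le> \<bar>f1 p\<bar> + \<bar>f2 p\<bar> / 2 + \<bar>g p\<bar>" by linarith
      also have "\<dots> \<le> C * K + C * K\<^sup>2 / 2 + (C * K + C * K\<^sup>2 / 2)"
        by (intro add_mono divide_right_mono fb) simp
      finally show ?thesis by simp
    qed
    have pm: "?\<psi> \<in> borel_measurable (M \<Otimes>\<^sub>M borel)" by measurable
    have "?I f1 + ?I f2 / 2 - ?I g
       = ?I (\<lambda>p. f1 p + f2 p / 2 - g p)" using fi by simp
    then have "\<bar>?I f1 + ?I f2 / 2 - ?I g\<bar>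
      \<le> ?I ?\<psi>" by (simp only: integral_abs_bound)
    also have "\<dots> \<le> (C * (K + K\<^sup>2 / 2) * ((3/2 + K + K\<^sup>2/2) * \<eta>)) * (t - s)"
    proof (rule time_prod_le[OF stle pm pb])
      fix r assume r: "s < r" "r \<le> t"
      have r0: "max 0 r = r" and r1: "r - s \<le> 1" using r st by auto
      note inc = abs_increment_bound[OF st(1) r(1) r1]
      have "?\<psi> (\<omega>, r) \<le> C * (K + K\<^sup>2 / 2) * \<bar>X r \<omega> - X s \<omega>\<bar>" for \<omega>
      proof -
        have "f1 (\<omega>, r) + f2 (\<omega>, r) / 2 - g (\<omega>, r) =
          (\<phi>1 (X s \<omega>) - \<phi>1 (X r \<omega>)) * b (X r \<omega>) + (\<phi>2 (X s \<omega>) - \<phi>2 (X r \<omega>)) * (v (X r \<omega>))\<^sup>2 / 2"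
          by (simp add: f1_def f2_def g_def Y_def r0 left_diff_distrib diff_divide_distrib)
        also have "\<bar>\<dots>\<bar> \<le> (C * \<bar>X s \<omega> - X r \<omega>\<bar>) * K + (C * \<bar>X s \<omega> - X r \<omega>\<bar>) * K\<^sup>2 / 2"
        proof (rule order_trans[OF abs_triangle_ineq add_mono])
          show "\<bar>(\<phi>1 (X s \<omega>) - \<phi>1 (X r \<omega>)) * b (X r \<omega>)\<bar> \<le> (C * \<bar>X s \<omega> - X r \<omega>\<bar>) * K"
            unfolding abs_mult using TD(9) by (intro mult_mono TD(8) b_bound) auto
          have "\<bar>(\<phi>2 (X s \<omega>) - \<phi>2 (X r \<omega>)) * (v (X r \<omega>))\<^sup>2\<bar> \<le> (C * \<bar>X s \<omega> - X r \<omega>\<bar>) * K\<^sup>2"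
            unfolding abs_mult using TD(9) by (intro mult_mono TD(6) sqb v_bound) auto
          then show "\<bar>(\<phi>2 (X s \<omega>) - \<phi>2 (X r \<omega>)) * (v (X r \<omega>))\<^sup>2 / 2\<bar> \<le> (C * \<bar>X s \<omega> - X r \<omega>\<bar>) * K\<^sup>2 / 2"
            by simp
        qed
        also have "\<dots> = C * (K + K\<^sup>2 / 2) * \<bar>X r \<omega> - X s \<omega>\<bar>"
          by (simp add: abs_minus_commute[of "X r \<omega>"] distrib_left distrib_right)
        finally show ?thesis .
      qed
      then have "expectation (\<lambda>\<omega>. ?\<psi> (\<omega>, r)) \<le> expectation (\<lambda>\<omega>. C * (K + K\<^sup>2 / 2) * \<bar>X r \<omega> - X s \<omega>\<bar>)"
        using inc(1) TD(9) K_nonneg by (intro integral_mono' integrable_mult_right) simp_all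
      also have "\<dots> = C * (K + K\<^sup>2 / 2) * expectation (\<lambda>\<omega>. \<bar>X r \<omega> - X s \<omega>\<bar>)" by simp
      also have "\<dots> \<le> C * (K + K\<^sup>2 / 2) * ((3/2 + K + K\<^sup>2/2) * sqrt (r - s))"
        using TD(9) K_nonneg by (intro mult_left_mono inc(2)) auto
      also have "\<dots> \<le> C * (K + K\<^sup>2 / 2) * ((3/2 + K + K\<^sup>2/2) * \<eta>)"
        using TD(9) K_nonneg r(2) by (intro mult_left_mono) (auto simp: \<eta>_def)
      finally show "expectation (\<lambda>\<omega>. ?\<psi> (\<omega>, r)) \<le> C * (K + K\<^sup>2 / 2) * ((3/2 + K + K\<^sup>2/2) * \<eta>)" .
    qed
    also have "\<dots> = C * (K + K\<^sup>2 / 2) * (3/2 + K + K\<^sup>2/2) * \<eta> ^ 3"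
      by (simp only: \<eta>(2) power2_eq_square power3_eq_cube mult.assoc)
    finally show ?thesis .
  qed

  have hE: "expectation h = expectation (\<lambda>\<omega>. \<phi> (X s \<omega> + D \<omega> + R \<omega>)) - expectation (\<lambda>\<omega>. \<phi> (X s \<omega>))
     - ?I fQ / 2 - ?I f1"
    unfolding h_def[abs_def] using i1 i2 W1 W2 by (simp add: e3 e4)
  have "(t - s) * sqrt (t - s) = \<eta> ^ 3" using \<eta>(2) by (simp add: \<eta>_def power3_eq_cube power2_eq_square)
  then have rhs: "dynkin_const C * ((t - s) * sqrt (t - s)) =
     (C * ((K\<^sup>2 + 3 * K ^ 4) / 2) + C * K * ((1 + K\<^sup>2) / 2 + K)) * \<eta> ^ 3 + C * (K + K\<^sup>2 / 2) * (3/2 + K + K\<^sup>2/2) * \<eta> ^ 3"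
    unfolding dynkin_const_def by (simp only: distrib_right)
  have eps: "C * \<epsilon> + C * K * \<epsilon> \<le> e" using \<epsilon>e by (simp only: distrib_right)
  have lhs: "?L = \<bar>expectation (\<lambda>\<omega>. \<phi> (X t \<omega>)) - expectation (\<lambda>\<omega>. \<phi> (X s \<omega>)) - integral\<^sup>L (time_prod s t) g\<bar>"
    by (simp add: g_def[abs_def] Y_def gen_def)
  show "?L \<le> dynkin_const C * ((t - s) * sqrt (t - s)) + e"
    unfolding rhs lhs using e1 e2 e5 e6 eps unfolding hE by linarith
qed

end

section \<open>The resolvent\<close>

lemma exponential_tail:
  assumes "0 < q" "0 \<le> r"
  shows "measure (density lborel (exponential_density q)) {r<..} = exp (- r * q)"
proof -
  interpret N: prob_space "density lborel (exponential_density q)" by (rule prob_space_exponential_density[OF assms(1)])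
  have "distributed (density lborel (exponential_density q)) lborel (\<lambda>x. x) (exponential_density q)"
    unfolding distributed_def by (simp add: distr_id2)
  from N.exponential_distributedD_gt[OF this assms(2,1)] show ?thesis
    by (simp add: greaterThan_def)
qed

text \<open>Fubini over 0 < r < t: the exponential time exceeds r with probability exp(-q r), which
  is 1/q times its density at r.\<close>

lemma laplace_of_primitive:
  fixes H :: "real \<Rightarrow> real"
  assumes q: "0 < q" and H [measurable]: "H \<in> borel_measurable borel" and Hb: "\<And>r. \<bar>H r\<bar> \<le> C"
  shows "(\<integral>t. (LINT r:{0<..t}|lborel. H r) \<partial>density lborel (exponential_density q))
    = (\<integral>r. H r \<partial>density lborel (exponential_density q)) / q"
proof -
  let ?N = "density lborel (exponential_density q)"
  interpret N: prob_space ?N by (rule prob_space_exponential_density[OF q])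
  interpret P: pair_sigma_finite lborel ?N ..
  \<comment> \<open>Strict in the upper variable, so that the section in t is the tail
    \<open>{r<..}\<close>; compared with \<open>{0<..t}\<close> this changes the inner integral only
    at the single point r = t.\<close>
  define k where "k p = (if 0 < fst p \<and> fst p < snd p then H (fst p) else 0)" for p :: "real \<times> real"
  have km [measurable]: "k \<in> borel_measurable (lborel \<Otimes>\<^sub>M ?N)" unfolding k_def[abs_def] by measurable
  have inner: "integrable ?N (\<lambda>t. k (r, t)) \<and> (\<integral>t. k (r, t) \<partial>?N) = indicator {0<..} r * H r * exp (- r * q)
      \<and> (\<integral>t. norm (k (r, t)) \<partial>?N) = indicator {0<..} r * \<bar>H r\<bar> * exp (- r * q)" for r
  proof (cases "0 < r")
    case True
    have eq: "(\<lambda>t. k (r, t)) = (\<lambda>t. H r * indicator {r<..} t)" "(\<lambda>t. norm (k (r, t))) = (\<lambda>t. \<bar>H r\<bar> * indicator {r<..} t)"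
      using True by (auto simp: k_def fun_eq_iff)
    have "integrable ?N (indicator {r<..} :: real \<Rightarrow> real)"
      by (intro integrable_real_indicator) (simp_all add: less_top[symmetric] N.emeasure_finite)
    then show ?thesis
      unfolding eq using True exponential_tail[OF q, of r] by simp
  next
    case False
    then have "k (r, t) = 0" for t by (simp add: k_def)
    then show ?thesis using False by simp
  qed
  have ei: "integrable lborel (exponential_density q)"
  proof -
    have "integrable ?N (\<lambda>_. 1 :: real)" by simp
    then show ?thesis using q by (subst (asm) integrable_density) (auto simp: exponential_density_nonneg)
  qed
  have ki: "integrable (lborel \<Otimes>\<^sub>M ?N) k"
  proof (rule P.Fubini_integrable[OF km])
    show "integrable lborel (\<lambda>r. \<integral>t. norm (k (r, t)) \<partial>?N)"
    proof (rule Bochner_Integration.integrable_bound)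
      show "integrable lborel (\<lambda>r. C / q * exponential_density q r)" using ei by simp
      show "(\<lambda>r. \<integral>t. norm (k (r, t)) \<partial>?N) \<in> borel_measurable lborel" by measurable
      show "AE r in lborel. norm (\<integral>t. norm (k (r, t)) \<partial>?N) \<le> norm (C / q * exponential_density q r)"
      proof (rule AE_I2)
        fix r
        have "\<bar>H r\<bar> * exp (- r * q) \<le> \<bar>C\<bar> * exp (- r * q)"
          using Hb[of r] by (intro mult_right_mono) auto
        then show "norm (\<integral>t. norm (k (r, t)) \<partial>?N) \<le> norm (C / q * exponential_density q r)"
          using inner[of r] q by (cases "0 < r") (auto simp: exponential_density_def abs_mult)
      qed
    qed
    show "AE r in lborel. integrable ?N (\<lambda>t. k (r, t))" using inner by simp
  qed
  have "(\<integral>t. (LINT r:{0<..t}|lborel. H r) \<partial>?N) = (\<integral>t. (\<integral>r. k (r, t) \<partial>lborel) \<partial>?N)"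
  proof (rule Bochner_Integration.integral_cong[OF refl])
    fix t
    show "(LINT r:{0<..t}|lborel. H r) = (\<integral>r. k (r, t) \<partial>lborel)"
      unfolding set_lebesgue_integral_def
    proof (rule integral_cong_AE)
      show "AE r in lborel. indicat_real {0<..t} r *\<^sub>R H r = k (r, t)"
        using AE_lborel_singleton[of t] by eventually_elim (auto simp: k_def split: split_indicator)
      show "(\<lambda>r. indicat_real {0<..t} r *\<^sub>R H r) \<in> borel_measurable lborel" by measurable
      show "(\<lambda>r. k (r, t)) \<in> borel_measurable lborel" unfolding k_def fst_conv snd_conv by measurable
    qed
  qed
  also have "\<dots> = (\<integral>r. (\<integral>t. k (r, t) \<partial>?N) \<partial>lborel)"
  proof -
    have ki': "integrable (lborel \<Otimes>\<^sub>M ?N) (case_prod (\<lambda>r t. k (r, t)))" using ki by simp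
    show ?thesis using P.Fubini_integral[OF ki'] by simp
  qed
  also have "\<dots> = (\<integral>r. exponential_density q r * H r / q \<partial>lborel)"
  proof (rule integral_cong_AE)
    show "AE r in lborel. (\<integral>t. k (r, t) \<partial>?N) = exponential_density q r * H r / q"
      using AE_lborel_singleton[of 0]
      by eventually_elim (use inner q in \<open>auto simp: exponential_density_def split: split_indicator\<close>)
  qed measurable
  also have "\<dots> = (\<integral>r. H r \<partial>?N) / q"
    using q by (subst integral_density) (auto simp: exponential_density_nonneg)
  finally show ?thesis .
qed

section \<open>Dynkin's formula for all times, and its value at an independent exponential
  time\<close>

context diffusion
begin

lemma mean_meas:
  assumes [measurable]: "f \<in> borel_measurable borel"
  shows "(\<lambda>r. expectation (\<lambda>\<omega>. f (X (max 0 r) \<omega>) :: real)) \<in> borel_measurable borel"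
proof (rule borel_measurable_lebesgue_integral)
  show "(\<lambda>(r, \<omega>). f (X (max 0 r) \<omega>)) \<in> borel_measurable (borel \<Otimes>\<^sub>M M)"
    using measurable_compose[OF X_joint assms] by (simp add: split_beta')
qed

lemma mean_bound:
  assumes "f \<in> borel_measurable borel" "\<And>y. \<bar>f y\<bar> \<le> (C::real)" "0 \<le> r"
  shows "\<bar>expectation (\<lambda>\<omega>. f (X r \<omega>))\<bar> \<le> C"
proof -
  have "integrable M (\<lambda>\<omega>. f (X r \<omega>))"
    by (rule integrable_const_bound[where B=C]) (use assms(2) measurable_compose[OF X_meas[OF assms(3)] assms(1)] in auto)
  then have "\<bar>expectation (\<lambda>\<omega>. f (X r \<omega>))\<bar> \<le> expectation (\<lambda>\<omega>. C)"
    using assms(2) by (intro abs_integral_le_integral) auto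
  then show ?thesis by (simp add: prob_space)
qed

lemma dynkin:
  assumes T: "smooth_test C \<phi> \<phi>1 \<phi>2" and t: "0 \<le> t"
  shows "expectation (\<lambda>\<omega>. \<phi> (X t \<omega>)) = \<phi> x0 + (LINT r:{0<..t}|lborel. expectation (\<lambda>\<omega>. gen \<phi>1 \<phi>2 (X (max 0 r) \<omega>)))"
proof -
  note TD = smooth_testD[OF T]
  define H where "H r = expectation (\<lambda>\<omega>. gen \<phi>1 \<phi>2 (X (max 0 r) \<omega>))" for r
  define m where "m t = expectation (\<lambda>\<omega>. \<phi> (X t \<omega>))" for t
  define \<Phi> where "\<Phi> t = m t - (LINT r:{0<..t}|lborel. H r)" for t
  have f: "(\<lambda>p. gen \<phi>1 \<phi>2 (X (max 0 (snd p)) (fst p))) \<in> borel_measurable (M \<Otimes>\<^sub>M borel)"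
    using measurable_compose[OF X_joint' gen_meas[OF T]] .
  have fi: "integrable (time_prod s t) (\<lambda>p. gen \<phi>1 \<phi>2 (X (max 0 (snd p)) (fst p)))" if "s \<le> t" for s t
    by (rule time_prod_integrable[OF that f gen_bound_smooth[OF T]])
  have Hi: "set_integrable lborel {s<..t} H" and
    Hf: "integral\<^sup>L (time_prod s t) (\<lambda>p. gen \<phi>1 \<phi>2 (X (max 0 (snd p)) (fst p))) = (LINT r:{s<..t}|lborel. H r)" if "s \<le> t" for s t
    using time_prod_fubini(2,4)[OF that f fi[OF that]] by (simp_all add: H_def[abs_def])
  have step: "\<bar>\<Phi> t - \<Phi> s\<bar> \<le> dynkin_const C * ((t - s) * sqrt (t - s))" if "0 \<le> s" "s < t" "t - s \<le> 1" for s t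
  proof -
    have "{0<..t} = {0<..s} \<union> {s<..t}" using that by auto
    then have "(LINT r:{0<..t}|lborel. H r) = (LINT r:{0<..s}|lborel. H r) + (LINT r:{s<..t}|lborel. H r)"
      using that by (simp add: set_integral_Un Hi)
    then have "\<Phi> t - \<Phi> s = m t - m s - integral\<^sup>L (time_prod s t) (\<lambda>p. gen \<phi>1 \<phi>2 (X (max 0 (snd p)) (fst p)))"
      using Hf[of s t] that by (simp add: \<Phi>_def)
    then show ?thesis
      using dynkin_local[OF T that] by (simp only: m_def)
  qed
  have step': "\<bar>\<Phi> y - \<Phi> x\<bar> \<le> dynkin_const C * (\<bar>y - x\<bar> * sqrt \<bar>y - x\<bar>)" if "0 \<le> x" "0 \<le> y" "\<bar>y - x\<bar> < 1" "y \<noteq> x" for x y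
    using step[of x y] step[of y x] that by (cases "x < y") (auto simp: abs_minus_commute)
  have "(\<Phi> has_field_derivative 0) (at x within {0..})" if x: "x \<in> {0..}" for x
    unfolding has_field_derivative_iff
  proof (rule Lim_null_comparison)
    show "\<forall>\<^sub>F y in at x within {0..}. norm ((\<Phi> y - \<Phi> x) / (y - x)) \<le> dynkin_const C * sqrt \<bar>y - x\<bar>"
      unfolding eventually_at
    proof (intro exI[of _ 1] conjI ballI impI)
      fix y assume y: "y \<in> {0..}" "y \<noteq> x \<and> dist y x < 1"
      then have "\<bar>\<Phi> y - \<Phi> x\<bar> \<le> (dynkin_const C * sqrt \<bar>y - x\<bar>) * \<bar>y - x\<bar>"
        using step'[of x y] x by (simp add: dist_real_def mult_ac)
      then show "norm ((\<Phi> y - \<Phi> x) / (y - x)) \<le> dynkin_const C * sqrt \<bar>y - x\<bar>"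
        using y by (simp add: pos_divide_le_eq)
    qed simp
    show "((\<lambda>y. dynkin_const C * sqrt \<bar>y - x\<bar>) \<longlongrightarrow> 0) (at x within {0..})"
    proof -
      have "((\<lambda>y. dynkin_const C * sqrt \<bar>y - x\<bar>) \<longlongrightarrow> dynkin_const C * sqrt \<bar>x - x\<bar>) (at x within {0..})"
        by (intro tendsto_intros)
      then show ?thesis by simp
    qed
  qed
  then obtain c where c: "\<And>x. x \<in> {0..} \<Longrightarrow> \<Phi> x = c"
    using has_field_derivative_zero_constant[of "{0::real..}" \<Phi>] by (auto simp: convex_real_interval)
  have "m 0 = \<phi> x0"
  proof -
    have [measurable]: "X 0 \<in> borel_measurable M" by (rule X_meas) simp
    note [measurable] = TD(10)
    have "m 0 = expectation (\<lambda>\<omega>. \<phi> x0)"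
      unfolding m_def by (rule integral_cong_AE) (use X_0 in auto)
    then show ?thesis by (simp add: prob_space)
  qed
  then have "\<Phi> 0 = \<phi> x0" by (simp add: \<Phi>_def set_lebesgue_integral_def)
  then have "\<Phi> t = \<phi> x0" using c[of 0] c[of t] t by simp
  then show ?thesis by (simp add: \<Phi>_def m_def H_def)
qed

text \<open>Independence is given for the path algebra \<open>G\<close>, so Fubini is applied on
  \<open>G\<close> times the line: there the joint law of the sample point and \<open>e\<close> is a
  product. This needs \<open>X\<close> jointly measurable with respect to \<open>G\<close>, which
  path continuity provides.\<close>

lemma exponential_time_law:
  assumes e: "distributed M lborel e (exponential_density q)" and q: "0 < q"
    and ind: "indep_set (sets (path_algebra (space M) {0..} X)) (sets (vimage_algebra (space M) e borel))"
    and f: "f \<in> borel_measurable borel" "\<And>y. \<bar>f y\<bar> \<le> (C::real)"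
  shows "expectation (\<lambda>\<omega>. f (X (max 0 (e \<omega>)) \<omega>)) =
    (\<integral>t. expectation (\<lambda>\<omega>. f (X (max 0 t) \<omega>)) \<partial>density lborel (exponential_density q))"
proof -
  define G where "G = path_algebra (space M) {0..} X"
  have spG: "space G = space M" by (simp add: G_def path_algebra_def)
  have sG: "sets G \<subseteq> sets M" using indep_setD_ev1[OF ind] by (simp add: G_def)
  \<comment> \<open>Pushing \<open>M\<close> forward along the identity into the coarser
    \<open>G\<close> restricts the probability to events of the path.\<close>
  have idG: "(\<lambda>\<omega>. \<omega>) \<in> measurable M G"
    using sG spG sets.sets_into_space[of _ M] by (auto simp: measurable_def Int_absorb2)
  have em [measurable]: "e \<in> borel_measurable M" using distributed_measurable[OF e] by simp
  let ?G = "distr M G (\<lambda>\<omega>. \<omega>)" and ?GE = "distr M (G \<Otimes>\<^sub>M borel) (\<lambda>\<omega>. (\<omega>, e \<omega>))"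
  have pm: "(\<lambda>\<omega>. (\<omega>, e \<omega>)) \<in> measurable M (G \<Otimes>\<^sub>M borel)" using idG em by (rule measurable_Pair)
  interpret G: prob_space "?G" by (rule prob_space_distr[OF idG])
  interpret N: prob_space "distr M borel e" by (rule prob_space_distr[OF em])
  interpret P: pair_prob_space "?G" "distr M borel e" ..
  have joint: "?G \<Otimes>\<^sub>M distr M borel e = ?GE"
  proof (rule pair_measure_eqI)
    show "sets (?G \<Otimes>\<^sub>M distr M borel e) = sets (?GE)"
      unfolding sets_distr by (intro sets_pair_measure_cong) simp_all
    fix A B' assume "A \<in> sets (?G)" "B' \<in> sets (distr M borel e)"
    then have A: "A \<in> sets G" and B': "B' \<in> sets borel" by simp_all
    have AM: "A \<in> sets M" "A \<subseteq> space M" using A sG sets.sets_into_space by auto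
    have eB: "e -` B' \<inter> space M \<in> sets (vimage_algebra (space M) e borel)"
      unfolding sets_vimage_algebra by (intro sigma_sets.Basic) (use B' in auto)
    have AB: "A \<times> B' \<in> sets (G \<Otimes>\<^sub>M borel)" using A B' by (rule pair_measureI)
    have pre: "(\<lambda>\<omega>. (\<omega>, e \<omega>)) -` (A \<times> B') \<inter> space M = A \<inter> (e -` B' \<inter> space M)" using AM(2) by auto
    have "emeasure (?GE) (A \<times> B') = emeasure M (A \<inter> (e -` B' \<inter> space M))"
      unfolding emeasure_distr[OF pm AB] pre ..
    also have "\<dots> = ennreal (prob A * prob (e -` B' \<inter> space M))"
      unfolding emeasure_eq_measure using indep_setD[OF ind A[unfolded G_def] eB] by simp
    also have "\<dots> = emeasure M A * emeasure M (e -` B' \<inter> space M)"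
      by (simp add: emeasure_eq_measure ennreal_mult)
    also have "emeasure M A = emeasure (?G) A"
      using emeasure_distr[OF idG A] AM(2) by (simp add: Int_absorb2)
    also have "emeasure M (e -` B' \<inter> space M) = emeasure (distr M borel e) B'"
      by (rule emeasure_distr[OF em B', symmetric])
    finally show "emeasure (?G) A * emeasure (distr M borel e) B' =
      emeasure (?GE) (A \<times> B')" by simp
  qed unfold_locales
  have law: "distr M borel e = density lborel (exponential_density q)"
    using distributed_distr_eq_density[OF e] by (simp cong: distr_cong)
  have XG: "X t \<in> borel_measurable G" if "0 \<le> t" for t
  proof -
    have "(\<lambda>\<omega>. \<lambda>s\<in>{0..}. X s \<omega>) \<in> measurable G (Pi\<^sub>M {0..} (\<lambda>_. borel))"
      unfolding G_def path_algebra_def by (rule measurable_vimage_algebra1) (auto simp: space_PiM)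
    from measurable_compose[OF this measurable_component_singleton[of t]] that show ?thesis by simp
  qed
  have "(\<lambda>(r, \<omega>). X (max 0 r) \<omega>) \<in> borel_measurable (borel \<Otimes>\<^sub>M G)"
    by (rule continuous_process_measurable) (use XG X_cont spG in auto)
  from measurable_compose[OF measurable_pair_swap' this]
  have Xj: "(\<lambda>p. X (max 0 (snd p)) (fst p)) \<in> borel_measurable (G \<Otimes>\<^sub>M borel)" by (simp add: split_beta')
  define fX where "fX p = f (X (max 0 (snd p)) (fst p))" for p
  have fXm: "fX \<in> borel_measurable (G \<Otimes>\<^sub>M borel)"
    unfolding fX_def[abs_def] using measurable_compose[OF Xj f(1)] .
  have fXm': "fX \<in> borel_measurable (?G \<Otimes>\<^sub>M distr M borel e)"
    using fXm by (subst measurable_cong_sets[OF sets_pair_measure_cong refl]) auto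
  have int: "integrable (?G \<Otimes>\<^sub>M distr M borel e) (case_prod (\<lambda>\<omega> t. fX (\<omega>, t)))"
  proof -
    have "integrable (?G \<Otimes>\<^sub>M distr M borel e) fX"
      by (rule P.integrable_const_bound[where B=C, OF _ fXm']) (simp add: fX_def f(2))
    then show ?thesis by simp
  qed
  have "expectation (\<lambda>\<omega>. f (X (max 0 (e \<omega>)) \<omega>)) = integral\<^sup>L (?GE) fX"
    using integral_distr[OF pm fXm] by (simp add: fX_def)
  also have "\<dots> = (\<integral>t. (\<integral>\<omega>. fX (\<omega>, t) \<partial>?G) \<partial>distr M borel e)"
    unfolding joint[symmetric] using P.integral_snd[OF int] by simp
  also have "\<dots> = (\<integral>t. expectation (\<lambda>\<omega>. f (X (max 0 t) \<omega>)) \<partial>distr M borel e)"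
  proof (rule Bochner_Integration.integral_cong[OF refl])
    fix t
    have "(\<lambda>\<omega>. fX (\<omega>, t)) \<in> borel_measurable G"
      unfolding fX_def by (simp add: measurable_compose[OF XG f(1)])
    from integral_distr[OF idG this]
    show "(\<integral>\<omega>. fX (\<omega>, t) \<partial>?G) = expectation (\<lambda>\<omega>. f (X (max 0 t) \<omega>))" by (simp add: fX_def)
  qed
  finally show ?thesis by (simp only: law)
qed

lemma resolvent_identity:
  assumes e: "distributed M lborel e (exponential_density q)" and q: "0 < q"
    and ind: "indep_set (sets (path_algebra (space M) {0..} X)) (sets (vimage_algebra (space M) e borel))"
    and T: "smooth_test C \<phi> \<phi>1 \<phi>2"
  shows "expectation (\<lambda>\<omega>. \<phi> (X (max 0 (e \<omega>)) \<omega>)) = \<phi> x0 + expectation (\<lambda>\<omega>. gen \<phi>1 \<phi>2 (X (max 0 (e \<omega>)) \<omega>)) / q"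
proof -
  note TD = smooth_testD[OF T]
  let ?N = "density lborel (exponential_density q)"
  interpret N: prob_space ?N by (rule prob_space_exponential_density[OF q])
  define H where "H r = expectation (\<lambda>\<omega>. gen \<phi>1 \<phi>2 (X (max 0 r) \<omega>))" for r
  have Hm [measurable]: "H \<in> borel_measurable borel" unfolding H_def[abs_def] by (rule mean_meas[OF gen_meas[OF T]])
  have Hb: "\<bar>H r\<bar> \<le> C * K + C * K\<^sup>2 / 2" for r
    unfolding H_def by (rule mean_bound[OF gen_meas[OF T] gen_bound_smooth[OF T]]) simp
  have m: "expectation (\<lambda>\<omega>. \<phi> (X (max 0 t) \<omega>)) = \<phi> x0 + (LINT r:{0<..t}|lborel. H r)" for t
  proof (cases "0 \<le> t")
    case True
    then show ?thesis using dynkin[OF T True] by (simp add: H_def)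
  next
    case False
    then have "{0<..t} = {}" "max 0 t = 0" by auto
    then show ?thesis using dynkin[OF T order_refl] by (simp add: set_lebesgue_integral_def)
  qed
  have "integrable ?N (\<lambda>t. expectation (\<lambda>\<omega>. \<phi> (X (max 0 t) \<omega>)))"
    by (rule N.integrable_const_bound[where B=C]) (use mean_bound[OF TD(10) TD(3)] mean_meas[OF TD(10)] in auto)
  then have Pi: "integrable ?N (\<lambda>t. LINT r:{0<..t}|lborel. H r)"
    using Bochner_Integration.integrable_diff[of ?N "\<lambda>t. expectation (\<lambda>\<omega>. \<phi> (X (max 0 t) \<omega>))" "\<lambda>_. \<phi> x0"] by (simp add: m)
  have "expectation (\<lambda>\<omega>. \<phi> (X (max 0 (e \<omega>)) \<omega>)) = (\<integral>t. \<phi> x0 + (LINT r:{0<..t}|lborel. H r) \<partial>?N)"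
    unfolding exponential_time_law[OF e q ind TD(10,3)] m ..
  also have "\<dots> = \<phi> x0 + (\<integral>t. (LINT r:{0<..t}|lborel. H r) \<partial>?N)"
    using Pi N.prob_space by (simp add: Bochner_Integration.integral_add)
  also have "\<dots> = \<phi> x0 + (\<integral>r. H r \<partial>?N) / q"
    by (simp only: laplace_of_primitive[OF q Hm Hb])
  also have "(\<integral>r. H r \<partial>?N) = expectation (\<lambda>\<omega>. gen \<phi>1 \<phi>2 (X (max 0 (e \<omega>)) \<omega>))"
    unfolding H_def by (rule exponential_time_law[OF e q ind gen_meas[OF T] gen_bound_smooth[OF T], symmetric])
  finally show ?thesis .
qed

end

section \<open>One-sided derivatives and functions glued from two pieces\<close>

lemma left_difference_quotient_seq:
  fixes f :: "real \<Rightarrow> real"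
  assumes "(f has_real_derivative D) (at y within {..y})"
  shows "(\<lambda>n. real (Suc n) * (f y - f (y - 1 / real (Suc n)))) \<longlonglongrightarrow> D"
proof -
  have lim: "((\<lambda>x. (f x - f y) / (x - y)) \<longlongrightarrow> D) (at y within {..y})"
    using assms by (simp add: has_field_derivative_iff)
  have "(\<lambda>n. y - 1 / real (Suc n)) \<longlonglongrightarrow> y - 0"
    by (intro tendsto_diff tendsto_const LIMSEQ_inverse_real_of_nat[unfolded inverse_eq_divide])
  then have "filterlim (\<lambda>n. y - 1 / real (Suc n)) (at y within {..y}) sequentially"
    unfolding filterlim_at by (auto simp: eventually_sequentially)
  from filterlim_compose[OF lim this]
  have l: "(\<lambda>n. (f (y - 1 / real (Suc n)) - f y) / (y - 1 / real (Suc n) - y)) \<longlonglongrightarrow> D" .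
  have eq: "(f (y - 1 / real (Suc n)) - f y) / (y - 1 / real (Suc n) - y) = real (Suc n) * (f y - f (y - 1 / real (Suc n)))" for n
    by (simp add: minus_divide_left[symmetric] del: of_nat_Suc) (simp add: algebra_simps del: of_nat_Suc)?
  show ?thesis using l unfolding eq .
qed

lemma has_real_derivative_glue:
  fixes g h :: "real \<Rightarrow> real"
  assumes g: "\<And>y. (g has_real_derivative g1 y) (at y)" and h: "\<And>y. (h has_real_derivative h1 y) (at y)"
    and c: "g c = h c" "g1 c = h1 c"
  shows "((\<lambda>y. if y \<le> c then g y else h y) has_real_derivative (if y \<le> c then g1 y else h1 y)) (at y)"
proof -
  let ?f = "\<lambda>y. if y \<le> c then g y else h y"
  consider "y < c" | "c < y" | "y = c" by linarith
  then show ?thesis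
  proof cases
    case 1
    have "(?f has_real_derivative g1 y) (at y)"
      by (rule has_field_derivative_transform_within_open[OF g[of y], of "{..<c}"]) (use 1 in auto)
    then show ?thesis using 1 by simp
  next
    case 2
    have "(?f has_real_derivative h1 y) (at y)"
      by (rule has_field_derivative_transform_within_open[OF h[of y], of "{c<..}"]) (use 2 in auto)
    then show ?thesis using 2 by simp
  next
    case 3
    have 1: "(?f has_real_derivative g1 c) (at c within {..c})"
      by (rule has_field_derivative_transform_within[OF has_field_derivative_at_within[OF g], of 1]) auto
    have 2: "(?f has_real_derivative g1 c) (at c within {c..})"
      unfolding c(2)
      by (rule has_field_derivative_transform_within[OF has_field_derivative_at_within[OF h], of 1]) (use c in auto)
    have "{..c} \<union> {c..} = (UNIV :: real set)" by auto
    then have "(?f has_real_derivative g1 c) (at c)"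
      using 1 2 at_within_union[of c "{..c}" "{c..}"] unfolding has_field_derivative_iff by (simp add: filterlim_sup)
    then show ?thesis using 3 by simp
  qed
qed

text \<open>The left neighbourhood of \<open>c\<close> sees only \<open>g\<close>, so no condition
  links the two pieces at \<open>c\<close>. This lets the second derivative of the resolvent
  solution jump.\<close>

lemma left_derivative_glue:
  fixes g h :: "real \<Rightarrow> real"
  assumes g: "\<And>y. y \<le> c \<Longrightarrow> (g has_real_derivative g1 y) (at y within {..y})"
    and h: "\<And>y. c < y \<Longrightarrow> (h has_real_derivative h1 y) (at y within {..y})"
  shows "((\<lambda>y. if y \<le> c then g y else h y) has_real_derivative (if y \<le> c then g1 y else h1 y)) (at y within {..y})"
proof (cases "y \<le> c")
  case True
  have "((\<lambda>y. if y \<le> c then g y else h y) has_real_derivative g1 y) (at y within {..y})"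
    by (rule has_field_derivative_transform_within[OF g[OF True], of 1]) (use True in auto)
  then show ?thesis using True by simp
next
  case False
  then have "c < y" by simp
  have "((\<lambda>y. if y \<le> c then g y else h y) has_real_derivative h1 y) (at y within {..y})"
    by (rule has_field_derivative_transform_within[OF h[OF \<open>c < y\<close>], of "y - c"]) (use False in \<open>auto simp: dist_real_def\<close>)
  then show ?thesis using False by simp
qed

text \<open>Passing through \<open>c\<close> costs nothing, since the two distances add up to the
  whole. The set \<open>S\<close> is there for pieces that are Lipschitz on one side only.\<close>

lemma lipschitz_glue:
  fixes g h :: "real \<Rightarrow> real"
  assumes g: "\<And>x y. x \<in> S \<Longrightarrow> y \<in> S \<Longrightarrow> x \<le> c \<Longrightarrow> y \<le> c \<Longrightarrow> \<bar>g x - g y\<bar> \<le> L * \<bar>x - y\<bar>"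
    and h: "\<And>x y. x \<in> S \<Longrightarrow> y \<in> S \<Longrightarrow> c \<le> x \<Longrightarrow> c \<le> y \<Longrightarrow> \<bar>h x - h y\<bar> \<le> L * \<bar>x - y\<bar>"
    and c: "g c = h c" "c \<in> S" and xy: "x \<in> S" "y \<in> S"
  shows "\<bar>(if x \<le> c then g x else h x) - (if y \<le> c then g y else h y)\<bar> \<le> L * \<bar>x - y\<bar>"
proof -
  have mixed: "\<bar>g x - h y\<bar> \<le> L * \<bar>x - y\<bar>" if "x \<in> S" "y \<in> S" "x \<le> c" "c \<le> y" for x y
  proof -
    have "\<bar>g x - h y\<bar> \<le> \<bar>g x - g c\<bar> + \<bar>h c - h y\<bar>" using c(1) by linarith
    also have "\<dots> \<le> L * \<bar>x - c\<bar> + L * \<bar>c - y\<bar>" using that c(2) by (intro add_mono g h) auto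
    also have "\<dots> = L * (\<bar>x - c\<bar> + \<bar>c - y\<bar>)" by (simp only: distrib_left)
    also have "\<bar>x - c\<bar> + \<bar>c - y\<bar> = \<bar>x - y\<bar>" using that by simp
    finally show ?thesis .
  qed
  show ?thesis
    using g[OF xy] h[OF xy] mixed[OF xy] mixed[OF xy(2,1)]
    by (cases "x \<le> c"; cases "y \<le> c") (auto simp: abs_minus_commute)
qed

section \<open>The resolvent identity with a left second derivative\<close>

context diffusion
begin

text \<open>
  \<open>u\<close> is approximated by its averages over \<open>[y - 1/n, y]\<close>: their second derivatives are left difference
  quotients of \<open>u1\<close> and converge at every point, also where \<open>v\<close> jumps.  No statement about the time
  spent by \<open>X\<close> at such a point is needed.
\<close>

lemma resolvent_identity_left:
  assumes e: "distributed M lborel e (exponential_density q)" and q: "0 < q"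
    and ind: "indep_set (sets (path_algebra (space M) {0..} X)) (sets (vimage_algebra (space M) e borel))"
    and u: "\<And>y. (u has_real_derivative u1 y) (at y)"
    and u1: "\<And>y. (u1 has_real_derivative u2 y) (at y within {..y})"
    and ub: "\<And>y. \<bar>u y\<bar> \<le> C" and u1b: "\<And>y. \<bar>u1 y\<bar> \<le> C"
    and lip: "\<And>x y. \<bar>u1 x - u1 y\<bar> \<le> C * \<bar>x - y\<bar>"
  shows "expectation (\<lambda>\<omega>. u (X (max 0 (e \<omega>)) \<omega>) - gen u1 u2 (X (max 0 (e \<omega>)) \<omega>) / q) = u x0"
proof -
  have C: "0 \<le> C" using ub[of 0] by linarith
  have em [measurable]: "e \<in> borel_measurable M" using distributed_measurable[OF e] by simp
  define Xe where "Xe \<omega> = X (max 0 (e \<omega>)) \<omega>" for \<omega>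
  have [measurable]: "Xe \<in> borel_measurable M"
  proof -
    have "(\<lambda>\<omega>. (\<omega>, e \<omega>)) \<in> measurable M (M \<Otimes>\<^sub>M borel)" by measurable
    from measurable_compose[OF this X_joint'] show ?thesis by (simp add: Xe_def[abs_def])
  qed
  have ucont: "isCont u y" for y using DERIV_isCont[OF u] .
  have um [measurable]: "u \<in> borel_measurable borel"
    by (rule borel_measurable_continuous_onI) (simp add: continuous_at_imp_continuous_on ucont)
  have "C-lipschitz_on UNIV u1" using lip C by (auto intro!: lipschitz_onI simp: dist_real_def)
  then have u1m [measurable]: "u1 \<in> borel_measurable borel"
    by (intro borel_measurable_continuous_onI lipschitz_on_continuous_on)
  \<comment> \<open>With an antiderivative of \<open>u\<close>, the average over a short interval
    and its first two derivatives are all left difference quotients: of \<open>U\<close>,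
    \<open>u\<close> and \<open>u1\<close>.\<close>
  obtain U where U: "\<And>y. (U has_real_derivative u y) (at y)"
    using einterval_antiderivative[of "-\<infinity>" "\<infinity>" u] ucont
    by (auto simp: has_real_derivative_iff_has_vector_derivative)
  define N where "N n = real (Suc n)" for n
  have N: "0 < N n" "1 \<le> N n" for n by (simp_all add: N_def)
  define \<phi> \<phi>1 \<phi>2 where "\<phi> n y = N n * (U y - U (y - 1 / N n))" and "\<phi>1 n y = N n * (u y - u (y - 1 / N n))"
    and "\<phi>2 n y = N n * (u1 y - u1 (y - 1 / N n))" for n y
  have quot: "\<bar>N n * (f y - f (y - 1 / N n))\<bar> \<le> C" if "\<And>x y. \<bar>f x - f y\<bar> \<le> C * \<bar>x - y\<bar>" for f :: "real \<Rightarrow> real" and n y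
  proof -
    have "\<bar>N n * (f y - f (y - 1 / N n))\<bar> = N n * \<bar>f y - f (y - 1 / N n)\<bar>" using N(1)[of n] by (simp add: abs_mult)
    also have "\<dots> \<le> N n * (C * \<bar>y - (y - 1 / N n)\<bar>)" using N(1)[of n] by (intro mult_left_mono that) auto
    also have "\<dots> = C" using N(1)[of n] by simp
    finally show ?thesis .
  qed
  have \<phi>b: "\<bar>\<phi> n y\<bar> \<le> C" "\<bar>\<phi>1 n y\<bar> \<le> C" "\<bar>\<phi>2 n y\<bar> \<le> C" for n y
    unfolding \<phi>_def \<phi>1_def \<phi>2_def
    by (rule quot[OF lipschitz_of_deriv_bound[OF U ub]], rule quot[OF lipschitz_of_deriv_bound[OF u u1b]], rule quot[OF lip])
  have \<phi>l: "(\<lambda>n. \<phi> n y) \<longlonglongrightarrow> u y" "(\<lambda>n. \<phi>1 n y) \<longlonglongrightarrow> u1 y" "(\<lambda>n. \<phi>2 n y) \<longlonglongrightarrow> u2 y" for y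
    unfolding \<phi>_def \<phi>1_def \<phi>2_def N_def
    by (rule left_difference_quotient_seq[OF has_field_derivative_at_within[OF U]],
        rule left_difference_quotient_seq[OF has_field_derivative_at_within[OF u]],
        rule left_difference_quotient_seq[OF u1])
  have shift: "((\<lambda>y. N n * (f y - f (y - 1 / N n))) has_real_derivative N n * (f' y - f' (y - 1 / N n))) (at y)"
    if f: "\<And>y. (f has_real_derivative f' y) (at y)" for f f' n y
  proof -
    have "((\<lambda>y. f (y - 1 / N n)) has_real_derivative f' (y - 1 / N n) * (1 - 0)) (at y)"
      by (rule DERIV_chain2[OF f DERIV_diff[OF DERIV_ident DERIV_const]])
    from DERIV_cmult[OF DERIV_diff[OF f this], of "N n"] show ?thesis by simp
  qed
  \<comment> \<open>This constant grows with \<open>n\<close>, which is harmless: the identity for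
    each \<open>n\<close> does not contain it, and the passage to the limit rests on the uniform
    bounds \<open>\<phi>b\<close>.\<close>
  have T: "smooth_test (2 * N n * C) (\<phi> n) (\<phi>1 n) (\<phi>2 n)" for n
    unfolding smooth_test_def
  proof (intro conjI allI)
    have CN: "C \<le> 2 * N n * C" using N(2)[of n] C mult_right_mono[of 1 "2 * N n" C] by linarith
    fix y z
    show "(\<phi> n has_real_derivative \<phi>1 n y) (at y)" unfolding \<phi>_def[abs_def] \<phi>1_def by (rule shift[OF U])
    show "(\<phi>1 n has_real_derivative \<phi>2 n y) (at y)" unfolding \<phi>1_def[abs_def] \<phi>2_def by (rule shift[OF u])
    show "\<bar>\<phi> n y\<bar> \<le> 2 * N n * C" "\<bar>\<phi>1 n y\<bar> \<le> 2 * N n * C" "\<bar>\<phi>2 n y\<bar> \<le> 2 * N n * C"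
      using \<phi>b[of n y] CN by linarith+
    have "\<phi>2 n y - \<phi>2 n z = N n * ((u1 y - u1 z) - (u1 (y - 1 / N n) - u1 (z - 1 / N n)))"
      by (simp add: \<phi>2_def right_diff_distrib)
    then have "\<bar>\<phi>2 n y - \<phi>2 n z\<bar> = N n * \<bar>(u1 y - u1 z) - (u1 (y - 1 / N n) - u1 (z - 1 / N n))\<bar>"
      using N(1)[of n] by (simp add: abs_mult)
    also have "\<dots> \<le> N n * (C * \<bar>y - z\<bar> + C * \<bar>(y - 1 / N n) - (z - 1 / N n)\<bar>)"
      using N(1)[of n] by (intro mult_left_mono order_trans[OF abs_triangle_ineq4 add_mono] lip) auto
    also have "\<dots> = 2 * N n * C * \<bar>y - z\<bar>" by simp
    finally show "\<bar>\<phi>2 n y - \<phi>2 n z\<bar> \<le> 2 * N n * C * \<bar>y - z\<bar>" .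
  qed
  note \<phi>m = smooth_testD(10-12)[OF T]
  have u2m: "u2 \<in> borel_measurable borel"
    by (rule borel_measurable_LIMSEQ_real[OF \<phi>l(3) \<phi>m(3)])
  have gm: "gen u1 u2 \<in> borel_measurable borel"
  proof -
    note [measurable] = u2m
    show ?thesis unfolding gen_def[abs_def] by measurable
  qed
  have id: "expectation (\<lambda>\<omega>. \<phi> n (Xe \<omega>)) = \<phi> n x0 + expectation (\<lambda>\<omega>. gen (\<phi>1 n) (\<phi>2 n) (Xe \<omega>)) / q" for n
    unfolding Xe_def by (rule resolvent_identity[OF e q ind T])
  have gl: "(\<lambda>n. gen (\<phi>1 n) (\<phi>2 n) y) \<longlonglongrightarrow> gen u1 u2 y" for y
    unfolding gen_def by (intro tendsto_intros \<phi>l) simp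
  have dct: "integrable M (\<lambda>\<omega>. f (Xe \<omega>))" "(\<lambda>n. expectation (\<lambda>\<omega>. s n (Xe \<omega>))) \<longlonglongrightarrow> expectation (\<lambda>\<omega>. f (Xe \<omega>))"
    if f: "f \<in> borel_measurable borel" and s: "\<And>n. s n \<in> borel_measurable borel" and sl: "\<And>y. (\<lambda>n. s n y) \<longlonglongrightarrow> f y"
      and sb: "\<And>n y. \<bar>s n y\<bar> \<le> c" for f and s :: "nat \<Rightarrow> real \<Rightarrow> real" and c
  proof -
    have Xem: "Xe \<in> borel_measurable M" by measurable
    have 1: "(\<lambda>\<omega>. f (Xe \<omega>)) \<in> borel_measurable M" by (rule measurable_compose[OF Xem f])
    have 2: "(\<lambda>\<omega>. s n (Xe \<omega>)) \<in> borel_measurable M" for n by (rule measurable_compose[OF Xem s])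
    have 3: "integrable M (\<lambda>\<omega>. c)" by simp
    have 4: "AE \<omega> in M. (\<lambda>n. s n (Xe \<omega>)) \<longlonglongrightarrow> f (Xe \<omega>)" by (rule AE_I2) (rule sl)
    have 5: "AE \<omega> in M. norm (s n (Xe \<omega>)) \<le> c" for n by (rule AE_I2) (simp only: real_norm_def sb)
    show "integrable M (\<lambda>\<omega>. f (Xe \<omega>))" by (rule integrable_dominated_convergence[OF 1 2 3 4 5])
    show "(\<lambda>n. expectation (\<lambda>\<omega>. s n (Xe \<omega>))) \<longlonglongrightarrow> expectation (\<lambda>\<omega>. f (Xe \<omega>))"
      by (rule integral_dominated_convergence[OF 1 2 3 4 5])
  qed
  note L1 = dct[OF um \<phi>m(1) \<phi>l(1) \<phi>b(1)]
  have gb: "\<bar>gen (\<phi>1 n) (\<phi>2 n) y\<bar> \<le> C * K + C * K\<^sup>2 / 2" for n y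
    by (rule gen_bound) (rule \<phi>b)+
  note L2 = dct[OF gm gen_meas[OF T] gl gb]
  have "(\<lambda>n. \<phi> n x0 + expectation (\<lambda>\<omega>. gen (\<phi>1 n) (\<phi>2 n) (Xe \<omega>)) / q) \<longlonglongrightarrow> u x0 + expectation (\<lambda>\<omega>. gen u1 u2 (Xe \<omega>)) / q"
    using q by (intro tendsto_intros \<phi>l L2) simp
  with L1(2) have "expectation (\<lambda>\<omega>. u (Xe \<omega>)) = u x0 + expectation (\<lambda>\<omega>. gen u1 u2 (Xe \<omega>)) / q"
    unfolding id by (rule LIMSEQ_unique)
  then show ?thesis using L1(1) L2(1) by (simp add: Xe_def)
qed

end

section \<open>The oscillating Brownian motion with drift\<close>

text \<open>Continuity from below gives equal mass to the open half-line as well. The restrictions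
  to it then have the same distribution function everywhere, constant from \<open>a\<close> on, and
  this determines them.\<close>

lemma emeasure_eq_below:
  fixes N1 N2 :: "real measure"
  assumes fin: "finite_measure N1" "finite_measure N2" and s: "sets N1 = sets borel" "sets N2 = sets borel"
    and eq: "\<And>z. z < a \<Longrightarrow> emeasure N1 {..z} = emeasure N2 {..z}"
    and A: "A \<in> sets borel" "A \<subseteq> {..<a}"
  shows "emeasure N1 A = emeasure N2 A"
proof -
  have un: "(\<Union>i. {..a - 1 / real (Suc i)}) = {..<a}"
  proof safe
    fix x assume "x < a"
    then obtain i where "1 / real (Suc i) < a - x" using reals_Archimedean[of "a - x"] by (auto simp: inverse_eq_divide)
    then show "x \<in> (\<Union>i. {..a - 1 / real (Suc i)})" by (intro UN_I[of i]) auto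
  next
    fix x i assume "x \<le> a - 1 / real (Suc i)"
    moreover have "0 < 1 / real (Suc i)" by simp
    ultimately show "x < a" by linarith
  qed
  have inc: "incseq (\<lambda>i. {..a - 1 / real (Suc i)})"
    by (rule incseq_SucI) (simp add: frac_le)
  have l: "(\<lambda>i. emeasure N {..a - 1 / real (Suc i)}) \<longlonglongrightarrow> emeasure N {..<a}" if "sets N = sets borel" for N :: "real measure"
  proof -
    have "range (\<lambda>i. {..a - 1 / real (Suc i)}) \<subseteq> sets N" unfolding that by (intro image_subsetI) (rule atMost_borel)
    from Lim_emeasure_incseq[OF this inc] show ?thesis unfolding un .
  qed
  have eqi: "emeasure N1 {..a - 1 / real (Suc i)} = emeasure N2 {..a - 1 / real (Suc i)}" for i
    by (rule eq) simp
  have eqa: "emeasure N1 {..<a} = emeasure N2 {..<a}"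
    by (rule LIMSEQ_unique[OF l[OF s(1), unfolded eqi] l[OF s(2)]])
  \<comment> \<open>Restriction as a density keeps a Borel measure on the whole line, to which
    uniqueness by distribution functions applies.\<close>
  define R where "R N = density N (indicator {..<a})" for N :: "real measure"
  have Re: "emeasure (R N) E = emeasure N ({..<a} \<inter> E)" if "sets N = sets borel" "E \<in> sets borel" for N E
    unfolding R_def using that by (intro emeasure_restricted) auto
  have Rf: "finite_borel_measure (R N)" if "finite_measure N" "sets N = sets borel" for N
  proof -
    interpret N: finite_measure N by fact
    have "emeasure (R N) (space (R N)) \<noteq> \<infinity>"
      using Re[OF that(2), of "space (R N)"] sets.top[of N] that(2)
      by (simp add: R_def N.emeasure_finite)
    then have "finite_measure (R N)" by (rule finite_measureI)
    then show ?thesis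
      by (intro finite_borel_measure.intro finite_borel_measure_axioms.intro) (simp_all add: R_def that(2))
  qed
  have "cdf (R N1) = cdf (R N2)"
  proof
    fix z
    have "emeasure N1 ({..<a} \<inter> {..z}) = emeasure N2 ({..<a} \<inter> {..z})"
    proof (cases "z < a")
      case True
      then have "{..<a} \<inter> {..z} = {..z}" by auto
      then show ?thesis using eq[OF True] by simp
    next
      case False
      then have "{..<a} \<inter> {..z} = {..<a}" by auto
      then show ?thesis using eqa by simp
    qed
    then show "cdf (R N1) z = cdf (R N2) z"
      by (simp add: cdf_def measure_def Re s)
  qed
  then have "R N1 = R N2" by (rule cdf_unique'[OF Rf[OF fin(1) s(1)] Rf[OF fin(2) s(2)]])
  then have "emeasure N1 ({..<a} \<inter> A) = emeasure N2 ({..<a} \<inter> A)"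
    using Re[OF s(1) A(1)] Re[OF s(2) A(1)] by simp
  moreover have "{..<a} \<inter> A = A" using A(2) by auto
  ultimately show ?thesis by simp
qed

text \<open>Reflection at \<open>z\<close> moves the range to \<open>{0..}\<close>, where the
  fundamental theorem for half-lines is available.\<close>

lemma nn_integral_exp_atMost:
  fixes a c p z :: real
  assumes "0 < p" "0 \<le> c"
  shows "(\<integral>\<^sup>+w. ennreal (c * exp (p * (w - a))) * indicator {..z} w \<partial>lborel) = ennreal (c / p * exp (p * (z - a)))"
proof -
  have "(\<integral>\<^sup>+w. ennreal (c * exp (p * (w - a))) * indicator {..z} w \<partial>lborel) =
    (\<integral>\<^sup>+w. ennreal (c * exp (p * (z + (- 1) * w - a))) * indicator {..z} (z + (- 1) * w) \<partial>lborel)"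
    by (subst nn_integral_real_affine[where c="-1" and t=z]) auto
  also have "\<dots> = (\<integral>\<^sup>+w. ennreal (c * exp (p * (z - w - a))) * indicator {0..} w \<partial>lborel)"
    by (intro nn_integral_cong) (auto split: split_indicator)
  also have "\<dots> = ennreal (0 - (- (c / p) * exp (p * (z - a)) * exp (- (p * 0))))"
  proof (rule nn_integral_FTC_atLeast)
    fix w :: real
    have "p * (z - w - a) = p * (z - a) + - (p * w)" by (simp add: right_diff_distrib)
    then have "exp (p * (z - w - a)) = exp (p * (z - a)) * exp (- (p * w))" by (simp only: exp_add)
    then show "((\<lambda>w. - (c / p) * exp (p * (z - a)) * exp (- (p * w))) has_real_derivative c * exp (p * (z - w - a))) (at w)"
      using assms(1) by (auto intro!: derivative_eq_intros)
    show "0 \<le> c * exp (p * (z - w - a))" using assms(2) by simp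
    have "filterlim (\<lambda>w. p * w) at_top at_top"
      by (rule filterlim_tendsto_pos_mult_at_top[OF tendsto_const assms(1) filterlim_ident])
    then have "filterlim (\<lambda>w. - (p * w)) at_bot at_top" by (simp add: filterlim_uminus_at_bot)
    from filterlim_compose[OF exp_at_bot this]
    have "((\<lambda>w. - (c / p) * exp (p * (z - a)) * exp (- (p * w))) \<longlongrightarrow> - (c / p) * exp (p * (z - a)) * 0) at_top"
      by (intro tendsto_mult_left)
    then show "((\<lambda>w. - (c / p) * exp (p * (z - a)) * exp (- (p * w))) \<longlongrightarrow> 0) at_top" by simp
  qed measurable
  finally show ?thesis by simp
qed

text \<open>The numbers \<open>delta_minus\<close> and minus \<open>delta_plus\<close> are the two
  roots r of r^2 \<sigma>^2 / 2 + \<mu> r = q. The last identity compares their distance with their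
  product; it converts the prefactor of the claimed density into the coefficient found by solving
  the differential equation.\<close>

lemma delta_props:
  assumes "0 < q" "0 < \<sigma>"
  shows "0 < delta_plus q \<mu> \<sigma>" "0 < delta_minus q \<mu> \<sigma>"
    and "(delta_plus q \<mu> \<sigma>)\<^sup>2 * \<sigma>\<^sup>2 / 2 - \<mu> * delta_plus q \<mu> \<sigma> = q"
    and "(delta_minus q \<mu> \<sigma>)\<^sup>2 * \<sigma>\<^sup>2 / 2 + \<mu> * delta_minus q \<mu> \<sigma> = q"
    and "0 < sqrt (2 * q * \<sigma>\<^sup>2 + \<mu>\<^sup>2)"
    and "q * (delta_plus q \<mu> \<sigma> + delta_minus q \<mu> \<sigma>)
      = delta_minus q \<mu> \<sigma> * delta_plus q \<mu> \<sigma> * sqrt (2 * q * \<sigma>\<^sup>2 + \<mu>\<^sup>2)"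
proof -
  define D where "D = sqrt (2 * q * \<sigma>\<^sup>2 + \<mu>\<^sup>2)"
  have pos: "0 < 2 * q * \<sigma>\<^sup>2" using assms by simp
  then have D2: "D\<^sup>2 = 2 * q * \<sigma>\<^sup>2 + \<mu>\<^sup>2" by (simp add: D_def add_nonneg_nonneg)
  have D0: "\<bar>\<mu>\<bar> < D"
    unfolding D_def real_sqrt_abs[symmetric] using pos by (intro real_sqrt_less_mono) simp
  show "0 < sqrt (2 * q * \<sigma>\<^sup>2 + \<mu>\<^sup>2)" using le_less_trans[OF abs_ge_zero D0] unfolding D_def .
  have p: "delta_plus q \<mu> \<sigma> = (D + \<mu>) / \<sigma>\<^sup>2" and m: "delta_minus q \<mu> \<sigma> = (D - \<mu>) / \<sigma>\<^sup>2"
    by (simp_all add: delta_plus_def delta_minus_def D_def)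
  show "0 < delta_plus q \<mu> \<sigma>" "0 < delta_minus q \<mu> \<sigma>"
    unfolding p m using D0 assms(2) by (auto intro!: divide_pos_pos)
  have s: "\<sigma>\<^sup>2 \<noteq> 0" using assms(2) by simp
  have *: "(D + \<mu>) * (D - \<mu>) = 2 * q * \<sigma>\<^sup>2" using D2 by (simp add: power2_eq_square algebra_simps)
  have sq: "((D + k) / \<sigma>\<^sup>2)\<^sup>2 * \<sigma>\<^sup>2 / 2 - k * ((D + k) / \<sigma>\<^sup>2) = (D + k) * (D - k) / (2 * \<sigma>\<^sup>2)" for k
    using s by (simp add: power2_eq_square field_simps)
  show "(delta_plus q \<mu> \<sigma>)\<^sup>2 * \<sigma>\<^sup>2 / 2 - \<mu> * delta_plus q \<mu> \<sigma> = q"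
    unfolding p sq * using s by simp
  have "(D - \<mu>) * (D + \<mu>) = 2 * q * \<sigma>\<^sup>2" using * by (simp add: mult.commute)
  then show "(delta_minus q \<mu> \<sigma>)\<^sup>2 * \<sigma>\<^sup>2 / 2 + \<mu> * delta_minus q \<mu> \<sigma> = q"
    unfolding m using sq[of "- \<mu>"] s by simp
  have "q * ((D + \<mu>) / \<sigma>\<^sup>2 + (D - \<mu>) / \<sigma>\<^sup>2) = 2 * q * D / \<sigma>\<^sup>2" by (simp add: add_divide_distrib[symmetric])
  also have "\<dots> = (2 * q * \<sigma>\<^sup>2) / \<sigma>\<^sup>2 * D / \<sigma>\<^sup>2" using s by simp
  also have "\<dots> = (D - \<mu>) / \<sigma>\<^sup>2 * ((D + \<mu>) / \<sigma>\<^sup>2) * D"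
    unfolding *[symmetric] by simp
  finally show "q * (delta_plus q \<mu> \<sigma> + delta_minus q \<mu> \<sigma>)
      = delta_minus q \<mu> \<sigma> * delta_plus q \<mu> \<sigma> * sqrt (2 * q * \<sigma>\<^sup>2 + \<mu>\<^sup>2)"
    by (simp only: p m D_def)
qed

lemma abs_mult_exp_le:
  assumes "\<bar>k\<bar> \<le> \<kappa>" "w \<le> 0"
  shows "\<bar>k * exp w\<bar> \<le> (\<kappa> :: real)"
proof -
  have "\<bar>k\<bar> * exp w \<le> \<bar>k\<bar> * 1" using assms(2) by (intro mult_left_mono) auto
  then show ?thesis using assms(1) by (simp add: abs_mult)
qed

text \<open>
  \<open>u y\<close> is the probability of \<open>X\<^sub>e \<le> z\<close> under the starting point \<open>y\<close>.  On each of the intervals cut out by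
  \<open>z\<close> and \<open>a\<close> it is a combination of the exponentials with the roots of the characteristic polynomial;
  \<open>k1\<close>, \<open>k2\<close>, \<open>\<beta>\<close> and \<open>G\<close> below are determined by boundedness and \<open>C\<^sup>1\<close> matching at \<open>z\<close> and \<open>a\<close>.
\<close>

lemma resolvent_solution:
  fixes p m d a z q \<mu>\<^sub>1 \<mu>\<^sub>2 \<sigma>\<^sub>1 \<sigma>\<^sub>2 :: real
  assumes pos: "0 < p" "0 < m" "0 < d" and za: "z < a"
    and quad: "p\<^sup>2 * \<sigma>\<^sub>1\<^sup>2 / 2 - \<mu>\<^sub>1 * p = q" "m\<^sup>2 * \<sigma>\<^sub>1\<^sup>2 / 2 + \<mu>\<^sub>1 * m = q" "d\<^sup>2 * \<sigma>\<^sub>2\<^sup>2 / 2 - \<mu>\<^sub>2 * d = q"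
  obtains u u1 u2 C where "\<And>y. (u has_real_derivative u1 y) (at y)"
    "\<And>y. (u1 has_real_derivative u2 y) (at y within {..y})"
    "\<And>y. \<bar>u y\<bar> \<le> C" "\<And>y. \<bar>u1 y\<bar> \<le> C" "\<And>x y. \<bar>u1 x - u1 y\<bar> \<le> C * \<bar>x - y\<bar>"
    "\<And>y. y \<le> a \<Longrightarrow> q * u y - (u1 y * \<mu>\<^sub>1 + u2 y * \<sigma>\<^sub>1\<^sup>2 / 2) = q * indicator {..z} y"
    "\<And>y. a < y \<Longrightarrow> q * u y - (u1 y * \<mu>\<^sub>2 + u2 y * \<sigma>\<^sub>2\<^sup>2 / 2) = 0"
    "\<And>y. a \<le> y \<Longrightarrow> u y = m * exp (p * (z - a)) / (d + m) * exp (- d * (y - a))"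
proof -
  define S where "S = p + m"
  have S: "0 < S" using pos by (simp add: S_def)
  \<comment> \<open>At \<open>z\<close> the \<open>\<beta>\<close> terms agree on both sides, so
    matching values means \<open>k1 + k2 = 1\<close> and matching slopes means
    \<open>k1 * m = k2 * p\<close>.\<close>
  define k1 where "k1 = p / S"
  define k2 where "k2 = m / S"
  have k: "k1 + k2 = 1" "k1 * m = k2 * p" "\<bar>k1\<bar> \<le> 1" "\<bar>k2\<bar> \<le> 1"
    using pos S by (auto simp: k1_def k2_def S_def add_divide_distrib[symmetric])
  \<comment> \<open>Matching values at \<open>a\<close> gives \<open>\<beta>\<close> in terms of
    \<open>G\<close>; inserted into the matching of slopes, \<open>match\<close>, it leaves a linear
    equation for \<open>G\<close> with factor \<open>d + m\<close>.\<close>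
  define G where "G = m * exp (p * (z - a)) / (d + m)"
  define \<beta> where "\<beta> = G - k2 * exp (p * (z - a))"
  have match: "- p * (k2 * exp (p * (z - a))) + m * \<beta> = - d * G"
  proof -
    have "G * (d + m) = m * exp (p * (z - a))" using pos by (simp add: G_def)
    moreover have "(p + m) * (k2 * exp (p * (z - a))) = m * exp (p * (z - a))" using S by (simp add: k2_def S_def)
    ultimately show ?thesis unfolding \<beta>_def by (simp add: algebra_simps)
  qed
  define uL uL1 uL2 uM uM1 uM2 uR uR1 uR2 where
    "uL y = 1 + (- k1) * exp (m * (y - z)) + \<beta> * exp (m * (y - a))" and
    "uL1 y = (- k1 * m) * exp (m * (y - z)) + (\<beta> * m) * exp (m * (y - a))" and
    "uL2 y = (- k1 * m\<^sup>2) * exp (m * (y - z)) + (\<beta> * m\<^sup>2) * exp (m * (y - a))" and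
    "uM y = k2 * exp (- p * (y - z)) + \<beta> * exp (m * (y - a))" and
    "uM1 y = (- k2 * p) * exp (- p * (y - z)) + (\<beta> * m) * exp (m * (y - a))" and
    "uM2 y = (k2 * p\<^sup>2) * exp (- p * (y - z)) + (\<beta> * m\<^sup>2) * exp (m * (y - a))" and
    "uR y = G * exp (- d * (y - a))" and
    "uR1 y = (- G * d) * exp (- d * (y - a))" and
    "uR2 y = (G * d\<^sup>2) * exp (- d * (y - a))" for y
  note defs = uL_def uL1_def uL2_def uM_def uM1_def uM2_def uR_def uR1_def uR2_def
  have der: "(uL has_real_derivative uL1 y) (at y)" "(uL1 has_real_derivative uL2 y) (at y)"
    "(uM has_real_derivative uM1 y) (at y)" "(uM1 has_real_derivative uM2 y) (at y)"
    "(uR has_real_derivative uR1 y) (at y)" "(uR1 has_real_derivative uR2 y) (at y)" for y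
    unfolding defs[abs_def] by (auto intro!: derivative_eq_intros simp: power2_eq_square)
  have za': "exp (- p * (a - z)) = exp (p * (z - a))" by (rule arg_cong[of _ _ exp]) (simp add: algebra_simps)
  have gluez: "uL z = uM z" "uL1 z = uM1 z"
    using k by (auto simp: uL_def uM_def uL1_def uM1_def)
  have gluea: "uM a = uR a" "uM1 a = uR1 a"
  proof -
    show "uM a = uR a" by (simp only: uM_def uR_def za') (simp add: \<beta>_def)
    show "uM1 a = uR1 a" using match by (simp only: uM1_def uR1_def za') (simp add: algebra_simps)
  qed
  define w w1 w2 where "w y = (if y \<le> a then uM y else uR y)" and "w1 y = (if y \<le> a then uM1 y else uR1 y)"
    and "w2 y = (if y \<le> a then uM2 y else uR2 y)" for y
  define u u1 u2 where "u y = (if y \<le> z then uL y else w y)" and "u1 y = (if y \<le> z then uL1 y else w1 y)"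
    and "u2 y = (if y \<le> z then uL2 y else w2 y)" for y
  have wz: "w z = uM z" "w1 z = uM1 z" using za by (simp_all add: w_def w1_def)
  have wd: "(w has_real_derivative w1 y) (at y)" for y
    unfolding w_def[abs_def] w1_def by (rule has_real_derivative_glue[OF der(3,5) gluea])
  have ud: "(u has_real_derivative u1 y) (at y)" for y
    unfolding u_def[abs_def] u1_def by (rule has_real_derivative_glue[OF der(1) wd]) (simp_all add: wz gluez)
  have w1d: "(w1 has_real_derivative w2 y) (at y within {..y})" for y
    unfolding w1_def[abs_def] w2_def
    by (rule left_derivative_glue) (rule has_field_derivative_at_within[OF der(4)], rule has_field_derivative_at_within[OF der(6)])
  have u1d: "(u1 has_real_derivative u2 y) (at y within {..y})" for y
    unfolding u1_def[abs_def] u2_def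
    by (rule left_derivative_glue) (rule has_field_derivative_at_within[OF der(2)], rule w1d)

  define E where "E = 1 + p + m + d"
  have E: "1 \<le> E" "p \<le> E" "m \<le> E" "d \<le> E" using pos by (simp_all add: E_def)
  \<comment> \<open>\<open>E\<^sup>2\<close> dominates 1, each exponent and its square, hence every
    factor produced by two differentiations. The 2 stands for the constant 1 and a coefficient
    \<open>k1\<close> or \<open>k2\<close>, both at most 1.\<close>
  define C where "C = (2 + \<bar>\<beta>\<bar> + \<bar>G\<bar>) * E\<^sup>2"
  have E2: "1 \<le> E\<^sup>2" "E \<le> E\<^sup>2" using one_le_power[OF E(1), of 2] power_increasing[of 1 2 E] E(1) by simp_all
  have c1: "t \<le> E\<^sup>2" "t\<^sup>2 \<le> E\<^sup>2" if "0 < t" "t \<le> E" for t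
    using that E2 power_mono[of t E 2] by auto
  have fac: "\<bar>x * t\<bar> \<le> \<kappa> * E\<^sup>2" if "\<bar>x\<bar> \<le> \<kappa>" "0 \<le> t" "t \<le> E\<^sup>2" for x t \<kappa> :: real
    unfolding abs_mult using that by (intro mult_mono) auto
  have nn: "0 \<le> 1 * E\<^sup>2" "0 \<le> \<bar>\<beta>\<bar> * E\<^sup>2" "0 \<le> \<bar>G\<bar> * E\<^sup>2" by simp_all
  have Csum: "C = 1 * E\<^sup>2 + 1 * E\<^sup>2 + \<bar>\<beta>\<bar> * E\<^sup>2 + \<bar>G\<bar> * E\<^sup>2" by (simp add: C_def algebra_simps)
  have one: "\<bar>1\<bar> \<le> 1 * E\<^sup>2" using E2(1) by simp
  have CB: "1 * E\<^sup>2 + 1 * E\<^sup>2 + \<bar>\<beta>\<bar> * E\<^sup>2 \<le> C" "1 * E\<^sup>2 + \<bar>\<beta>\<bar> * E\<^sup>2 \<le> C" "\<bar>G\<bar> * E\<^sup>2 \<le> C"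
    unfolding Csum using nn by simp_all
  note bound2 = order_trans[OF order_trans[OF abs_triangle_ineq add_mono] CB(2)]
  have fk: "\<bar>- k1\<bar> \<le> 1" "\<bar>- k2\<bar> \<le> 1" "\<bar>- G\<bar> \<le> \<bar>G\<bar>" using k by auto
  have t0: "0 \<le> t\<^sup>2" for t :: real by simp
  note fm = c1[OF pos(2) E(3)] and fp = c1[OF pos(1) E(2)] and fd = c1[OF pos(3) E(4)]
  have bL: "\<bar>uL y\<bar> \<le> C" "\<bar>uL1 y\<bar> \<le> C" "\<bar>uL2 y\<bar> \<le> C" if y: "y \<le> z" for y
  proof -
    have e: "m * (y - z) \<le> 0" "m * (y - a) \<le> 0" using pos y za by (auto intro!: mult_nonneg_nonpos)
    have t: "\<bar>- k1 * exp (m * (y - z))\<bar> \<le> 1 * E\<^sup>2" "\<bar>\<beta> * exp (m * (y - a))\<bar> \<le> \<bar>\<beta>\<bar> * E\<^sup>2"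
      using fac[OF fk(1), of 1] fac[OF order_refl, of 1 \<beta>] E2 by (auto intro!: abs_mult_exp_le e)
    show "\<bar>uL y\<bar> \<le> C" unfolding uL_def by (rule order_trans[OF order_trans[OF abs_triangle_ineq add_mono[OF order_trans[OF abs_triangle_ineq add_mono[OF one t(1)]] t(2)]] CB(1)])
    have t: "\<bar>(- k1 * m) * exp (m * (y - z))\<bar> \<le> 1 * E\<^sup>2" "\<bar>(\<beta> * m) * exp (m * (y - a))\<bar> \<le> \<bar>\<beta>\<bar> * E\<^sup>2"
      by (rule abs_mult_exp_le[OF fac[OF fk(1) less_imp_le[OF pos(2)] fm(1)] e(1)],
          rule abs_mult_exp_le[OF fac[OF order_refl less_imp_le[OF pos(2)] fm(1)] e(2)])
    show "\<bar>uL1 y\<bar> \<le> C" unfolding uL1_def by (rule bound2[OF t])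
    have t: "\<bar>(- k1 * m\<^sup>2) * exp (m * (y - z))\<bar> \<le> 1 * E\<^sup>2" "\<bar>(\<beta> * m\<^sup>2) * exp (m * (y - a))\<bar> \<le> \<bar>\<beta>\<bar> * E\<^sup>2"
      by (rule abs_mult_exp_le[OF fac[OF fk(1) t0 fm(2)] e(1)], rule abs_mult_exp_le[OF fac[OF order_refl t0 fm(2)] e(2)])
    show "\<bar>uL2 y\<bar> \<le> C" unfolding uL2_def by (rule bound2[OF t])
  qed
  have bM: "\<bar>uM y\<bar> \<le> C" "\<bar>uM1 y\<bar> \<le> C" "\<bar>uM2 y\<bar> \<le> C" if y: "z \<le> y" "y \<le> a" for y
  proof -
    have e: "- p * (y - z) \<le> 0" "m * (y - a) \<le> 0" using pos y by (auto intro!: mult_nonneg_nonpos)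
    have t: "\<bar>k2 * exp (- p * (y - z))\<bar> \<le> 1 * E\<^sup>2" "\<bar>\<beta> * exp (m * (y - a))\<bar> \<le> \<bar>\<beta>\<bar> * E\<^sup>2"
      using fac[OF k(4), of 1] fac[OF order_refl, of 1 \<beta>] E2 by (auto intro!: abs_mult_exp_le e[simplified])
    show "\<bar>uM y\<bar> \<le> C" unfolding uM_def by (rule bound2[OF t])
    have t: "\<bar>(- k2 * p) * exp (- p * (y - z))\<bar> \<le> 1 * E\<^sup>2" "\<bar>(\<beta> * m) * exp (m * (y - a))\<bar> \<le> \<bar>\<beta>\<bar> * E\<^sup>2"
      by (rule abs_mult_exp_le[OF fac[OF fk(2) less_imp_le[OF pos(1)] fp(1)] e(1)],
          rule abs_mult_exp_le[OF fac[OF order_refl less_imp_le[OF pos(2)] fm(1)] e(2)])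
    show "\<bar>uM1 y\<bar> \<le> C" unfolding uM1_def by (rule bound2[OF t])
    have t: "\<bar>(k2 * p\<^sup>2) * exp (- p * (y - z))\<bar> \<le> 1 * E\<^sup>2" "\<bar>(\<beta> * m\<^sup>2) * exp (m * (y - a))\<bar> \<le> \<bar>\<beta>\<bar> * E\<^sup>2"
      by (rule abs_mult_exp_le[OF fac[OF k(4) t0 fp(2)] e(1)], rule abs_mult_exp_le[OF fac[OF order_refl t0 fm(2)] e(2)])
    show "\<bar>uM2 y\<bar> \<le> C" unfolding uM2_def by (rule bound2[OF t])
  qed
  have bR: "\<bar>uR y\<bar> \<le> C" "\<bar>uR1 y\<bar> \<le> C" "\<bar>uR2 y\<bar> \<le> C" if y: "a \<le> y" for y
  proof -
    have e: "- d * (y - a) \<le> 0" using pos y by (auto intro!: mult_nonneg_nonneg)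
    have "\<bar>(G * 1) * exp (- d * (y - a))\<bar> \<le> \<bar>G\<bar> * E\<^sup>2"
      by (rule abs_mult_exp_le[OF fac[OF order_refl zero_le_one E2(1)] e])
    from order_trans[OF this CB(3)] show "\<bar>uR y\<bar> \<le> C" unfolding uR_def mult_1_right .
    have "\<bar>(- G * d) * exp (- d * (y - a))\<bar> \<le> \<bar>G\<bar> * E\<^sup>2"
      by (rule abs_mult_exp_le[OF fac[OF fk(3) less_imp_le[OF pos(3)] fd(1)] e])
    from order_trans[OF this CB(3)] show "\<bar>uR1 y\<bar> \<le> C" unfolding uR1_def .
    have "\<bar>(G * d\<^sup>2) * exp (- d * (y - a))\<bar> \<le> \<bar>G\<bar> * E\<^sup>2"
      by (rule abs_mult_exp_le[OF fac[OF order_refl t0 fd(2)] e])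
    from order_trans[OF this CB(3)] show "\<bar>uR2 y\<bar> \<le> C" unfolding uR2_def .
  qed
  have ub: "\<bar>u y\<bar> \<le> C" and u1b: "\<bar>u1 y\<bar> \<le> C" for y
    using bL[of y] bM[of y] bR[of y] by (auto simp: u_def u1_def w_def w1_def)
  have lipT: "\<bar>f x - f y\<bar> \<le> C * \<bar>x - y\<bar>"
    if "convex T" "\<And>y. (f has_real_derivative f' y) (at y)" "\<And>y. y \<in> T \<Longrightarrow> \<bar>f' y\<bar> \<le> C" "x \<in> T" "y \<in> T"
    for f f' :: "real \<Rightarrow> real" and T x y
    using field_differentiable_bound[of T f f' C x y] that by (auto intro: has_field_derivative_at_within)
  \<comment> \<open>Only to the right of \<open>z\<close>: the derivative of the middle branch is
    unbounded at minus infinity.\<close>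
  have lw: "\<bar>w1 x - w1 y\<bar> \<le> C * \<bar>x - y\<bar>" if "x \<in> {z..}" "y \<in> {z..}" for x y
    unfolding w1_def
  proof (rule lipschitz_glue[where S="{z..}"])
    show "\<bar>uM1 x - uM1 y\<bar> \<le> C * \<bar>x - y\<bar>" if "x \<in> {z..}" "y \<in> {z..}" "x \<le> a" "y \<le> a" for x y
      by (rule lipT[where T="{z..a}", OF _ der(4) bM(3)]) (use that in auto)
    show "\<bar>uR1 x - uR1 y\<bar> \<le> C * \<bar>x - y\<bar>" if "x \<in> {z..}" "y \<in> {z..}" "a \<le> x" "a \<le> y" for x y
      by (rule lipT[where T="{a..}", OF _ der(6) bR(3)]) (use that in auto)
  qed (use that za gluea in auto)
  have lu: "\<bar>u1 x - u1 y\<bar> \<le> C * \<bar>x - y\<bar>" for x y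
    unfolding u1_def
  proof (rule lipschitz_glue[where S=UNIV])
    show "\<bar>uL1 x - uL1 y\<bar> \<le> C * \<bar>x - y\<bar>" if "x \<le> z" "y \<le> z" for x y
      by (rule lipT[where T="{..z}", OF _ der(2) bL(3)]) (use that in auto)
    show "\<bar>w1 x - w1 y\<bar> \<le> C * \<bar>x - y\<bar>" if "z \<le> x" "z \<le> y" for x y
      by (rule lw) (use that in auto)
  qed (use wz gluez in auto)

  have expm: "q * (c * e) - ((c * m) * e * \<mu>\<^sub>1 + (c * m\<^sup>2) * e * \<sigma>\<^sub>1\<^sup>2 / 2) = 0" for c e
    unfolding quad(2)[symmetric] by (simp add: algebra_simps)
  have expp: "q * (c * e) - ((- c * p) * e * \<mu>\<^sub>1 + (c * p\<^sup>2) * e * \<sigma>\<^sub>1\<^sup>2 / 2) = 0" for c e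
    unfolding quad(1)[symmetric] by (simp add: algebra_simps)
  have expd: "q * (c * e) - ((- c * d) * e * \<mu>\<^sub>2 + (c * d\<^sup>2) * e * \<sigma>\<^sub>2\<^sup>2 / 2) = 0" for c e
    unfolding quad(3)[symmetric] by (simp add: algebra_simps)
  have odeL: "q * uL y - (uL1 y * \<mu>\<^sub>1 + uL2 y * \<sigma>\<^sub>1\<^sup>2 / 2) = q" for y
    using expm[of "- k1" "exp (m * (y - z))"] expm[of \<beta> "exp (m * (y - a))"]
    unfolding uL_def uL1_def uL2_def by (simp only: distrib_left distrib_right add_divide_distrib)
  have odeM: "q * uM y - (uM1 y * \<mu>\<^sub>1 + uM2 y * \<sigma>\<^sub>1\<^sup>2 / 2) = 0" for y
    using expp[of k2 "exp (- p * (y - z))"] expm[of \<beta> "exp (m * (y - a))"]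
    unfolding uM_def uM1_def uM2_def by (simp only: distrib_left distrib_right add_divide_distrib)
  have odeR: "q * uR y - (uR1 y * \<mu>\<^sub>2 + uR2 y * \<sigma>\<^sub>2\<^sup>2 / 2) = 0" for y
    using expd[of G "exp (- d * (y - a))"] unfolding uR_def uR1_def uR2_def .
  show thesis
  proof (rule that[OF ud u1d ub u1b lu])
    show "q * u y - (u1 y * \<mu>\<^sub>1 + u2 y * \<sigma>\<^sub>1\<^sup>2 / 2) = q * indicator {..z} y" if "y \<le> a" for y
      using odeL[of y] odeM[of y] that by (simp add: u_def u1_def u2_def w_def w1_def w2_def)
    show "q * u y - (u1 y * \<mu>\<^sub>2 + u2 y * \<sigma>\<^sub>2\<^sup>2 / 2) = 0" if "a < y" for y
      using odeR[of y] that za by (simp add: u_def u1_def u2_def w_def w1_def w2_def)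
    show "u y = m * exp (p * (z - a)) / (d + m) * exp (- d * (y - a))" if "a \<le> y" for y
    proof -
      have "u y = uR y" using that za gluea(1) by (cases "y = a") (simp_all add: u_def w_def)
      then show ?thesis by (simp add: uR_def G_def)
    qed
  qed
qed

section \<open>From the solution of the equation to the density\<close>

context brownian_space
begin

text \<open>\<open>F\<close> is a filtration to which \<open>B\<close> is adapted, and by the usual
  conditions it contains the null sets from time 0 on.\<close>

lemma augmented_subset:
  assumes "0 \<le> t"
  shows "sets (augmented_filtration M B t) \<subseteq> sets (F t)"
proof -
  have "(\<lambda>\<omega>. \<lambda>s\<in>{0..t}. B s \<omega>) \<in> measurable (F t) (Pi\<^sub>M {0..t} (\<lambda>_. borel))"
    by (rule measurable_restrict) (auto intro: B_adapted)
  from measurable_sets[OF this]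
  have "{(\<lambda>\<omega>. \<lambda>s\<in>{0..t}. B s \<omega>) -` A \<inter> space M |A. A \<in> sets (Pi\<^sub>M {0..t} (\<lambda>_. borel))} \<subseteq> sets (F t)"
    by (auto simp: space_F)
  from sets.sigma_sets_subset[OF this]
  have "sets (path_algebra (space M) {0..t} B) \<subseteq> sets (F t)"
    unfolding path_algebra_def sets_vimage_algebra by (simp add: space_F)
  moreover have "null_sets M \<subseteq> sets (F t)"
    using null_sets_subset sets_F_mono[OF assms] by blast
  ultimately have sub: "sets (path_algebra (space M) {0..t} B) \<union> null_sets M \<subseteq> sets (F t)" by blast
  then have "sigma_sets (space M) (sets (path_algebra (space M) {0..t} B) \<union> null_sets M) \<subseteq> sets (F t)"
    using sets.sigma_sets_subset[of _ "F t"] by (simp add: space_F)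
  moreover have "sets (path_algebra (space M) {0..t} B) \<union> null_sets M \<subseteq> Pow (space M)"
    using sub sets.space_closed[of "F t"] unfolding space_F by (rule order_trans)
  ultimately show ?thesis
    unfolding augmented_filtration_def by (simp add: sets_measure_of)
qed

end

text \<open>Needed for \<open>X (e \<omega>) \<omega>\<close>: where \<open>e\<close> is negative, a
  null event, the value of \<open>X\<close> is arbitrary, and only completeness makes the
  composition measurable.\<close>

lemma (in complete_measure) borel_measurable_AE_eq:
  fixes f g :: "'a \<Rightarrow> real"
  assumes g: "g \<in> borel_measurable M" and ae: "AE x in M. f x = g x"
  shows "f \<in> borel_measurable M"
proof (rule measurableI)
  fix A :: "real set" assume "A \<in> sets borel"
  then have gA: "g -` A \<inter> space M \<in> sets M" using measurable_sets[OF g] by simp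
  have "AE x in M. x \<in> g -` A \<inter> space M \<longleftrightarrow> x \<in> f -` A \<inter> space M"
    using ae by eventually_elim auto
  then show "f -` A \<inter> space M \<in> sets M" by (rule in_sets_AE[OF _ gA Int_lower2])
qed simp

theorem theorem3p2:
  fixes M :: "'w measure" and F :: "real \<Rightarrow> 'w measure"
    and B X :: "real \<Rightarrow> 'w \<Rightarrow> real" and e :: "'w \<Rightarrow> real"
    and a \<mu>\<^sub>1 \<mu>\<^sub>2 \<sigma>\<^sub>1 \<sigma>\<^sub>2 q x :: real
  assumes "usual_filtered_prob_space M F"
    and "brownian_motion M F B"
    and "\<sigma>\<^sub>1 > 0" and "\<sigma>\<^sub>2 > 0" and "q > 0"
    and "strong_solution M F B
           (\<lambda>y. \<mu>\<^sub>1 * indicator {y. y \<le> a} y + \<mu>\<^sub>2 * indicator {y. y > a} y)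
           (\<lambda>y. \<sigma>\<^sub>1 * indicator {y. y \<le> a} y + \<sigma>\<^sub>2 * indicator {y. y > a} y) x X"
    and "distributed M lborel e (exponential_density q)"
    and "prob_space.indep_set M (sets (path_algebra (space M) {0..} X))
           (sets (vimage_algebra (space M) e borel))"
    and "x \<ge> a"
  shows "(\<lambda>\<omega>. X (e \<omega>) \<omega>) \<in> borel_measurable M \<and>
    restrict_space (distr M borel (\<lambda>\<omega>. X (e \<omega>) \<omega>)) {..<a} =
    density (restrict_space lborel {..<a})
      (\<lambda>z. ennreal (q / sqrt (2 * q * \<sigma>\<^sub>1\<^sup>2 + \<mu>\<^sub>1\<^sup>2)
         * ((delta_plus q \<mu>\<^sub>1 \<sigma>\<^sub>1 + delta_minus q \<mu>\<^sub>1 \<sigma>\<^sub>1) / (delta_plus q \<mu>\<^sub>2 \<sigma>\<^sub>2 + delta_minus q \<mu>\<^sub>1 \<sigma>\<^sub>1))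
         * exp (- delta_plus q \<mu>\<^sub>2 \<sigma>\<^sub>2 * (x - a)) * exp (delta_plus q \<mu>\<^sub>1 \<sigma>\<^sub>1 * (z - a))))"
proof -
  define b where "b y = \<mu>\<^sub>1 * indicator {y. y \<le> a} y + \<mu>\<^sub>2 * indicator {y. y > a} y" for y :: real
  define v where "v y = \<sigma>\<^sub>1 * indicator {y. y \<le> a} y + \<sigma>\<^sub>2 * indicator {y. y > a} y" for y :: real
  have sol: "strong_solution M F B b v x X" unfolding b_def[abs_def] v_def[abs_def] by (rule assms(6))
  interpret brownian_space M F B
    by (intro brownian_space.intro brownian_space_axioms.intro assms(1,2))
  interpret diffusion M F B b v "\<bar>\<mu>\<^sub>1\<bar> + \<bar>\<mu>\<^sub>2\<bar> + \<bar>\<sigma>\<^sub>1\<bar> + \<bar>\<sigma>\<^sub>2\<bar>" x X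
  proof
    show "b \<in> borel_measurable borel" "v \<in> borel_measurable borel"
      unfolding b_def[abs_def] v_def[abs_def] by measurable
    show "\<bar>b y\<bar> \<le> \<bar>\<mu>\<^sub>1\<bar> + \<bar>\<mu>\<^sub>2\<bar> + \<bar>\<sigma>\<^sub>1\<bar> + \<bar>\<sigma>\<^sub>2\<bar>" "\<bar>v y\<bar> \<le> \<bar>\<mu>\<^sub>1\<bar> + \<bar>\<mu>\<^sub>2\<bar> + \<bar>\<sigma>\<^sub>1\<bar> + \<bar>\<sigma>\<^sub>2\<bar>" for y
      unfolding b_def v_def by (cases "y \<le> a"; simp)+
    show "X t \<in> borel_measurable (F t)" if "0 \<le> t" for t
    proof -
      have "space (augmented_filtration M B t) = space (F t)"
        by (simp add: augmented_filtration_def space_measure_of_conv space_F)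
      moreover have "X t \<in> borel_measurable (augmented_filtration M B t)"
        using sol that by (simp add: strong_solution_def)
      ultimately show ?thesis
        using measurable_mono[OF order_refl refl augmented_subset[OF that], of borel] by auto
    qed
    show "continuous_on {0..} (\<lambda>t. X t \<omega>)" if "\<omega> \<in> space M" for \<omega>
      using sol that by (simp add: strong_solution_def)
    show "AE \<omega> in M. X 0 \<omega> = x" using sol by (simp add: strong_solution_def)
    show "\<exists>J. has_ito_integral M F B t (\<lambda>s \<omega>. v (X s \<omega>)) J \<and>
        (AE \<omega> in M. X t \<omega> = x + (LINT s:{0..t}|lborel. b (X s \<omega>)) + J \<omega>)" if "0 \<le> t" for t
      using sol that by (simp add: strong_solution_def)
  qed
  define p m d where "p = delta_plus q \<mu>\<^sub>1 \<sigma>\<^sub>1" and "m = delta_minus q \<mu>\<^sub>1 \<sigma>\<^sub>1" and "d = delta_plus q \<mu>\<^sub>2 \<sigma>\<^sub>2"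
  note \<delta>1 = delta_props[OF assms(5,3), of \<mu>\<^sub>1, folded p_def m_def]
  note \<delta>2 = delta_props[OF assms(5,4), of \<mu>\<^sub>2, folded d_def]
  have em [measurable]: "e \<in> borel_measurable M" using distributed_measurable[OF assms(7)] by simp
  \<comment> \<open>A version that avoids negative times altogether; it agrees with
    \<open>X (e \<omega>) \<omega>\<close> almost surely.\<close>
  define Xe where "Xe \<omega> = X (max 0 (e \<omega>)) \<omega>" for \<omega>
  have Xem [measurable]: "Xe \<in> borel_measurable M"
  proof -
    have "(\<lambda>\<omega>. (\<omega>, e \<omega>)) \<in> measurable M (M \<Otimes>\<^sub>M borel)" by measurable
    from measurable_compose[OF this X_joint'] show ?thesis by (simp add: Xe_def[abs_def])
  qed
  have "AE \<omega> in M. 0 \<le> e \<omega>"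
  proof -
    have "prob {\<omega> \<in> space M. 0 < e \<omega>} = 1"
      using exponential_distributedD_gt[OF assms(7) order_refl assms(5)] by simp
    then have "AE \<omega> in M. \<omega> \<in> {\<omega> \<in> space M. 0 < e \<omega>}" by (intro AE_prob_1)
    then show ?thesis by eventually_elim auto
  qed
  then have XeAE: "AE \<omega> in M. X (e \<omega>) \<omega> = Xe \<omega>" by eventually_elim (simp add: Xe_def)
  have meas: "(\<lambda>\<omega>. X (e \<omega>) \<omega>) \<in> borel_measurable M" by (rule borel_measurable_AE_eq[OF Xem XeAE])
  have distr: "distr M borel (\<lambda>\<omega>. X (e \<omega>) \<omega>) = distr M borel Xe"
    by (rule distr_cong_AE[OF refl refl XeAE meas Xem])
  define c where "c = q / sqrt (2 * q * \<sigma>\<^sub>1\<^sup>2 + \<mu>\<^sub>1\<^sup>2) * ((p + m) / (d + m)) * exp (- d * (x - a))"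
  have c0: "0 \<le> c" using assms(5) \<delta>1(1,2,5) \<delta>2(1) by (simp add: c_def)
  \<comment> \<open>This identifies the primitive of the claimed density on the half-line with the
    value \<open>u x\<close> of the resolvent solution.\<close>
  have cp: "c / p = m / (d + m) * exp (- d * (x - a))"
  proof -
    have "q / sqrt (2 * q * \<sigma>\<^sub>1\<^sup>2 + \<mu>\<^sub>1\<^sup>2) * (p + m) = m * p"
      using \<delta>1(5,6) by (simp add: divide_eq_eq)
    then show ?thesis using \<delta>1(1) unfolding c_def by simp
  qed
  have cdf: "emeasure (distr M borel Xe) {..z} = ennreal (c / p * exp (p * (z - a)))" if z: "z < a" for z
  proof -
    have mz: "measure (distr M borel Xe) {..z} = c / p * exp (p * (z - a))"
    proof (rule resolvent_solution[OF \<delta>1(1,2) \<delta>2(1) z \<delta>1(3,4) \<delta>2(3)])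
      fix u u1 u2 :: "real \<Rightarrow> real" and C :: real
      assume u: "\<And>y. (u has_real_derivative u1 y) (at y)"
        "\<And>y. (u1 has_real_derivative u2 y) (at y within {..y})"
        "\<And>y. \<bar>u y\<bar> \<le> C" "\<And>y. \<bar>u1 y\<bar> \<le> C" "\<And>x y. \<bar>u1 x - u1 y\<bar> \<le> C * \<bar>x - y\<bar>"
        and ode1: "\<And>y. y \<le> a \<Longrightarrow> q * u y - (u1 y * \<mu>\<^sub>1 + u2 y * \<sigma>\<^sub>1\<^sup>2 / 2) = q * indicator {..z} y"
        and ode2: "\<And>y. a < y \<Longrightarrow> q * u y - (u1 y * \<mu>\<^sub>2 + u2 y * \<sigma>\<^sub>2\<^sup>2 / 2) = 0"
        and ux: "\<And>y. a \<le> y \<Longrightarrow> u y = m * exp (p * (z - a)) / (d + m) * exp (- d * (y - a))"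
      \<comment> \<open>At the jump \<open>y = a\<close> the coefficients have their left values and
        \<open>u2\<close> is the left derivative, so the equation holds at every point without
        exception.\<close>
      have "u y - gen u1 u2 y / q = indicator {..z} y" for y
      proof -
        have "q * u y - gen u1 u2 y = q * indicator {..z} y"
          using ode1[of y] ode2[of y] z by (cases "y \<le> a") (simp_all add: gen_def b_def v_def)
        then show ?thesis using assms(5) by (simp add: field_simps)
      qed
      then have "expectation (\<lambda>\<omega>. indicator {..z} (Xe \<omega>)) = u x"
        using resolvent_identity_left[OF assms(7,5,8) u] by (simp add: Xe_def)
      moreover have "expectation (\<lambda>\<omega>. indicator {..z} (Xe \<omega>)) = measure (distr M borel Xe) {..z}"
        using integral_distr[OF Xem, of "indicator {..z} :: real \<Rightarrow> real"] by simp
      moreover have "u x = c / p * exp (p * (z - a))"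
        unfolding ux[OF assms(9)] cp by simp
      ultimately show "measure (distr M borel Xe) {..z} = c / p * exp (p * (z - a))" by simp
    qed
    interpret L: prob_space "distr M borel Xe" by (rule prob_space_distr[OF Xem])
    show ?thesis by (simp only: L.emeasure_eq_measure mz)
  qed
  define g where "g z = ennreal (c * exp (p * (z - a)))" for z
  have gm [measurable]: "g \<in> borel_measurable borel" unfolding g_def[abs_def] by measurable
  have below: "emeasure (distr M borel Xe) A = (\<integral>\<^sup>+w. g w * indicator A w \<partial>lborel)"
    if A: "A \<in> sets borel" "A \<subseteq> {..<a}" for A
  proof -
    \<comment> \<open>Cut off at \<open>a\<close>, because the exponential grows to the right and
      its density on the whole line would have infinite mass. The point \<open>a\<close> is included
      so that the total mass is read off from \<open>Nz\<close>.\<close>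
    define N where "N = density lborel (\<lambda>w. g w * indicator {..a} w)"
    have NE: "emeasure N E = (\<integral>\<^sup>+w. g w * indicator ({..a} \<inter> E) w \<partial>lborel)" if "E \<in> sets borel" for E
      unfolding N_def using that by (subst emeasure_density) (auto intro!: nn_integral_cong split: split_indicator)
    have Nz: "emeasure N {..z} = ennreal (c / p * exp (p * (z - a)))" if "z \<le> a" for z
      using nn_integral_exp_atMost[OF \<delta>1(1) c0, of a z] that by (simp add: NE g_def min_absorb2)
    have "emeasure (distr M borel Xe) A = emeasure N A"
    proof (rule emeasure_eq_below[OF _ _ _ _ _ A])
      show "finite_measure (distr M borel Xe)"
        using prob_space_distr[OF Xem] by (rule prob_space.axioms)
      have "space N = UNIV" by (simp add: N_def)
      then have "emeasure N (space N) = emeasure N {..a}" using NE[of UNIV] NE[of "{..a}"] by simp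
      then show "finite_measure N" using Nz[of a] by (intro finite_measureI) simp
      show "emeasure (distr M borel Xe) {..z} = emeasure N {..z}" if "z < a" for z
        using cdf[OF that] Nz[of z] that by simp
    qed (simp_all add: N_def)
    also have "\<dots> = (\<integral>\<^sup>+w. g w * indicator A w \<partial>lborel)"
    proof -
      have "{..a} \<inter> A = A" using A(2) by auto
      then show ?thesis by (simp add: NE[OF A(1)])
    qed
    finally show ?thesis .
  qed
  let ?L = "restrict_space (distr M borel Xe) {..<a}" and ?R = "density (restrict_space lborel {..<a}) g"
  have "?L = ?R"
  proof (rule measure_eqI)
    show "sets (?L) = sets (?R)"
      by (simp add: sets_restrict_space)
    fix A assume "A \<in> sets (?L)"
    then have A: "A \<in> sets borel" "A \<subseteq> {..<a}"
      by (auto simp: sets_restrict_space)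
    have A': "A \<in> sets (restrict_space lborel {..<a})"
      using A by (auto simp: sets_restrict_space)
    have "emeasure (?L) A = emeasure (distr M borel Xe) A"
      using A by (intro emeasure_restrict_space) auto
    also have "\<dots> = (\<integral>\<^sup>+w. g w * indicator A w \<partial>lborel)" by (rule below[OF A])
    also have "\<dots> = (\<integral>\<^sup>+w. g w * indicator A w * indicator {..<a} w \<partial>lborel)"
      using A(2) by (intro nn_integral_cong) (auto split: split_indicator)
    also have "\<dots> = (\<integral>\<^sup>+w. g w * indicator A w \<partial>restrict_space lborel {..<a})"
      by (rule nn_integral_restrict_space[symmetric]) simp
    also have "\<dots> = emeasure (?R) A"
      using A' by (intro emeasure_density[symmetric] measurable_restrict_space1) auto
    finally show "emeasure (?L) A = emeasure (?R) A" .
  qed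
  then show ?thesis
    unfolding distr using meas by (simp add: g_def[abs_def] c_def p_def m_def d_def)
qed

end
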